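(* Let $G$ be a Lie group of dimension $n\ge2$, $E_{H,F}$ a Courant algebroid of type $B_n$ over $G$ with left-invariant $H,F$, $E_-=\{X-g(X)\mid X\in TG\}$ a left-invariant generalized metric on $E_{H,F}$, $\delta\in\tilde E^*$ a left-invariant divergence operator, $(v_a)_{1\le a\le n}$ a $g$-orthonormal basis of $\mathfrak{g}$ and $(e_A)_{0\le A\le2n}$ the induced basis of $\tilde E$. Then $E_-$ is odd generalized Einstein with divergence $\delta$ if and only if for any $1\le a\le n$ and $n+1\le i\le 2n$ (with $i'=i-n$, $j'=j-n$) $$\sum_{b=1}^n\Big(\sum_{j=n+1}^{2n}B_{bi}^jB_{aj}^b+B_{ia}^b\delta_b\Big)+F_{i'a}\delta_0-\sum_{b=1}^n\epsilon_bF_{i'b}F_{ab}=0,$$ $$\sum_{b=1}^n\epsilon_b\Big(\sum_{j=n+1}^{2n}\epsilon_{j'}F_{j'b}B_{bij}+F_{i'b}\delta_b\Big)=0,$$ $$\sum_{b=1}^nF_{ab}\,\epsilon_b(\delta_b-\delta_{b+n})=0,$$ $$\sum_{b=1}^n\epsilon_b\big(B_{iab}\delta_b-B_{ia\,b+n}\delta_{b+n}\big)+\delta_0F_{i'a}=0.$$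
   Context: Let $G$ have Lie algebra $\mathfrak{g}$ (left-invariant vector fields) and let $H\in\Omega^3(G)$, $F\in\Omega^2(G)$ be left-invariant with $dF=0$ and $dH+F\wedge F=0$. $E=E_{H,F}$ is the bundle $TG\oplus T^*G\oplus\mathbb{R}$ with anchor $\pi$ the projection to $TG$, scalar product $\langle X+\xi+\lambda,Y+\eta+\mu\rangle=\frac12(\xi(Y)+\eta(X))+\lambda\mu$ and Dorfman bracket $$[X+\xi+\lambda,Y+\eta+\mu]_{H,F}=\mathcal{L}_X(Y+\eta)-i_Yd\xi+2\mu\,d\lambda+i_Xi_YH-2(\mu\, i_XF-\lambda\, i_YF)+X(\mu)-Y(\lambda)+F(X,Y).$$ Left-invariant sections form $\tilde E=\mathfrak{g}\oplus\mathfrak{g}^*\oplus\mathbb{R}$. Here $g$ is a left-invariant pseudo-Riemannian metric, $g(X)=g(X,\cdot)$, and $E_+=E_-^\perp$. A generalized connection is a linear map $D:\Gamma(E)\to\Gamma(E^*\otimes E)$ with $D_u(fv)=\pi(u)(f)v+fD_uv$ and $\pi(u)\langle v,w\rangle=\langle D_uv,w\rangle+\langle v,D_uw\rangle$. Its torsion is $T^D(u,v,w)=\langle D_uv-D_vu-[u,v]_{H,F},w\rangle+\langle v,D_wu\rangle$; $D$ is Levi-Civita for $E_-$ if $T^D=0$ and $D_u\Gamma(E_-)\subset\Gamma(E_-)$ for all $u$. A divergence operator is an additive map $\delta:\Gamma(E)\to C^\infty(G)$ with $\delta(fu)=\pi(u)(f)+f\delta(u)$; left-invariant ones are identified with elements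 of $\tilde E^*$; $\delta^D(u)=\mathrm{tr}\,Du$. For a Levi-Civita generalized connection $D$ of $E_-$ with $\delta^D=\delta$, put $R^D(u,v)w=D_uD_vw-D_vD_uw-D_{[u,v]_{H,F}}w$ and $\mathrm{Ric}^{\delta,+}(u,v)=\mathrm{tr}(E_+\ni w\mapsto R^D(w,u)v)$ ($u\in E_-,v\in E_+$), $\mathrm{Ric}^{\delta,-}(u,v)=\mathrm{tr}(E_-\ni w\mapsto R^D(w,u)v)$ ($u\in E_+,v\in E_-$). These are tensors depending only on $(E_-,\delta)$. $E_-$ is odd generalized Einstein with divergence $\delta$ if $\mathrm{Ric}^{\delta,+}=0$ and $\mathrm{Ric}^{\delta,-}=0$. Notation. $\epsilon_a=g(v_a,v_a)\in\{\pm1\}$ for $1\le a\le n$; $\epsilon_0=1$; $\epsilon_{n+a}=-\epsilon_a$. $e_0=1$, $e_a=v_a+g(v_a)$, $e_{n+a}=v_a-g(v_a)$ for $1\le a\le n$. $\delta_A=\delta(e_A)$, $F_{ab}=F(v_a,v_b)$, $B_{ABC}=\langle[e_A,e_B]_{H,F},e_C\rangle$, $B_{AB}^C=\epsilon_CB_{ABC}$. *)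

theory Defs
  imports
    "HOL-Analysis.Analysis"
    "HOL-Library.Function_Algebras"
    "HOL-Library.FuncSet"
    "HOL-Algebra.Group"
begin

section \<open>Smooth manifolds and Lie groups\<close>

text \<open>\<open>Ck k S f\<close> is only used for open \<open>S\<close>, where it is the usual notion of class $C^k$.\<close>

fun Ck :: "nat \<Rightarrow> 'e::euclidean_space set \<Rightarrow> ('e \<Rightarrow> 'f::real_normed_vector) \<Rightarrow> bool" where
  "Ck 0 S f \<longleftrightarrow> continuous_on S f"
| "Ck (Suc k) S f \<longleftrightarrow> (\<forall>x\<in>S. f differentiable (at x)) \<and>
     (\<forall>b\<in>Basis. Ck k S (\<lambda>x. frechet_derivative f (at x) b))"

definition smooth_on :: "'e::euclidean_space set \<Rightarrow> ('e \<Rightarrow> 'f::real_normed_vector) \<Rightarrow> bool" where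
  "smooth_on S f \<longleftrightarrow> (\<forall>k. Ck k S f)"

text \<open>A chart is a pair of its domain and its coordinate map; the inverse of a chart
  \<open>(U, \<phi>)\<close> is \<open>inv_into U \<phi>\<close>. The manifold is the whole topological space \<open>'a\<close>, modelled
  on the Euclidean space \<open>'e\<close>, so its dimension is \<open>DIM('e)\<close>. Atlases need not be maximal.\<close>

type_synonym ('a, 'e) atlas = "('a set \<times> ('a \<Rightarrow> 'e)) set"

definition is_atlas ::
  "('a::{t2_space, second_countable_topology}, 'e::euclidean_space) atlas \<Rightarrow> bool" where
  "is_atlas M \<longleftrightarrow>
     (\<Union>(U, \<phi>)\<in>M. U) = UNIV \<and>
     (\<forall>(U, \<phi>)\<in>M. open U \<and> open (\<phi> ` U) \<and> homeomorphism U (\<phi> ` U) \<phi> (inv_into U \<phi>)) \<and>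
     (\<forall>(U, \<phi>)\<in>M. \<forall>(V, \<psi>)\<in>M. smooth_on (\<phi> ` (U \<inter> V)) (\<psi> \<circ> inv_into U \<phi>))"

definition prod_atlas :: "('a, 'e) atlas \<Rightarrow> ('b, 'f) atlas \<Rightarrow> ('a \<times> 'b, 'e \<times> 'f) atlas" where
  "prod_atlas M N = {(U \<times> V, map_prod \<phi> \<psi>) | U \<phi> V \<psi>. (U, \<phi>) \<in> M \<and> (V, \<psi>) \<in> N}"

definition smooth_map ::
  "('a::topological_space, 'e::euclidean_space) atlas \<Rightarrow>
   ('b::topological_space, 'f::euclidean_space) atlas \<Rightarrow> ('a \<Rightarrow> 'b) \<Rightarrow> bool" where
  "smooth_map M N f \<longleftrightarrow> continuous_on UNIV f \<and>
     (\<forall>(U, \<phi>)\<in>M. \<forall>(V, \<psi>)\<in>N. smooth_on (\<phi> ` (U \<inter> f -` V)) (\<psi> \<circ> f \<circ> inv_into U \<phi>))"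

record ('a, 'e) lie_group = "'a monoid" +
  charts :: "('a, 'e) atlas"

definition is_lie_group ::
  "('a::{t2_space, second_countable_topology}, 'e::euclidean_space) lie_group \<Rightarrow> bool" where
  "is_lie_group G \<longleftrightarrow> group G \<and> carrier G = UNIV \<and> is_atlas (charts G) \<and>
     smooth_map (prod_atlas (charts G) (charts G)) (charts G) (\<lambda>(x, y). x \<otimes>\<^bsub>G\<^esub> y) \<and>
     smooth_map (charts G) (charts G) (\<lambda>x. inv\<^bsub>G\<^esub> x)"


section \<open>Functions, vector fields and differential forms\<close>

text \<open>Functions and operators are added and multiplied pointwise. To make equality of vector
  fields and forms the intended one, these operators are required to vanish outside the set of
  smooth functions and of vector fields, respectively.\<close>

type_synonym 'a fn = "'a \<Rightarrow> real"
type_synonym 'a vf = "'a fn \<Rightarrow> 'a fn"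
type_synonym 'a form1 = "'a vf \<Rightarrow> 'a fn"
type_synonym 'a form2 = "'a vf \<Rightarrow> 'a form1"
type_synonym 'a form3 = "'a vf \<Rightarrow> 'a form2"

definition smooth_funs :: "('a, 'e::euclidean_space) lie_group \<Rightarrow> 'a fn set" where
  "smooth_funs G = {f. \<forall>(U, \<phi>)\<in>charts G. smooth_on (\<phi> ` U) (f \<circ> inv_into U \<phi>)}"

text \<open>A vector field is identified with its action on smooth functions: in each chart it is
  the directional derivative along a smooth vector-valued function \<open>c\<close> (its components).\<close>

definition vfields :: "('a, 'e::euclidean_space) lie_group \<Rightarrow> 'a vf set" where
  "vfields G = {X. (\<forall>f. f \<notin> smooth_funs G \<longrightarrow> X f = 0) \<and>
     (\<forall>(U, \<phi>)\<in>charts G. \<exists>c :: 'e \<Rightarrow> 'e. smooth_on (\<phi> ` U) c \<and>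
        (\<forall>f\<in>smooth_funs G. \<forall>p\<in>U.
           X f p = frechet_derivative (f \<circ> inv_into U \<phi>) (at (\<phi> p)) (c (\<phi> p))))}"

definition vf_scale :: "'a fn \<Rightarrow> 'a vf \<Rightarrow> 'a vf" where
  "vf_scale f X = (\<lambda>h. f * X h)"

definition lie_bracket :: "'a vf \<Rightarrow> 'a vf \<Rightarrow> 'a vf" where
  "lie_bracket X Y = (\<lambda>f. X (Y f) - Y (X f))"

definition one_forms :: "('a, 'e::euclidean_space) lie_group \<Rightarrow> 'a form1 set" where
  "one_forms G = {\<xi>. (\<forall>X. X \<notin> vfields G \<longrightarrow> \<xi> X = 0) \<and>
     (\<forall>X\<in>vfields G. \<xi> X \<in> smooth_funs G) \<and>
     (\<forall>X\<in>vfields G. \<forall>Y\<in>vfields G. \<xi> (X + Y) = \<xi> X + \<xi> Y) \<and>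
     (\<forall>f\<in>smooth_funs G. \<forall>X\<in>vfields G. \<xi> (vf_scale f X) = f * \<xi> X)}"

definition two_forms :: "('a, 'e::euclidean_space) lie_group \<Rightarrow> 'a form2 set" where
  "two_forms G = {\<omega>. (\<forall>X\<in>vfields G. \<omega> X \<in> one_forms G) \<and>
     (\<forall>X\<in>vfields G. \<forall>Y\<in>vfields G. \<omega> X Y = - \<omega> Y X)}"

definition three_forms :: "('a, 'e::euclidean_space) lie_group \<Rightarrow> 'a form3 set" where
  "three_forms G = {\<omega>. (\<forall>X\<in>vfields G. \<omega> X \<in> two_forms G) \<and>
     (\<forall>X\<in>vfields G. \<forall>Y\<in>vfields G. \<omega> X Y = - \<omega> Y X)}"

definition on_vfields :: "('a, 'e::euclidean_space) lie_group \<Rightarrow> 'a form1 \<Rightarrow> 'a form1" where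
  "on_vfields G \<xi> = (\<lambda>Z. if Z \<in> vfields G then \<xi> Z else 0)"

definition d0 :: "('a, 'e::euclidean_space) lie_group \<Rightarrow> 'a fn \<Rightarrow> 'a form1" where
  "d0 G f = on_vfields G (\<lambda>X. X f)"

text \<open>Exterior derivatives by the Koszul formula (no combinatorial prefactors); the wedge product
  below is the one matching this convention.\<close>

definition d1 :: "'a form1 \<Rightarrow> 'a form2" where
  "d1 \<xi> X Y = X (\<xi> Y) - Y (\<xi> X) - \<xi> (lie_bracket X Y)"

definition d2 :: "'a form2 \<Rightarrow> 'a form3" where
  "d2 \<omega> X Y Z = X (\<omega> Y Z) - Y (\<omega> X Z) + Z (\<omega> X Y)
     - \<omega> (lie_bracket X Y) Z + \<omega> (lie_bracket X Z) Y - \<omega> (lie_bracket Y Z) X"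

definition d3 :: "'a form3 \<Rightarrow> 'a vf \<Rightarrow> 'a form3" where
  "d3 \<omega> X Y Z W = X (\<omega> Y Z W) - Y (\<omega> X Z W) + Z (\<omega> X Y W) - W (\<omega> X Y Z)
     - \<omega> (lie_bracket X Y) Z W + \<omega> (lie_bracket X Z) Y W - \<omega> (lie_bracket X W) Y Z
     - \<omega> (lie_bracket Y Z) X W + \<omega> (lie_bracket Y W) X Z - \<omega> (lie_bracket Z W) X Y"

definition wedge22 :: "'a form2 \<Rightarrow> 'a form2 \<Rightarrow> 'a vf \<Rightarrow> 'a form3" where
  "wedge22 \<alpha> \<beta> X Y Z W =
     \<alpha> X Y * \<beta> Z W - \<alpha> X Z * \<beta> Y W + \<alpha> X W * \<beta> Y Z
     + \<alpha> Y Z * \<beta> X W - \<alpha> Y W * \<beta> X Z + \<alpha> Z W * \<beta> X Y"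

definition lie_deriv1 :: "'a vf \<Rightarrow> 'a form1 \<Rightarrow> 'a form1" where
  "lie_deriv1 X \<eta> = (\<lambda>Z. X (\<eta> Z) - \<eta> (lie_bracket X Z))"

text \<open>A pseudo-Riemannian metric: a symmetric (0,2)-tensor, nondegenerate at each point; the last
  clause says that \<open>X\<close> vanishes at \<open>p\<close> as soon as it is orthogonal to everything at \<open>p\<close>.\<close>

definition pseudo_riemannian ::
  "('a, 'e::euclidean_space) lie_group \<Rightarrow> 'a form2 \<Rightarrow> bool" where
  "pseudo_riemannian G g \<longleftrightarrow> (\<forall>X\<in>vfields G. g X \<in> one_forms G) \<and>
     (\<forall>X\<in>vfields G. \<forall>Y\<in>vfields G. g X Y = g Y X) \<and>
     (\<forall>X\<in>vfields G. \<forall>p. (\<forall>Y\<in>vfields G. g X Y p = 0) \<longrightarrow> (\<forall>f\<in>smooth_funs G. X f p = 0))"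


section \<open>Left-invariance\<close>

text \<open>Pullback along the left translation \<open>x \<mapsto> a \<otimes> x\<close>.\<close>

definition lt_fn :: "('a, 'e) lie_group \<Rightarrow> 'a \<Rightarrow> 'a fn \<Rightarrow> 'a fn" where
  "lt_fn G a f = (\<lambda>x. f (a \<otimes>\<^bsub>G\<^esub> x))"

definition lt_vf :: "('a, 'e) lie_group \<Rightarrow> 'a \<Rightarrow> 'a vf \<Rightarrow> 'a vf" where
  "lt_vf G a X = (\<lambda>f. lt_fn G a (X (lt_fn G (inv\<^bsub>G\<^esub> a) f)))"

definition lt_form1 :: "('a, 'e) lie_group \<Rightarrow> 'a \<Rightarrow> 'a form1 \<Rightarrow> 'a form1" where
  "lt_form1 G a \<xi> = (\<lambda>X. lt_fn G a (\<xi> (lt_vf G (inv\<^bsub>G\<^esub> a) X)))"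

definition left_inv_vfields :: "('a, 'e::euclidean_space) lie_group \<Rightarrow> 'a vf set" where
  "left_inv_vfields G = {X \<in> vfields G. \<forall>a. lt_vf G a X = X}"

definition left_inv2 :: "('a, 'e::euclidean_space) lie_group \<Rightarrow> 'a form2 \<Rightarrow> bool" where
  "left_inv2 G \<omega> \<longleftrightarrow> (\<forall>a. \<forall>X\<in>vfields G. \<forall>Y\<in>vfields G.
     \<omega> (lt_vf G a X) (lt_vf G a Y) = lt_fn G a (\<omega> X Y))"

definition left_inv3 :: "('a, 'e::euclidean_space) lie_group \<Rightarrow> 'a form3 \<Rightarrow> bool" where
  "left_inv3 G \<omega> \<longleftrightarrow> (\<forall>a. \<forall>X\<in>vfields G. \<forall>Y\<in>vfields G. \<forall>Z\<in>vfields G.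
     \<omega> (lt_vf G a X) (lt_vf G a Y) (lt_vf G a Z) = lt_fn G a (\<omega> X Y Z))"

definition lie_algebra_basis ::
  "('a, 'e::euclidean_space) lie_group \<Rightarrow> nat \<Rightarrow> (nat \<Rightarrow> 'a vf) \<Rightarrow> bool" where
  "lie_algebra_basis G n v \<longleftrightarrow> (\<forall>a\<in>{1..n}. v a \<in> left_inv_vfields G) \<and>
     (\<forall>X\<in>left_inv_vfields G. \<exists>!c. c \<in> {1..n} \<rightarrow>\<^sub>E (UNIV :: real set) \<and>
        X = (\<Sum>a=1..n. vf_scale (\<lambda>_. c a) (v a)))"

definition orthonormal :: "'a form2 \<Rightarrow> nat \<Rightarrow> (nat \<Rightarrow> 'a vf) \<Rightarrow> bool" where
  "orthonormal g n v \<longleftrightarrow>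
     (\<forall>a\<in>{1..n}. g (v a) (v a) = 1 \<or> g (v a) (v a) = -1) \<and>
     (\<forall>a\<in>{1..n}. \<forall>b\<in>{1..n}. a \<noteq> b \<longrightarrow> g (v a) (v b) = 0)"


section \<open>Courant algebroids of type $B_n$\<close>

text \<open>Sections of $TG \oplus T^*G \oplus \mathbb{R}$; addition is that of the product type.\<close>

type_synonym 'a sec = "'a vf \<times> 'a form1 \<times> 'a fn"

definition sections :: "('a, 'e::euclidean_space) lie_group \<Rightarrow> 'a sec set" where
  "sections G = vfields G \<times> one_forms G \<times> smooth_funs G"

definition scale :: "'a fn \<Rightarrow> 'a sec \<Rightarrow> 'a sec" where
  "scale f = (\<lambda>(X, \<xi>, l). (\<lambda>h. f * X h, \<lambda>Z. f * \<xi> Z, f * l))"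

definition anchor :: "'a sec \<Rightarrow> 'a vf" where
  "anchor u = fst u"

definition pairing :: "'a sec \<Rightarrow> 'a sec \<Rightarrow> 'a fn" where
  "pairing = (\<lambda>(X, \<xi>, l) (Y, \<eta>, \<mu>). (\<lambda>_. 1/2) * (\<xi> Y + \<eta> X) + l * \<mu>)"

definition dorfman :: "('a, 'e::euclidean_space) lie_group \<Rightarrow> 'a form3 \<Rightarrow> 'a form2 \<Rightarrow>
    'a sec \<Rightarrow> 'a sec \<Rightarrow> 'a sec" where
  "dorfman G H F = (\<lambda>(X, \<xi>, l) (Y, \<eta>, \<mu>).
     (lie_bracket X Y,
      on_vfields G (\<lambda>Z. lie_deriv1 X \<eta> Z - d1 \<xi> Y Z + 2 * \<mu> * d0 G l Z + H Y X Z
                      - 2 * (\<mu> * F X Z - l * F Y Z)),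
      X \<mu> - Y l + F X Y))"

definition E_minus :: "('a, 'e::euclidean_space) lie_group \<Rightarrow> 'a form2 \<Rightarrow> 'a sec set" where
  "E_minus G g = {(X, - g X, 0) | X. X \<in> vfields G}"

definition E_plus :: "('a, 'e::euclidean_space) lie_group \<Rightarrow> 'a form2 \<Rightarrow> 'a sec set" where
  "E_plus G g = {u \<in> sections G. \<forall>w\<in>E_minus G g. pairing u w = 0}"

definition lt_sec :: "('a, 'e) lie_group \<Rightarrow> 'a \<Rightarrow> 'a sec \<Rightarrow> 'a sec" where
  "lt_sec G a = (\<lambda>(X, \<xi>, l). (lt_vf G a X, lt_form1 G a \<xi>, lt_fn G a l))"

definition divergence_operator ::
  "('a, 'e::euclidean_space) lie_group \<Rightarrow> ('a sec \<Rightarrow> 'a fn) \<Rightarrow> bool" where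
  "divergence_operator G \<delta> \<longleftrightarrow> (\<forall>u\<in>sections G. \<delta> u \<in> smooth_funs G) \<and>
     (\<forall>u\<in>sections G. \<forall>v\<in>sections G. \<delta> (u + v) = \<delta> u + \<delta> v) \<and>
     (\<forall>f\<in>smooth_funs G. \<forall>u\<in>sections G. \<delta> (scale f u) = anchor u f + f * \<delta> u)"

definition left_inv_divergence ::
  "('a, 'e::euclidean_space) lie_group \<Rightarrow> ('a sec \<Rightarrow> 'a fn) \<Rightarrow> bool" where
  "left_inv_divergence G \<delta> \<longleftrightarrow> divergence_operator G \<delta> \<and>
     (\<forall>a. \<forall>u\<in>sections G. \<delta> (lt_sec G a u) = lt_fn G a (\<delta> u))"


section \<open>Generalized connections and curvature\<close>

text \<open>\<open>D u v\<close> is the section $D_u v$; tensoriality in \<open>u\<close> expresses that $Dv$ is a section of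
  $E^* \otimes E$.\<close>

definition gen_connection ::
  "('a, 'e::euclidean_space) lie_group \<Rightarrow> ('a sec \<Rightarrow> 'a sec \<Rightarrow> 'a sec) \<Rightarrow> bool" where
  "gen_connection G D \<longleftrightarrow>
     (\<forall>u\<in>sections G. \<forall>v\<in>sections G. D u v \<in> sections G) \<and>
     (\<forall>u\<in>sections G. \<forall>u'\<in>sections G. \<forall>v\<in>sections G. D (u + u') v = D u v + D u' v) \<and>
     (\<forall>f\<in>smooth_funs G. \<forall>u\<in>sections G. \<forall>v\<in>sections G. D (scale f u) v = scale f (D u v)) \<and>
     (\<forall>u\<in>sections G. \<forall>v\<in>sections G. \<forall>v'\<in>sections G. D u (v + v') = D u v + D u v') \<and>
     (\<forall>f\<in>smooth_funs G. \<forall>u\<in>sections G. \<forall>v\<in>sections G.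
        D u (scale f v) = scale (anchor u f) v + scale f (D u v)) \<and>
     (\<forall>u\<in>sections G. \<forall>v\<in>sections G. \<forall>w\<in>sections G.
        anchor u (pairing v w) = pairing (D u v) w + pairing v (D u w))"

definition torsion :: "('a, 'e::euclidean_space) lie_group \<Rightarrow> 'a form3 \<Rightarrow> 'a form2 \<Rightarrow>
    ('a sec \<Rightarrow> 'a sec \<Rightarrow> 'a sec) \<Rightarrow> 'a sec \<Rightarrow> 'a sec \<Rightarrow> 'a sec \<Rightarrow> 'a fn" where
  "torsion G H F D u v w =
     pairing (D u v - D v u - dorfman G H F u v) w + pairing v (D w u)"

definition levi_civita :: "('a, 'e::euclidean_space) lie_group \<Rightarrow> 'a form3 \<Rightarrow> 'a form2 \<Rightarrow>
    'a form2 \<Rightarrow> ('a sec \<Rightarrow> 'a sec \<Rightarrow> 'a sec) \<Rightarrow> bool" where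
  "levi_civita G H F g D \<longleftrightarrow> gen_connection G D \<and>
     (\<forall>u\<in>sections G. \<forall>v\<in>sections G. \<forall>w\<in>sections G. torsion G H F D u v w = 0) \<and>
     (\<forall>u\<in>sections G. \<forall>v\<in>E_minus G g. D u v \<in> E_minus G g)"

text \<open>Traces of endomorphisms of a vector bundle with space of sections \<open>V\<close>, computed in a global
  frame. This suffices here, since all bundles over a Lie group occurring below are trivial; the
  result does not depend on the frame.\<close>

definition global_frame ::
  "('a, 'e::euclidean_space) lie_group \<Rightarrow> 'a sec set \<Rightarrow> nat \<Rightarrow> (nat \<Rightarrow> 'a sec) \<Rightarrow> bool" where
  "global_frame G V m b \<longleftrightarrow> (\<forall>i<m. b i \<in> V) \<and>
     (\<forall>w\<in>V. \<exists>!c. c \<in> {..<m} \<rightarrow>\<^sub>E smooth_funs G \<and> w = (\<Sum>i<m. scale (c i) (b i)))"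

definition trace_on ::
  "('a, 'e::euclidean_space) lie_group \<Rightarrow> 'a sec set \<Rightarrow> ('a sec \<Rightarrow> 'a sec) \<Rightarrow> 'a fn" where
  "trace_on G V A = (THE t. \<exists>m b c. global_frame G V m b \<and>
     (\<forall>i<m. \<forall>j<m. c i j \<in> smooth_funs G) \<and>
     (\<forall>i<m. A (b i) = (\<Sum>j<m. scale (c i j) (b j))) \<and> t = (\<Sum>i<m. c i i))"

definition divergence_of :: "('a, 'e::euclidean_space) lie_group \<Rightarrow>
    ('a sec \<Rightarrow> 'a sec \<Rightarrow> 'a sec) \<Rightarrow> 'a sec \<Rightarrow> 'a fn" where
  "divergence_of G D u = trace_on G (sections G) (\<lambda>w. D w u)"

definition curvature :: "('a, 'e::euclidean_space) lie_group \<Rightarrow> 'a form3 \<Rightarrow> 'a form2 \<Rightarrow>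
    ('a sec \<Rightarrow> 'a sec \<Rightarrow> 'a sec) \<Rightarrow> 'a sec \<Rightarrow> 'a sec \<Rightarrow> 'a sec \<Rightarrow> 'a sec" where
  "curvature G H F D u v w = D u (D v w) - D v (D u w) - D (dorfman G H F u v) w"

definition Ric_plus :: "('a, 'e::euclidean_space) lie_group \<Rightarrow> 'a form3 \<Rightarrow> 'a form2 \<Rightarrow>
    'a form2 \<Rightarrow> ('a sec \<Rightarrow> 'a sec \<Rightarrow> 'a sec) \<Rightarrow> 'a sec \<Rightarrow> 'a sec \<Rightarrow> 'a fn" where
  "Ric_plus G H F g D u v = trace_on G (E_plus G g) (\<lambda>w. curvature G H F D w u v)"

definition Ric_minus :: "('a, 'e::euclidean_space) lie_group \<Rightarrow> 'a form3 \<Rightarrow> 'a form2 \<Rightarrow>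
    'a form2 \<Rightarrow> ('a sec \<Rightarrow> 'a sec \<Rightarrow> 'a sec) \<Rightarrow> 'a sec \<Rightarrow> 'a sec \<Rightarrow> 'a fn" where
  "Ric_minus G H F g D u v = trace_on G (E_minus G g) (\<lambda>w. curvature G H F D w u v)"

text \<open>The Ricci tensors depend on \<open>D\<close> only through \<open>E_-\<close> and \<open>\<delta>\<close>, so any Levi-Civita generalized
  connection with divergence \<open>\<delta>\<close> may be used to compute them; demanding that one exists keeps the
  definition from being vacuous.\<close>

definition odd_generalized_einstein :: "('a, 'e::euclidean_space) lie_group \<Rightarrow> 'a form3 \<Rightarrow>
    'a form2 \<Rightarrow> 'a form2 \<Rightarrow> ('a sec \<Rightarrow> 'a fn) \<Rightarrow> bool" where
  "odd_generalized_einstein G H F g \<delta> \<longleftrightarrow> (\<exists>D. levi_civita G H F g D \<and>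
     (\<forall>u\<in>sections G. divergence_of G D u = \<delta> u) \<and>
     (\<forall>u\<in>E_minus G g. \<forall>v\<in>E_plus G g. Ric_plus G H F g D u v = 0) \<and>
     (\<forall>u\<in>E_plus G g. \<forall>v\<in>E_minus G g. Ric_minus G H F g D u v = 0))"


section \<open>The basis induced by an orthonormal basis of the Lie algebra\<close>

definition induced_basis :: "'a form2 \<Rightarrow> nat \<Rightarrow> (nat \<Rightarrow> 'a vf) \<Rightarrow> nat \<Rightarrow> 'a sec" where
  "induced_basis g n v A =
     (if A = 0 then (0, 0, 1)
      else if A \<le> n then (v A, g (v A), 0)
      else (v (A - n), - g (v (A - n)), 0))"

text \<open>The functions below are constant on the group, and evaluated at the unit.\<close>

definition basis_sign ::
  "('a, 'e) lie_group \<Rightarrow> 'a form2 \<Rightarrow> nat \<Rightarrow> (nat \<Rightarrow> 'a vf) \<Rightarrow> nat \<Rightarrow> real" where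
  "basis_sign G g n v A =
     (if A = 0 then 1
      else if A \<le> n then g (v A) (v A) \<one>\<^bsub>G\<^esub>
      else - g (v (A - n)) (v (A - n)) \<one>\<^bsub>G\<^esub>)"

definition dorfman_coeff :: "('a, 'e::euclidean_space) lie_group \<Rightarrow> 'a form3 \<Rightarrow> 'a form2 \<Rightarrow>
    (nat \<Rightarrow> 'a sec) \<Rightarrow> nat \<Rightarrow> nat \<Rightarrow> nat \<Rightarrow> real" where
  "dorfman_coeff G H F e A B C = pairing (dorfman G H F (e A) (e B)) (e C) \<one>\<^bsub>G\<^esub>"

end

theory Submission
  imports Defs
begin

text \<open>The sections of \<open>E\<close> have the global orthonormal frame \<open>e 0, \<dots>, e (2*n)\<close> with respect to which the
Dorfman bracket has constant, totally antisymmetric structure constants \<open>B A C E\<close>. The frame elements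
\<open>e 0, \<dots>, e n\<close> span \<open>E_+\<close> and the remaining ones span \<open>E_-\<close>. A Levi-Civita generalized connection is
determined by the functions \<open>\<omega> A C E = \<langle>D_{e A} (e C), e E\<rangle>\<close>, antisymmetric in the last two
indices. They vanish if \<open>C\<close> and \<open>E\<close> belong to different halves. If \<open>A\<close> belongs to the other half
than \<open>C\<close> and \<open>E\<close>, the torsion condition forces \<open>\<omega> A C E = B A C E\<close> (lemma \<open>\<omega>_B\<close>). If all three
belong to the same half, \<open>\<omega>\<close> is not determined, but its contraction over the first and the third
index is the divergence.

Computing the trace that defines the Ricci tensor (lemma \<open>ric_e\<close>), the undetermined part of \<open>\<omega>\<close>
enters in three places: once through its contraction, which is the divergence \<open>\<delta>\<close>, and in two further
terms, which cancel because \<open>B\<close> is invariant under cyclic permutations. The derivative of the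
contraction vanishes, since \<open>\<delta>\<close> is constant on the frame. Hence, for \<open>i\<close> in the minus half and \<open>b\<close> in
the plus half, the vanishing of the two Ricci tensors on the pair \<open>(i, b)\<close> means that the contractions
of \<open>B i b \<cdot>\<close> with \<open>\<delta>\<close> over the plus half and of \<open>B b i \<cdot>\<close> with \<open>\<delta>\<close> over the minus half are both equal to
one and the same quadratic expression in \<open>B\<close>, called \<open>ric_sum\<close> below (lemma \<open>einstein_iff\<close>). Since the
coefficients \<open>B A C 0\<close> are those of \<open>F\<close>, the plus equation for \<open>b = a\<close> is the first equation of the theorem, the plus
equation for \<open>b = 0\<close> is the second one, and the differences of plus and minus equations are the third
one (for \<open>b = 0\<close>) and the fourth one (for \<open>b = a\<close>).

Three points need an argument beyond this computation. First, the left-invariant fields have to be a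
frame over the smooth functions: a left-invariant field that vanishes at one point vanishes
everywhere, so the components of \<open>n\<close> independent ones form a basis of the model space at each point,
and the coefficients of a smooth field in this basis are smooth. Second, the trace has to be
independent of the frame, and the curvature tensorial on the arguments that occur. Third, a
Levi-Civita generalized connection with the given divergence has to exist: take \<open>B/3\<close> for three indices
of the same half and add the pure trace term that produces \<open>\<delta>\<close>, which is possible because both halves
have rank at least two.\<close>

section \<open>Smooth functions on open subsets of a Euclidean space\<close>

lemma Ck_cong:
  assumes "open S" "\<And>x. x \<in> S \<Longrightarrow> f x = g x"
  shows "Ck k S f \<longleftrightarrow> Ck k S g"
  using assms(2)
proof (induction k arbitrary: f g)
  case 0
  then show ?case by (simp cong: continuous_on_cong)
next
  case (Suc k)
  have D: "(f has_derivative D) (at x) \<longleftrightarrow> (g has_derivative D) (at x)" if "x \<in> S" for x D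
    using assms(1) that Suc.prems
    by (metis has_derivative_transform_within_open)
  have "frechet_derivative f (at x) = frechet_derivative g (at x)" if "x \<in> S" for x
    unfolding frechet_derivative_def using D[OF that] by simp
  moreover have "f differentiable (at x) \<longleftrightarrow> g differentiable (at x)" if "x \<in> S" for x
    unfolding differentiable_def using D[OF that] by simp
  ultimately show ?case
    using Suc.IH by (metis (no_types, lifting) Ck.simps(2))
qed

lemma Ck_Suc_imp: "Ck (Suc k) S f \<Longrightarrow> Ck k S f"
proof (induction k arbitrary: f)
  case 0
  then show ?case
    by (auto intro!: continuous_at_imp_continuous_on differentiable_imp_continuous_within)
next
  case (Suc k)
  then show ?case by (metis Ck.simps(2))
qed

lemma Ck_const: "Ck k S (\<lambda>_. c)"
  by (induction k arbitrary: c) (auto simp: frechet_derivative_const)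

lemma Ck_add:
  assumes "open S" "Ck k S f" "Ck k S g"
  shows "Ck k S (\<lambda>x. f x + g x)"
  using assms(2,3)
proof (induction k arbitrary: f g)
  case 0
  then show ?case by (simp add: continuous_on_add)
next
  case (Suc k)
  have "Ck k S (\<lambda>x. frechet_derivative (\<lambda>x. f x + g x) (at x) b)" if "b \<in> Basis" for b
    using Suc.IH[of "\<lambda>x. frechet_derivative f (at x) b" "\<lambda>x. frechet_derivative g (at x) b"]
      Suc.prems that
    by (subst Ck_cong[OF assms(1)])
      (auto simp: frechet_derivative_at[OF has_derivative_add[OF frechet_derivative_works[THEN iffD1]
         frechet_derivative_works[THEN iffD1]], symmetric])
  then show ?case using Suc.prems by auto
qed

lemma Ck_sum:
  assumes "open S" "\<And>i. i \<in> I \<Longrightarrow> Ck k S (f i)"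
  shows "Ck k S (\<lambda>x. \<Sum>i\<in>I. f i x)"
  using assms(2)
proof (induction I rule: infinite_finite_induct)
  case (insert i I)
  then show ?case using Ck_add[OF assms(1), of k "f i" "\<lambda>x. \<Sum>i\<in>I. f i x"] by simp
qed (simp_all add: Ck_const)

text \<open>Leibniz' rule expresses the partial derivatives of a product through products of the same
kind, so that one induction covers products of functions, scalar multiples and inner products.\<close>

lemma Ck_bilinear:
  assumes B: "bounded_bilinear B" and "open S" "Ck k S f" "Ck k S g"
  shows "Ck k S (\<lambda>x. B (f x) (g x))"
  using assms(3,4)
proof (induction k arbitrary: f g)
  case 0
  then show ?case using bounded_bilinear.continuous_on[OF B] by auto
next
  case (Suc k)
  have D: "((\<lambda>x. B (f x) (g x)) has_derivative
      (\<lambda>h. B (f x) (frechet_derivative g (at x) h) + B (frechet_derivative f (at x) h) (g x))) (at x)"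
    if "x \<in> S" for x
    by (rule bounded_bilinear.FDERIV[OF B]) (use Suc.prems that in \<open>simp_all add: frechet_derivative_works[symmetric]\<close>)
  have "Ck k S (\<lambda>x. frechet_derivative (\<lambda>x. B (f x) (g x)) (at x) b)" if "b \<in> Basis" for b
  proof (subst Ck_cong[OF assms(2)])
    show "frechet_derivative (\<lambda>x. B (f x) (g x)) (at x) b =
       B (f x) (frechet_derivative g (at x) b) + B (frechet_derivative f (at x) b) (g x)"
      if "x \<in> S" for x
      by (simp add: frechet_derivative_at[OF D[OF that], symmetric])
    show "Ck k S (\<lambda>x. B (f x) (frechet_derivative g (at x) b) + B (frechet_derivative f (at x) b) (g x))"
      by (rule Ck_add[OF assms(2)]; rule Suc.IH) (use Suc.prems that Ck_Suc_imp in auto)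
  qed
  moreover have "\<forall>x\<in>S. (\<lambda>x. B (f x) (g x)) differentiable (at x)"
    using D differentiable_def by blast
  ultimately show ?case by simp
qed

text \<open>The derivative of \<open>1/f\<close> is \<open>-f'/f^2\<close>, which contains \<open>1/f\<close> only without derivatives.\<close>

lemma Ck_inverse:
  fixes f :: "'e::euclidean_space \<Rightarrow> real"
  assumes "open S" "\<And>x. x \<in> S \<Longrightarrow> f x \<noteq> 0" "Ck k S f"
  shows "Ck k S (\<lambda>x. inverse (f x))"
  using assms(3)
proof (induction k)
  case 0
  then show ?case using assms(2) by (simp add: continuous_on_inverse)
next
  case (Suc k)
  have D: "((\<lambda>x. inverse (f x)) has_derivative
      (\<lambda>h. - (inverse (f x) * frechet_derivative f (at x) h * inverse (f x)))) (at x)"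
    if "x \<in> S" for x
    by (rule Deriv.has_derivative_inverse) (use Suc.prems that assms(2) in \<open>simp_all add: frechet_derivative_works[symmetric]\<close>)
  have "Ck k S (\<lambda>x. frechet_derivative (\<lambda>x. inverse (f x)) (at x) b)" if "b \<in> Basis" for b
  proof (subst Ck_cong[OF assms(1)])
    show "frechet_derivative (\<lambda>x. inverse (f x)) (at x) b =
        (-1) * (inverse (f x) * frechet_derivative f (at x) b * inverse (f x))"
      if "x \<in> S" for x
      by (simp add: frechet_derivative_at[OF D[OF that], symmetric])
    note mult = Ck_bilinear[OF bounded_bilinear_mult assms(1)]
    have i: "Ck k S (\<lambda>x. inverse (f x))" by (rule Suc.IH[OF Ck_Suc_imp[OF Suc.prems]])
    have f': "Ck k S (\<lambda>x. frechet_derivative f (at x) b)" using Suc.prems that by simp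
    show "Ck k S (\<lambda>x. (-1) * (inverse (f x) * frechet_derivative f (at x) b * inverse (f x)))"
      by (rule mult[OF Ck_const mult[OF mult[OF i f'] i]])
  qed
  moreover have "\<forall>x\<in>S. (\<lambda>x. inverse (f x)) differentiable (at x)"
    using D differentiable_def by blast
  ultimately show ?case by simp
qed

lemma smooth_on_cong:
  "open S \<Longrightarrow> (\<And>x. x \<in> S \<Longrightarrow> f x = g x) \<Longrightarrow> smooth_on S f \<longleftrightarrow> smooth_on S g"
  unfolding smooth_on_def using Ck_cong by blast

lemma smooth_on_const: "smooth_on S (\<lambda>_. c)"
  by (simp add: smooth_on_def Ck_const)

lemma smooth_on_add: "open S \<Longrightarrow> smooth_on S f \<Longrightarrow> smooth_on S g \<Longrightarrow> smooth_on S (\<lambda>x. f x + g x)"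
  by (simp add: smooth_on_def Ck_add)

lemma smooth_on_sum:
  "open S \<Longrightarrow> (\<And>i. i \<in> I \<Longrightarrow> smooth_on S (f i)) \<Longrightarrow> smooth_on S (\<lambda>x. \<Sum>i\<in>I. f i x)"
  by (simp add: smooth_on_def Ck_sum)

lemma smooth_on_bilinear:
  "bounded_bilinear B \<Longrightarrow> open S \<Longrightarrow> smooth_on S f \<Longrightarrow> smooth_on S g \<Longrightarrow>
    smooth_on S (\<lambda>x. B (f x) (g x))"
  by (simp add: smooth_on_def Ck_bilinear)

lemmas smooth_on_mult = smooth_on_bilinear[OF bounded_bilinear_mult]
lemmas smooth_on_scaleR = smooth_on_bilinear[OF bounded_bilinear_scaleR]
lemmas smooth_on_inner = smooth_on_bilinear[OF bounded_bilinear_inner]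

lemma smooth_on_minus:
  fixes f g :: "_ \<Rightarrow> 'f::real_normed_vector"
  assumes "open S" "smooth_on S f" "smooth_on S g"
  shows "smooth_on S (\<lambda>x. f x - g x)"
proof -
  have "smooth_on S (\<lambda>x. f x + (-1) *\<^sub>R g x)"
    by (intro smooth_on_add smooth_on_scaleR smooth_on_const assms)
  then show ?thesis by simp
qed

lemma smooth_on_divide:
  fixes f g :: "_ \<Rightarrow> real"
  assumes "open S" "smooth_on S f" "smooth_on S g" "\<And>x. x \<in> S \<Longrightarrow> g x \<noteq> 0"
  shows "smooth_on S (\<lambda>x. f x / g x)"
proof -
  have "smooth_on S (\<lambda>x. inverse (g x))"
    using assms by (simp add: smooth_on_def Ck_inverse)
  then show ?thesis
    unfolding divide_inverse by (intro smooth_on_mult assms)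
qed

lemma smooth_on_differentiable: "smooth_on S f \<Longrightarrow> x \<in> S \<Longrightarrow> f differentiable (at x)"
  by (metis smooth_on_def Ck.simps(2))

lemma smooth_on_partial:
  "smooth_on S f \<Longrightarrow> b \<in> Basis \<Longrightarrow> smooth_on S (\<lambda>x. frechet_derivative f (at x) b)"
  by (metis smooth_on_def Ck.simps(2))

lemma frechet_derivative_basis_sum:
  assumes "f differentiable (at x)"
  shows "frechet_derivative f (at x) h = (\<Sum>b\<in>Basis. (h \<bullet> b) *\<^sub>R frechet_derivative f (at x) b)"
proof -
  interpret linear "frechet_derivative f (at x)"
    by (rule linear_frechet_derivative[OF assms])
  have "frechet_derivative f (at x) (\<Sum>b\<in>Basis. (h \<bullet> b) *\<^sub>R b)
      = (\<Sum>b\<in>Basis. (h \<bullet> b) *\<^sub>R frechet_derivative f (at x) b)"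
    by (simp add: sum scale)
  then show ?thesis by (simp add: euclidean_representation)
qed

lemma smooth_on_directional:
  assumes "open S" "smooth_on S f" "smooth_on S c"
  shows "smooth_on S (\<lambda>x. frechet_derivative f (at x) (c x))"
proof -
  have "smooth_on S (\<lambda>x. \<Sum>b\<in>Basis. (c x \<bullet> b) *\<^sub>R frechet_derivative f (at x) b)"
    by (intro smooth_on_sum smooth_on_scaleR smooth_on_inner smooth_on_const smooth_on_partial assms)
  then show ?thesis
    by (subst smooth_on_cong[OF assms(1)])
      (auto intro!: frechet_derivative_basis_sum smooth_on_differentiable[OF assms(2)])
qed

text \<open>The mean value theorem, applied first in direction \<open>b\<close> and then in direction \<open>c\<close>. The left-hand
side is symmetric in \<open>b\<close> and \<open>c\<close>; letting \<open>t\<close> tend to 0 yields the symmetry of second derivatives.\<close>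

lemma second_difference_mean_value:
  fixes f :: "'e::euclidean_space \<Rightarrow> real" and b c x :: 'e
  assumes r: "ball x r \<subseteq> S" and t: "0 < t" "t * (norm b + norm c) < r"
    and f: "\<And>y. y \<in> S \<Longrightarrow> f differentiable (at y)"
    and fb: "\<And>y. y \<in> S \<Longrightarrow> (\<lambda>y. frechet_derivative f (at y) b) differentiable (at y)"
  obtains s s' where "0 < s" "s < t" "0 < s'" "s' < t"
    "f (x + t *\<^sub>R b + t *\<^sub>R c) - f (x + t *\<^sub>R b) - f (x + t *\<^sub>R c) + f x =
      t * t * frechet_derivative (\<lambda>y. frechet_derivative f (at y) b) (at (x + s *\<^sub>R b + s' *\<^sub>R c)) c"
proof -
  have S: "x + s *\<^sub>R b + s' *\<^sub>R c \<in> S" if "0 \<le> s" "s \<le> t" "0 \<le> s'" "s' \<le> t" for s s'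
  proof -
    have "norm (s *\<^sub>R b + s' *\<^sub>R c) \<le> s * norm b + s' * norm c"
      using that norm_triangle_ineq[of "s *\<^sub>R b" "s' *\<^sub>R c"] by simp
    also have "\<dots> \<le> t * (norm b + norm c)"
      using that by (simp add: distrib_left add_mono mult_right_mono)
    finally have "norm (s *\<^sub>R b + s' *\<^sub>R c) < r" using t by simp
    then have "x + (s *\<^sub>R b + s' *\<^sub>R c) \<in> ball x r" unfolding mem_ball by (metis add_diff_cancel_left' dist_commute dist_norm)
    then show ?thesis using r by (auto simp: add.assoc)
  qed
  have line: "((\<lambda>s. h (y + s *\<^sub>R d)) has_real_derivative frechet_derivative h (at (y + s *\<^sub>R d)) d) (at s)"
    if "h differentiable (at (y + s *\<^sub>R d))" for h :: "'e \<Rightarrow> real" and y d :: 'e and s :: real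
  proof -
    have 1: "((\<lambda>s. y + s *\<^sub>R d) has_derivative (\<lambda>u. u *\<^sub>R d)) (at s)"
      by (auto intro!: derivative_eq_intros)
    have 2: "(h has_derivative frechet_derivative h (at (y + s *\<^sub>R d))) (at (y + s *\<^sub>R d))"
      using that by (simp add: frechet_derivative_works)
    have "((\<lambda>s. h (y + s *\<^sub>R d)) has_derivative
        (\<lambda>u. frechet_derivative h (at (y + s *\<^sub>R d)) (u *\<^sub>R d))) (at s)"
      by (rule has_derivative_compose[OF 1 2])
    moreover have "frechet_derivative h (at (y + s *\<^sub>R d)) (u *\<^sub>R d)
        = frechet_derivative h (at (y + s *\<^sub>R d)) d * u" for u
      using linear_frechet_derivative[OF that] by (simp add: linear_scale mult.commute)
    ultimately show ?thesis
      unfolding has_field_derivative_def by simp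
  qed
  let ?p = "\<lambda>s. f ((x + t *\<^sub>R c) + s *\<^sub>R b) - f (x + s *\<^sub>R b)"
  let ?fb = "\<lambda>y. frechet_derivative f (at y) b"
  have "\<exists>s. 0 < s \<and> s < t \<and> ?p t - ?p 0 =
      (t - 0) * (?fb ((x + t *\<^sub>R c) + s *\<^sub>R b) - ?fb (x + s *\<^sub>R b))"
  proof (rule MVT2)
    fix s assume s: "0 \<le> s" "s \<le> t"
    have 1: "(x + t *\<^sub>R c) + s *\<^sub>R b \<in> S" using S[OF s, of t] t by (simp add: algebra_simps)
    have 2: "x + s *\<^sub>R b \<in> S" using S[OF s, of 0] t by simp
    show "(?p has_real_derivative ?fb ((x + t *\<^sub>R c) + s *\<^sub>R b) - ?fb (x + s *\<^sub>R b)) (at s)"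
      by (intro DERIV_diff line f 1 2)
  qed (use t in auto)
  then obtain s where s: "0 < s" "s < t" and
    eq1: "?p t - ?p 0 = t * (?fb ((x + t *\<^sub>R c) + s *\<^sub>R b) - ?fb (x + s *\<^sub>R b))" by auto
  have "\<exists>s'. 0 < s' \<and> s' < t \<and> ?fb ((x + s *\<^sub>R b) + t *\<^sub>R c) - ?fb ((x + s *\<^sub>R b) + 0 *\<^sub>R c) =
      (t - 0) * frechet_derivative ?fb (at ((x + s *\<^sub>R b) + s' *\<^sub>R c)) c"
    using s by (intro MVT2 line fb S) (use t in auto)
  then obtain s' where s': "0 < s'" "s' < t" and
    eq2: "?fb ((x + s *\<^sub>R b) + t *\<^sub>R c) - ?fb (x + s *\<^sub>R b) =
      t * frechet_derivative ?fb (at (x + s *\<^sub>R b + s' *\<^sub>R c)) c" by auto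
  have swap: "(x + t *\<^sub>R c) + u *\<^sub>R b = (x + u *\<^sub>R b) + t *\<^sub>R c" for u
    by (simp add: add.commute add.left_commute)
  have "f (x + t *\<^sub>R b + t *\<^sub>R c) - f (x + t *\<^sub>R b) - f (x + t *\<^sub>R c) + f x =
      t * (t * frechet_derivative ?fb (at (x + s *\<^sub>R b + s' *\<^sub>R c)) c)"
    using eq1 eq2 unfolding swap[of s] swap[of t] by simp
  then show ?thesis using that[OF s s'] by (simp add: mult.assoc)
qed

text \<open>Near \<open>x\<close> both mixed derivatives are within any given distance of the same second difference
quotient.\<close>

lemma mixed_partials_commute:
  fixes f :: "'e::euclidean_space \<Rightarrow> real"
  assumes "open S" "x \<in> S" "smooth_on S f" "b \<in> Basis" "c \<in> Basis"
  shows "frechet_derivative (\<lambda>y. frechet_derivative f (at y) b) (at x) c =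
         frechet_derivative (\<lambda>y. frechet_derivative f (at y) c) (at x) b"
proof -
  let ?P = "\<lambda>b c y. frechet_derivative (\<lambda>y. frechet_derivative f (at y) b) (at y) c"
  have cont: "isCont (?P b c) x" if "b \<in> Basis" "c \<in> Basis" for b c
    using smooth_on_partial[OF smooth_on_partial[OF assms(3) that(1)] that(2)]
      smooth_on_differentiable[OF _ assms(2)] differentiable_imp_continuous_within by blast
  have bound: "\<bar>?P b c x - ?P c b x\<bar> < e + e" if "0 < e" for e
  proof -
    obtain d1 where d1: "0 < d1" "\<And>y. dist y x < d1 \<Longrightarrow> dist (?P b c y) (?P b c x) < e"
      using cont[OF assms(4,5)] \<open>0 < e\<close> unfolding continuous_at_eps_delta by metis
    obtain d2 where d2: "0 < d2" "\<And>y. dist y x < d2 \<Longrightarrow> dist (?P c b y) (?P c b x) < e"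
      using cont[OF assms(5,4)] \<open>0 < e\<close> unfolding continuous_at_eps_delta by metis
    obtain d3 where d3: "0 < d3" "ball x d3 \<subseteq> S"
      using assms(1,2) openE by blast
    \<comment> \<open>the points provided by the mean value theorem are within distance \<open>2 * t\<close> of \<open>x\<close>\<close>
    define t where "t = Min {d1, d2, d3} / 3"
    have t: "0 < t" "t * 2 < d1" "t * 2 < d2" "t * 2 < d3"
      using d1 d2 d3 by (auto simp: t_def)
    have n: "norm b = 1" "norm c = 1" using assms by auto
    have near: "dist (x + s *\<^sub>R b + s' *\<^sub>R c) x < t * 2" if "0 < s" "s < t" "0 < s'" "s' < t" for s s'
    proof -
      have "norm (s *\<^sub>R b + s' *\<^sub>R c) \<le> s + s'"
        using that n norm_triangle_ineq[of "s *\<^sub>R b" "s' *\<^sub>R c"] by simp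
      then show ?thesis using that by (simp add: dist_norm add.assoc)
    qed
    have tn: "t * (norm b + norm c) < d3" "t * (norm c + norm b) < d3" using t n by auto
    note df = smooth_on_differentiable[OF assms(3)]
      smooth_on_differentiable[OF smooth_on_partial[OF assms(3,4)]]
      smooth_on_differentiable[OF smooth_on_partial[OF assms(3,5)]]
    obtain s s' where s: "0 < s" "s < t" "0 < s'" "s' < t"
      "f (x + t *\<^sub>R b + t *\<^sub>R c) - f (x + t *\<^sub>R b) - f (x + t *\<^sub>R c) + f x =
        t * t * ?P b c (x + s *\<^sub>R b + s' *\<^sub>R c)"
      by (rule second_difference_mean_value[OF d3(2) t(1) tn(1) df(1,2)]) auto
    obtain r r' where r: "0 < r" "r < t" "0 < r'" "r' < t"
      "f (x + t *\<^sub>R c + t *\<^sub>R b) - f (x + t *\<^sub>R c) - f (x + t *\<^sub>R b) + f x =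
        t * t * ?P c b (x + r *\<^sub>R c + r' *\<^sub>R b)"
      by (rule second_difference_mean_value[OF d3(2) t(1) tn(2) df(1,3)]) auto
    have "t * t * ?P b c (x + s *\<^sub>R b + s' *\<^sub>R c) = t * t * ?P c b (x + r' *\<^sub>R b + r *\<^sub>R c)"
      using s(5) r(5) by (simp add: algebra_simps)
    then have "?P b c (x + s *\<^sub>R b + s' *\<^sub>R c) = ?P c b (x + r' *\<^sub>R b + r *\<^sub>R c)"
      using t(1) by simp
    moreover have "dist (?P b c (x + s *\<^sub>R b + s' *\<^sub>R c)) (?P b c x) < e"
      using d1(2) near[OF s(1-4)] t by force
    moreover have "dist (?P c b (x + r' *\<^sub>R b + r *\<^sub>R c)) (?P c b x) < e"
      using d2(2) near[OF r(3,4,1,2)] t by force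
    ultimately show ?thesis unfolding dist_real_def by linarith
  qed
  show ?thesis
  proof (rule ccontr)
    assume "?P b c x \<noteq> ?P c b x"
    then show False using bound[of "\<bar>?P b c x - ?P c b x\<bar> / 2"] by simp
  qed
qed

text \<open>Smoothness of the solution of a linear system without determinants: projecting everything to
the orthogonal complement of the last vector \<open>c k\<close> removes the last unknown, and \<open>h k\<close> is found from
the others by taking the inner product with \<open>c k\<close>.\<close>

lemma smooth_coefficients:
  fixes c :: "nat \<Rightarrow> 'e::euclidean_space \<Rightarrow> 'f::real_inner"
  assumes "open S" "\<And>i. i < k \<Longrightarrow> smooth_on S (c i)" "smooth_on S X"
    and "\<And>x r. x \<in> S \<Longrightarrow> (\<Sum>i<k. r i *\<^sub>R c i x) = 0 \<Longrightarrow> \<forall>i<k. r i = 0"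
    and "\<And>x. x \<in> S \<Longrightarrow> X x = (\<Sum>i<k. h i x *\<^sub>R c i x)"
  shows "\<forall>i<k. smooth_on S (h i)"
  using assms(2-)
proof (induction k arbitrary: c X)
  case 0
  then show ?case by simp
next
  case (Suc k)
  have nz: "c k x \<bullet> c k x \<noteq> 0" if "x \<in> S" for x
  proof
    assume "c k x \<bullet> c k x = 0"
    then have "(\<Sum>i<Suc k. (if i = k then 1 else 0) *\<^sub>R c i x) = 0" by simp
    then show False using Suc.prems(3)[OF that] by fastforce
  qed
  \<comment> \<open>the coefficient of the projection to \<open>c k\<close>, and the projection to its complement\<close>
  let ?q = "\<lambda>y x. (y x \<bullet> c k x) / (c k x \<bullet> c k x)"
  let ?pr = "\<lambda>y x. y x - ?q y x *\<^sub>R c k x"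
  have sm: "smooth_on S (?q y)" "smooth_on S (?pr y)" if "smooth_on S y" for y
    using Suc.prems(1)[of k] that nz
    by (auto intro!: smooth_on_minus smooth_on_scaleR smooth_on_divide smooth_on_inner assms(1))
  have IH: "\<forall>i<k. smooth_on S (h i)"
  proof (rule Suc.IH)
    show "smooth_on S (?pr (c i))" if "i < k" for i using sm Suc.prems(1) that by simp
    show "smooth_on S (?pr X)" using sm Suc.prems(2) by simp
    show "\<forall>i<k. r i = 0" if "x \<in> S" "(\<Sum>i<k. r i *\<^sub>R ?pr (c i) x) = 0" for x r
    proof -
      \<comment> \<open>the projected vectors differ from the original ones by multiples of \<open>c k\<close>\<close>
      define r' where "r' i = (if i = k then - (\<Sum>j<k. r j * ?q (c j) x) else r i)" for i
      have "(\<Sum>i<Suc k. r' i *\<^sub>R c i x) = (\<Sum>i<k. r i *\<^sub>R ?pr (c i) x)"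
        by (simp add: r'_def scaleR_diff_right sum_subtractf scaleR_sum_left)
      then have "\<forall>i<Suc k. r' i = 0" using that Suc.prems(3) by metis
      then show ?thesis by (auto simp: r'_def split: if_splits) (metis less_SucI less_irrefl)
    qed
    show "?pr X x = (\<Sum>i<k. h i x *\<^sub>R ?pr (c i) x)" if "x \<in> S" for x
    proof -
      have "?q X x = (\<Sum>i<k. h i x * ?q (c i) x) + h k x"
        using nz[OF that] Suc.prems(4)[OF that]
        by (simp add: inner_add_left inner_sum_left add_divide_distrib sum_divide_distrib)
      then show ?thesis
        using Suc.prems(4)[OF that]
        by (simp add: scaleR_diff_right sum_subtractf scaleR_add_left scaleR_sum_left)
    qed
  qed
  moreover have "smooth_on S (h k)"
  proof -
    have "smooth_on S (\<lambda>x. ?q (\<lambda>x. X x - (\<Sum>i<k. h i x *\<^sub>R c i x)) x)"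
      using IH Suc.prems(1,2)
      by (intro sm smooth_on_minus smooth_on_sum smooth_on_scaleR assms(1)) auto
    moreover have "h k x = ?q (\<lambda>x. X x - (\<Sum>i<k. h i x *\<^sub>R c i x)) x" if "x \<in> S" for x
      using Suc.prems(4)[OF that] nz[OF that] by simp
    ultimately show ?thesis using smooth_on_cong[OF assms(1)] by (metis (no_types, lifting))
  qed
  ultimately show ?case using less_Suc_eq by auto
qed

lemma smooth_on_locally_constant:
  assumes "open S" "\<And>x. x \<in> S \<Longrightarrow> \<exists>T. open T \<and> x \<in> T \<and> (\<forall>y\<in>T. f y = f x)"
  shows "smooth_on S f"
proof -
  have D: "(f has_derivative (\<lambda>_. 0)) (at x)" if "x \<in> S" for x
  proof -
    obtain T where T: "open T" "x \<in> T" "\<forall>y\<in>T. f y = f x" using assms(2)[of x] \<open>x \<in> S\<close> by auto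
    then show ?thesis using has_derivative_transform_within_open[OF has_derivative_const[of "f x" "at x"]]
      by metis
  qed
  have "Ck k S f" for k
  proof (cases k)
    case 0
    then show ?thesis
      using D has_derivative_continuous continuous_at_imp_continuous_on by (metis Ck.simps(1))
  next
    case (Suc k')
    have "Ck k' S (\<lambda>x. frechet_derivative f (at x) b)" for b
      by (subst Ck_cong[OF assms(1), of _ "\<lambda>_. 0"]) (auto simp: Ck_const frechet_derivative_at[OF D, symmetric])
    moreover have "\<forall>x\<in>S. f differentiable (at x)" using D unfolding differentiable_def by blast
    ultimately show ?thesis using Suc by simp
  qed
  then show ?thesis by (simp add: smooth_on_def)
qed

section \<open>Smooth functions and vector fields on a manifold\<close>

lemma sum_apply: "(\<Sum>i\<in>I. f i) x = (\<Sum>i\<in>I. f i x)"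
  by (induction I rule: infinite_finite_induct) auto

text \<open>The double sum is the Hessian of \<open>f\<close> on the vectors \<open>d x\<close> and \<open>h\<close>.\<close>

lemma directional_derivative_of_directional_derivative:
  fixes f :: "'e::euclidean_space \<Rightarrow> real"
  assumes "open S" "x \<in> S" "smooth_on S f" "smooth_on S d"
  shows "frechet_derivative (\<lambda>y. frechet_derivative f (at y) (d y)) (at x) h =
    frechet_derivative f (at x) (frechet_derivative d (at x) h) +
    (\<Sum>b\<in>Basis. \<Sum>b'\<in>Basis. (d x \<bullet> b) * (h \<bullet> b') *
       frechet_derivative (\<lambda>y. frechet_derivative f (at y) b) (at x) b')"
proof -
  let ?P = "\<lambda>b y. frechet_derivative f (at y) b"
  have eq: "(\<Sum>b\<in>Basis. (d y \<bullet> b) * ?P b y) = frechet_derivative f (at y) (d y)" if "y \<in> S" for y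
    using frechet_derivative_basis_sum[OF smooth_on_differentiable[OF assms(3) that], of "d y"] by simp
  have dd: "(d has_derivative frechet_derivative d (at x)) (at x)"
    using smooth_on_differentiable[OF assms(4,2)] by (simp add: frechet_derivative_works)
  have dP: "(?P b has_derivative frechet_derivative (?P b) (at x)) (at x)" if "b \<in> Basis" for b
    using smooth_on_differentiable[OF smooth_on_partial[OF assms(3) that] assms(2)]
    by (simp add: frechet_derivative_works)
  have "((\<lambda>y. \<Sum>b\<in>Basis. (d y \<bullet> b) * ?P b y) has_derivative
     (\<lambda>h. \<Sum>b\<in>Basis. (d x \<bullet> b) * frechet_derivative (?P b) (at x) h
        + (frechet_derivative d (at x) h \<bullet> b) * ?P b x)) (at x)"
    by (intro has_derivative_sum has_derivative_mult has_derivative_inner_left dd dP)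
  then have "((\<lambda>y. frechet_derivative f (at y) (d y)) has_derivative
     (\<lambda>h. \<Sum>b\<in>Basis. (d x \<bullet> b) * frechet_derivative (?P b) (at x) h
        + (frechet_derivative d (at x) h \<bullet> b) * ?P b x)) (at x)"
    by (rule has_derivative_transform_within_open[OF _ assms(1,2) eq])
  then have "frechet_derivative (\<lambda>y. frechet_derivative f (at y) (d y)) (at x) h =
     (\<Sum>b\<in>Basis. (d x \<bullet> b) * frechet_derivative (?P b) (at x) h)
        + (\<Sum>b\<in>Basis. (frechet_derivative d (at x) h \<bullet> b) * ?P b x)"
    by (simp add: frechet_derivative_at[symmetric] sum.distrib)
  also have "(\<Sum>b\<in>Basis. (frechet_derivative d (at x) h \<bullet> b) * ?P b x) =
      frechet_derivative f (at x) (frechet_derivative d (at x) h)"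
    using frechet_derivative_basis_sum[OF smooth_on_differentiable[OF assms(3,2)],
      of "frechet_derivative d (at x) h"] by simp
  also have "(\<Sum>b\<in>Basis. (d x \<bullet> b) * frechet_derivative (?P b) (at x) h) =
    (\<Sum>b\<in>Basis. \<Sum>b'\<in>Basis. (d x \<bullet> b) * (h \<bullet> b') * frechet_derivative (?P b) (at x) b')"
  proof (rule sum.cong[OF refl])
    fix b :: 'e assume b: "b \<in> Basis"
    show "(d x \<bullet> b) * frechet_derivative (?P b) (at x) h =
      (\<Sum>b'\<in>Basis. (d x \<bullet> b) * (h \<bullet> b') * frechet_derivative (?P b) (at x) b')"
      using frechet_derivative_basis_sum[OF
          smooth_on_differentiable[OF smooth_on_partial[OF assms(3) b] assms(2)], of h]
      by (simp add: sum_distrib_left mult.assoc)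
  qed
  finally show ?thesis by simp
qed

text \<open>The Hessian terms cancel, so that the bracket of two vector fields is again a vector field, with
the components on the right-hand side.\<close>

lemma commutator_of_directional_derivatives:
  fixes f :: "'e::euclidean_space \<Rightarrow> real"
  assumes "open S" "x \<in> S" "smooth_on S f" "smooth_on S c" "smooth_on S d"
  shows "frechet_derivative (\<lambda>y. frechet_derivative f (at y) (d y)) (at x) (c x)
       - frechet_derivative (\<lambda>y. frechet_derivative f (at y) (c y)) (at x) (d x)
       = frechet_derivative f (at x) (frechet_derivative d (at x) (c x) - frechet_derivative c (at x) (d x))"
proof -
  let ?P = "\<lambda>b b'. frechet_derivative (\<lambda>y. frechet_derivative f (at y) b) (at x) b'"
  have "(\<Sum>b\<in>Basis. \<Sum>b'\<in>Basis. (d x \<bullet> b) * (c x \<bullet> b') * ?P b b') =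
        (\<Sum>b'\<in>Basis. \<Sum>b\<in>Basis. (d x \<bullet> b) * (c x \<bullet> b') * ?P b b')"
    by (rule sum.swap)
  also have "\<dots> = (\<Sum>b'\<in>Basis. \<Sum>b\<in>Basis. (c x \<bullet> b') * (d x \<bullet> b) * ?P b' b)"
    by (intro sum.cong refl) (simp add: mixed_partials_commute[OF assms(1-3)] mult.commute)
  finally show ?thesis
    using linear_frechet_derivative[OF smooth_on_differentiable[OF assms(3,2)]]
    by (simp add: directional_derivative_of_directional_derivative[OF assms(1-3,4)]
        directional_derivative_of_directional_derivative[OF assms(1-3,5)] linear_diff)
qed

locale atlas_group =
  fixes G :: "('a::{t2_space, second_countable_topology}, 'e::euclidean_space) lie_group"
  assumes atlas: "is_atlas (charts G)"
begin

abbreviation R where "R \<equiv> smooth_funs G"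
abbreviation V where "V \<equiv> vfields G"

lemma chart:
  assumes "(U, \<phi>) \<in> charts G"
  shows "open U" "open (\<phi> ` U)" "homeomorphism U (\<phi> ` U) \<phi> (inv_into U \<phi>)"
    "p \<in> U \<Longrightarrow> inv_into U \<phi> (\<phi> p) = p"
proof -
  show 1: "open U" "open (\<phi> ` U)" "homeomorphism U (\<phi> ` U) \<phi> (inv_into U \<phi>)"
    using atlas assms unfolding is_atlas_def by auto
  show "inv_into U \<phi> (\<phi> p) = p" if "p \<in> U"
    using homeomorphism_apply1[OF 1(3) that] .
qed

lemma chart_at: obtains U \<phi> where "(U, \<phi>) \<in> charts G" "p \<in> U"
proof -
  have "(\<Union>(U, \<phi>)\<in>charts G. U) = UNIV" using atlas unfolding is_atlas_def by simp
  then have "p \<in> (\<Union>(U, \<phi>)\<in>charts G. U)" by simp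
  then show ?thesis using that by auto
qed

lemma R_iff: "f \<in> R \<longleftrightarrow> (\<forall>(U, \<phi>)\<in>charts G. smooth_on (\<phi> ` U) (\<lambda>y. f (inv_into U \<phi> y)))"
  unfolding smooth_funs_def comp_def by simp

lemma R_chart: "f \<in> R \<Longrightarrow> (U, \<phi>) \<in> charts G \<Longrightarrow> smooth_on (\<phi> ` U) (\<lambda>y. f (inv_into U \<phi> y))"
  unfolding R_iff by blast

lemma R_const [simp, intro]: "(\<lambda>_. c) \<in> R"
  unfolding R_iff by (auto simp: smooth_on_const)

lemma R_0 [simp, intro]: "0 \<in> R" unfolding zero_fun_def by (rule R_const)
lemma R_1 [simp, intro]: "1 \<in> R" unfolding one_fun_def by (rule R_const)

lemma R_add [simp, intro]: "f \<in> R \<Longrightarrow> g \<in> R \<Longrightarrow> f + g \<in> R"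
  unfolding R_iff plus_fun_def by (auto intro!: smooth_on_add chart(2))

lemma R_mult [simp, intro]: "f \<in> R \<Longrightarrow> g \<in> R \<Longrightarrow> f * g \<in> R"
  unfolding R_iff times_fun_def by (auto intro!: smooth_on_mult chart(2))

lemma R_diff [simp, intro]: "f \<in> R \<Longrightarrow> g \<in> R \<Longrightarrow> f - g \<in> R"
  unfolding R_iff fun_diff_def by (auto intro!: smooth_on_minus chart(2))

lemma R_uminus [simp, intro]: "f \<in> R \<Longrightarrow> - f \<in> R"
  using R_diff[OF R_0] by simp

lemma R_sum [simp, intro]: "(\<And>i. i \<in> I \<Longrightarrow> f i \<in> R) \<Longrightarrow> (\<Sum>i\<in>I. f i) \<in> R"
  by (induction I rule: infinite_finite_induct) auto

text \<open>A coordinate expression of \<open>X\<close>, tested on the functions that are smooth on the whole manifold.\<close>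

definition components :: "'a vf \<Rightarrow> 'a set \<Rightarrow> ('a \<Rightarrow> 'e) \<Rightarrow> ('e \<Rightarrow> 'e) \<Rightarrow> bool" where
  "components X U \<phi> c \<longleftrightarrow> smooth_on (\<phi> ` U) c \<and>
     (\<forall>f\<in>R. \<forall>p\<in>U. X f p = frechet_derivative (\<lambda>y. f (inv_into U \<phi> y)) (at (\<phi> p)) (c (\<phi> p)))"

lemma componentsD:
  assumes "components X U \<phi> c"
  shows "smooth_on (\<phi> ` U) c"
    "f \<in> R \<Longrightarrow> p \<in> U \<Longrightarrow> X f p = frechet_derivative (\<lambda>y. f (inv_into U \<phi> y)) (at (\<phi> p)) (c (\<phi> p))"
  using assms by (simp_all add: components_def)

lemma V_iff: "X \<in> V \<longleftrightarrow> (\<forall>f. f \<notin> R \<longrightarrow> X f = 0) \<and> (\<forall>(U, \<phi>)\<in>charts G. \<exists>c. components X U \<phi> c)"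
  by (simp add: vfields_def comp_def components_def)

lemma V_chart: "X \<in> V \<Longrightarrow> (U, \<phi>) \<in> charts G \<Longrightarrow> \<exists>c. components X U \<phi> c"
  by (auto simp: V_iff)

lemma V_intro:
  assumes "\<And>f. f \<notin> R \<Longrightarrow> X f = 0" "\<And>U \<phi>. (U, \<phi>) \<in> charts G \<Longrightarrow> \<exists>c. components X U \<phi> c"
  shows "X \<in> V"
  using assms by (auto simp: V_iff)

lemma V_nonsmooth: "X \<in> V \<Longrightarrow> f \<notin> R \<Longrightarrow> X f = 0"
  unfolding vfields_def by simp

lemma V_R [intro]:
  assumes "X \<in> V" shows "X f \<in> R"
proof (cases "f \<in> R")
  case True
  show ?thesis unfolding R_iff
  proof (clarify)
    fix U \<phi> assume U: "(U, \<phi>) \<in> charts G"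
    obtain c where c0: "components X U \<phi> c" using V_chart[OF assms U] by blast
    note c = componentsD[OF c0]
    have "smooth_on (\<phi> ` U) (\<lambda>y. frechet_derivative (\<lambda>y. f (inv_into U \<phi> y)) (at y) (c y))"
      by (intro smooth_on_directional chart(2)[OF U] R_chart[OF True U] c(1))
    then show "smooth_on (\<phi> ` U) (\<lambda>y. X f (inv_into U \<phi> y))"
      by (rule smooth_on_cong[OF chart(2)[OF U], THEN iffD1, rotated])
        (auto simp: c(2) True chart(4)[OF U])
  qed
qed (simp add: V_nonsmooth[OF assms])

lemma chart_derivative:
  assumes "f \<in> R" "(U, \<phi>) \<in> charts G" "p \<in> U"
  shows "((\<lambda>y. f (inv_into U \<phi> y)) has_derivative
    frechet_derivative (\<lambda>y. f (inv_into U \<phi> y)) (at (\<phi> p))) (at (\<phi> p))"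
  using smooth_on_differentiable[OF R_chart[OF assms(1,2)]] assms(3)
  by (simp add: frechet_derivative_works)

lemma deriv_add:
  assumes "X \<in> V" "f \<in> R" "g \<in> R" shows "X (f + g) = X f + X g"
proof
  fix p
  obtain U \<phi> where U: "(U, \<phi>) \<in> charts G" "p \<in> U" using chart_at .
  obtain c where c0: "components X U \<phi> c" using V_chart[OF assms(1) U(1)] by blast
    note c = componentsD[OF c0]
  show "X (f + g) p = (X f + X g) p"
    unfolding plus_fun_apply c(2)[OF assms(2) U(2)] c(2)[OF assms(3) U(2)]
      c(2)[OF R_add[OF assms(2,3)] U(2)]
    by (subst frechet_derivative_at[OF has_derivative_add[OF
            chart_derivative[OF assms(2) U] chart_derivative[OF assms(3) U]], symmetric]) simp
qed

lemma deriv_mult: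
  assumes "X \<in> V" "f \<in> R" "g \<in> R" shows "X (f * g) = X f * g + f * X g"
proof
  fix p
  obtain U \<phi> where U: "(U, \<phi>) \<in> charts G" "p \<in> U" using chart_at .
  obtain c where c0: "components X U \<phi> c" using V_chart[OF assms(1) U(1)] by blast
    note c = componentsD[OF c0]
  show "X (f * g) p = (X f * g + f * X g) p"
    unfolding plus_fun_apply times_fun_apply c(2)[OF assms(2) U(2)] c(2)[OF assms(3) U(2)]
      c(2)[OF R_mult[OF assms(2,3)] U(2)]
    by (subst frechet_derivative_at[OF has_derivative_mult[OF
            chart_derivative[OF assms(2) U] chart_derivative[OF assms(3) U]], symmetric])
      (simp add: chart(4)[OF U])
qed

lemma deriv_const:
  assumes "X \<in> V" shows "X (\<lambda>_. r) = 0"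
proof
  fix p
  obtain U \<phi> where U: "(U, \<phi>) \<in> charts G" "p \<in> U" using chart_at .
  obtain c where c0: "components X U \<phi> c" using V_chart[OF assms(1) U(1)] by blast
    note c = componentsD[OF c0]
  show "X (\<lambda>_. r) p = 0 p"
    using c(2)[OF R_const U(2)] by (simp add: frechet_derivative_const)
qed

lemma deriv_0: "X \<in> V \<Longrightarrow> X 0 = 0"
  using deriv_const[of X 0] unfolding zero_fun_def by simp

lemma deriv_1: "X \<in> V \<Longrightarrow> X 1 = 0"
  using deriv_const[of X 1] unfolding one_fun_def by simp

lemma deriv_sum: "X \<in> V \<Longrightarrow> (\<And>i. i \<in> I \<Longrightarrow> f i \<in> R) \<Longrightarrow> X (\<Sum>i\<in>I. f i) = (\<Sum>i\<in>I. X (f i))"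
  by (induction I rule: infinite_finite_induct) (auto simp: deriv_0 deriv_add)

lemma V_add [simp, intro]:
  assumes "X \<in> V" "Y \<in> V" shows "X + Y \<in> V"
proof (rule V_intro)
  fix U \<phi> assume U: "(U, \<phi>) \<in> charts G"
  obtain c where c0: "components X U \<phi> c" using V_chart[OF assms(1) U(1)] by blast
    note c = componentsD[OF c0]
  obtain d where d0: "components Y U \<phi> d" using V_chart[OF assms(2) U(1)] by blast
    note d = componentsD[OF d0]
  have "(X + Y) f p = frechet_derivative (\<lambda>y. f (inv_into U \<phi> y)) (at (\<phi> p)) (c (\<phi> p) + d (\<phi> p))"
    if "f \<in> R" "p \<in> U" for f p
    using has_derivative_linear[OF chart_derivative[OF that(1) U that(2)]] that
    by (simp add: c d linear_add)
  then show "\<exists>c. components (X + Y) U \<phi> c"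
    unfolding components_def
    using smooth_on_add[OF chart(2)[OF U] c(1) d(1)]
    by (intro exI[of _ "\<lambda>y. c y + d y"]) simp
qed (simp add: V_nonsmooth[OF assms(1)] V_nonsmooth[OF assms(2)])

lemma V_scale [simp, intro]:
  assumes "h \<in> R" "X \<in> V" shows "vf_scale h X \<in> V"
proof (rule V_intro)
  fix U \<phi> assume U: "(U, \<phi>) \<in> charts G"
  obtain c where c0: "components X U \<phi> c" using V_chart[OF assms(2) U(1)] by blast
    note c = componentsD[OF c0]
  have "vf_scale h X f p =
      frechet_derivative (\<lambda>y. f (inv_into U \<phi> y)) (at (\<phi> p)) (h (inv_into U \<phi> (\<phi> p)) *\<^sub>R c (\<phi> p))"
    if "f \<in> R" "p \<in> U" for f p
    using has_derivative_linear[OF chart_derivative[OF that(1) U that(2)]] that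
    by (simp add: c linear_scale vf_scale_def chart(4)[OF U])
  then show "\<exists>c. components (vf_scale h X) U \<phi> c"
    unfolding components_def
    using smooth_on_scaleR[OF chart(2)[OF U] R_chart[OF assms(1) U] c(1)]
    by (intro exI[of _ "\<lambda>y. h (inv_into U \<phi> y) *\<^sub>R c y"]) simp
qed (simp add: V_nonsmooth[OF assms(2)] vf_scale_def)

lemma V_0 [simp, intro]: "0 \<in> V"
proof (rule V_intro)
  fix U \<phi> assume U: "(U, \<phi>) \<in> charts G"
  show "\<exists>c. components 0 U \<phi> c"
    unfolding components_def
    using has_derivative_linear[OF chart_derivative[OF _ U]]
    by (intro exI[of _ "\<lambda>_. 0"]) (simp add: smooth_on_const linear_0)
qed simp

lemma V_sum [intro]: "(\<And>i. i \<in> I \<Longrightarrow> X i \<in> V) \<Longrightarrow> (\<Sum>i\<in>I. X i) \<in> V"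
  by (induction I rule: infinite_finite_induct) auto

lemma V_bracket [simp, intro]:
  assumes "X \<in> V" "Y \<in> V" shows "lie_bracket X Y \<in> V"
proof (rule V_intro)
  fix U \<phi> assume U: "(U, \<phi>) \<in> charts G"
  obtain c where c0: "components X U \<phi> c" using V_chart[OF assms(1) U(1)] by blast
    note c = componentsD[OF c0]
  obtain d where d0: "components Y U \<phi> d" using V_chart[OF assms(2) U(1)] by blast
    note d = componentsD[OF d0]
  let ?z = "\<lambda>y. frechet_derivative d (at y) (c y) - frechet_derivative c (at y) (d y)"
  have "lie_bracket X Y f p = frechet_derivative (\<lambda>y. f (inv_into U \<phi> y)) (at (\<phi> p)) (?z (\<phi> p))"
    if f: "f \<in> R" and p: "p \<in> U" for f p
  proof -
    have rep: "frechet_derivative (\<lambda>y. Z f (inv_into U \<phi> y)) (at (\<phi> p)) =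
        frechet_derivative (\<lambda>y. frechet_derivative (\<lambda>y. f (inv_into U \<phi> y)) (at y) (k y)) (at (\<phi> p))"
      if "Z \<in> V" "\<And>p. p \<in> U \<Longrightarrow>
        Z f p = frechet_derivative (\<lambda>y. f (inv_into U \<phi> y)) (at (\<phi> p)) (k (\<phi> p))" for Z k
    proof (rule frechet_derivative_at[OF has_derivative_transform_within_open[OF
            chart_derivative[OF V_R[OF that(1)] U p] chart(2)[OF U]]])
      show "\<phi> p \<in> \<phi> ` U" using p by simp
      show "Z f (inv_into U \<phi> y) = frechet_derivative (\<lambda>y. f (inv_into U \<phi> y)) (at y) (k y)"
        if "y \<in> \<phi> ` U" for y
        using that \<open>\<And>p. p \<in> U \<Longrightarrow> Z f p = _ p\<close> chart(4)[OF U] by auto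
    qed
    show ?thesis
      using commutator_of_directional_derivatives[OF chart(2)[OF U] imageI[OF p] R_chart[OF f U] c(1) d(1)]
      by (simp add: lie_bracket_def c(2)[OF V_R p] d(2)[OF V_R p] assms
        rep[OF assms(1) c(2)[OF f]] rep[OF assms(2) d(2)[OF f]])
  qed
  moreover have "smooth_on (\<phi> ` U) ?z"
    by (intro smooth_on_minus smooth_on_directional chart(2)[OF U] c(1) d(1))
  ultimately show "\<exists>c. components (lie_bracket X Y) U \<phi> c"
    unfolding components_def
    by (intro exI[of _ ?z]) simp
qed (simp add: lie_bracket_def assms V_nonsmooth[OF assms(1)] V_nonsmooth[OF assms(2)] deriv_0[OF assms(1)] deriv_0[OF assms(2)])

end

section \<open>Left-invariant vector fields form a frame\<close>

text \<open>Index ranges \<open>{1..n}\<close> are to stay as they are written.\<close>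

declare One_nat_def [simp del]

lemma span_image_eq_UNIV:
  fixes c :: "nat \<Rightarrow> 'e::euclidean_space"
  assumes indep: "\<And>r. (\<Sum>a=1..DIM('e). r a *\<^sub>R c a) = 0 \<Longrightarrow> \<forall>a\<in>{1..DIM('e)}. r a = 0"
  obtains h where "x = (\<Sum>a=1..DIM('e). h a *\<^sub>R c a)"
proof -
  let ?I = "{1..DIM('e)}"
  have inj: "inj_on c ?I"
  proof (rule inj_onI, rule ccontr)
    fix a b assume ab: "a \<in> ?I" "b \<in> ?I" "c a = c b" "a \<noteq> b"
    let ?r = "\<lambda>i. if i = a then 1 else if i = b then - 1 else (0::real)"
    have "(\<Sum>i\<in>?I. ?r i *\<^sub>R c i) = (\<Sum>i\<in>?I. (if i = a then c a else 0) - (if i = b then c b else 0))"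
      using ab by (intro sum.cong) auto
    also have "\<dots> = 0" using ab unfolding sum_subtractf by (simp add: sum.delta)
    finally show False using indep[of ?r] ab(1) by fastforce
  qed
  have ind: "independent (c ` ?I)"
  proof (rule independent_if_scalars_zero)
    fix u x assume u: "(\<Sum>x\<in>c ` ?I. u x *\<^sub>R x) = 0" "x \<in> c ` ?I"
    have "(\<Sum>a\<in>?I. u (c a) *\<^sub>R c a) = 0" using u(1) unfolding sum.reindex[OF inj] comp_def .
    then show "u x = 0" using indep[of "\<lambda>a. u (c a)"] u(2) by auto
  qed simp
  have "UNIV \<subseteq> span (c ` ?I)"
    by (rule card_ge_dim_independent[OF _ ind]) (simp_all add: card_image[OF inj])
  then have "x \<in> span (c ` ?I)" by auto
  then obtain u where "x = (\<Sum>y\<in>c ` ?I. u y *\<^sub>R y)" by (auto simp: span_finite)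
  then have "x = (\<Sum>a=1..DIM('e). u (c a) *\<^sub>R c a)" unfolding sum.reindex[OF inj] comp_def .
  then show ?thesis by (rule that)
qed

locale lie_group_frame =
  fixes G :: "('a::{t2_space, second_countable_topology}, 'e::euclidean_space) lie_group"
    and n :: nat and v :: "nat \<Rightarrow> 'a vf"
  assumes lie: "is_lie_group G" and dim: "n = DIM('e)" and lie_basis: "lie_algebra_basis G n v"

sublocale lie_group_frame \<subseteq> atlas_group
  using lie by unfold_locales (simp add: is_lie_group_def)

context lie_group_frame
begin

lemma group_simps:
  "inv\<^bsub>G\<^esub> x \<otimes>\<^bsub>G\<^esub> (x \<otimes>\<^bsub>G\<^esub> y) = y" "x \<otimes>\<^bsub>G\<^esub> (inv\<^bsub>G\<^esub> x \<otimes>\<^bsub>G\<^esub> y) = y"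
  "inv\<^bsub>G\<^esub> (inv\<^bsub>G\<^esub> x) = x" "(x \<otimes>\<^bsub>G\<^esub> inv\<^bsub>G\<^esub> y) \<otimes>\<^bsub>G\<^esub> y = x"
proof -
  interpret group G using lie by (simp add: is_lie_group_def)
  have "z \<in> carrier G" for z using lie by (simp add: is_lie_group_def)
  then show "inv\<^bsub>G\<^esub> x \<otimes>\<^bsub>G\<^esub> (x \<otimes>\<^bsub>G\<^esub> y) = y" "x \<otimes>\<^bsub>G\<^esub> (inv\<^bsub>G\<^esub> x \<otimes>\<^bsub>G\<^esub> y) = y"
    "inv\<^bsub>G\<^esub> (inv\<^bsub>G\<^esub> x) = x" "(x \<otimes>\<^bsub>G\<^esub> inv\<^bsub>G\<^esub> y) \<otimes>\<^bsub>G\<^esub> y = x"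
    by (simp_all add: m_assoc[symmetric] del: m_assoc) (simp add: m_assoc)
qed

lemma lt_fn_cancel [simp]:
  "lt_fn G x (lt_fn G (inv\<^bsub>G\<^esub> x) f) = f" "lt_fn G (inv\<^bsub>G\<^esub> x) (lt_fn G x f) = f"
  by (simp_all add: lt_fn_def group_simps)

lemma lt_fn_arith:
  "lt_fn G x (f + g) = lt_fn G x f + lt_fn G x g"
  "lt_fn G x (f - g) = lt_fn G x f - lt_fn G x g"
  "lt_fn G x (f * g) = lt_fn G x f * lt_fn G x g"
  "lt_fn G x 0 = 0"
  by (auto simp: lt_fn_def)

lemma v_left_inv: "a \<in> {1..n} \<Longrightarrow> v a \<in> left_inv_vfields G"
  using lie_basis by (simp add: lie_algebra_basis_def)

lemma left_inv_V: "X \<in> left_inv_vfields G \<Longrightarrow> X \<in> V"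
  by (simp add: left_inv_vfields_def)

lemma v_V: "a \<in> {1..n} \<Longrightarrow> v a \<in> V"
  using v_left_inv left_inv_V by blast

lemma left_inv_eq: "X \<in> left_inv_vfields G \<Longrightarrow> lt_fn G x (X (lt_fn G (inv\<^bsub>G\<^esub> x) f)) = X f"
  unfolding left_inv_vfields_def lt_vf_def by (auto dest: fun_cong)

text \<open>Left-invariance is an equality of operators on all functions. The case in which only one of \<open>f\<close>
and its translate is smooth is what makes \<open>R_lt_fn\<close> work.\<close>

lemma left_inv_lt_fn:
  assumes "X \<in> left_inv_vfields G" shows "X (lt_fn G x f) = lt_fn G x (X f)"
  using left_inv_eq[OF assms, of x "lt_fn G x f"] by simp

lemma left_inv_0: "0 \<in> left_inv_vfields G"
  by (auto simp: left_inv_vfields_def lt_vf_def lt_fn_arith)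

lemma left_inv_bracket:
  assumes "X \<in> left_inv_vfields G" "Y \<in> left_inv_vfields G"
  shows "lie_bracket X Y \<in> left_inv_vfields G"
proof -
  have "lt_vf G x (lie_bracket X Y) = lie_bracket X Y" for x
    by (rule ext) (simp add: lt_vf_def lie_bracket_def left_inv_lt_fn assms lt_fn_arith)
  then show ?thesis using assms by (simp add: left_inv_vfields_def)
qed

text \<open>A combination with constant coefficients is left-invariant; if it vanishes at \<open>p\<close>, translating
from \<open>p\<close> to any other point shows that it vanishes everywhere.\<close>

lemma invariant_fields_independent_at:
  assumes "\<And>f. f \<in> R \<Longrightarrow> (\<Sum>a=1..n. r a * v a f p) = 0"
  shows "\<forall>a\<in>{1..n}. r a = 0"
proof -
  have "(\<Sum>a=1..n. r a * v a f q) = 0" for f q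
  proof -
    \<comment> \<open>translation by \<open>x\<close> takes \<open>q\<close> to \<open>p\<close>\<close>
    define x where "x = p \<otimes>\<^bsub>G\<^esub> inv\<^bsub>G\<^esub> q"
    let ?f = "lt_fn G (inv\<^bsub>G\<^esub> x) f"
    have "v a f q = v a ?f p" if "a \<in> {1..n}" for a
    proof -
      have "v a f q = lt_fn G x (v a ?f) q" by (simp add: left_inv_eq[OF v_left_inv[OF that]])
      also have "\<dots> = v a ?f p" by (simp add: lt_fn_def x_def group_simps)
      finally show ?thesis .
    qed
    then have eq: "(\<Sum>a=1..n. r a * v a f q) = (\<Sum>a=1..n. r a * v a ?f p)" by simp
    show ?thesis
    proof (cases "?f \<in> R")
      case False
      then have "v a ?f p = 0" if "a \<in> {1..n}" for a using V_nonsmooth[OF v_V[OF that] False] by simp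
      then show ?thesis unfolding eq by simp
    qed (simp only: eq assms)
  qed
  then have "(\<Sum>a=1..n. vf_scale (\<lambda>_. r a) (v a)) = 0"
    by (intro ext) (simp add: sum_apply vf_scale_def)
  then have 1: "0 = (\<Sum>a=1..n. vf_scale (\<lambda>_. restrict r {1..n} a) (v a))" by simp
  have 2: "0 = (\<Sum>a=1..n. vf_scale (\<lambda>_. restrict (\<lambda>_. 0) {1..n} a) (v a))"
    by (intro ext) (simp add: sum_apply vf_scale_def)
  let ?P = "\<lambda>c. c \<in> {1..n} \<rightarrow>\<^sub>E (UNIV :: real set) \<and> 0 = (\<Sum>a=1..n. vf_scale (\<lambda>_. c a) (v a))"
  have "\<exists>!c. ?P c" using lie_basis left_inv_0 unfolding lie_algebra_basis_def by blast
  then obtain c where c: "\<forall>d. ?P d \<longrightarrow> d = c" unfolding Ex1_def by blast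
  have "?P (restrict r {1..n})" using 1 by auto
  moreover have "?P (restrict (\<lambda>_. 0) {1..n})" using 2 by auto
  ultimately have "restrict r {1..n} = restrict (\<lambda>_. 0) {1..n}"
    using c[rule_format, of "restrict r {1..n}"] c[rule_format, of "restrict (\<lambda>_. 0) {1..n}"]
    by (simp only:)
  then show ?thesis by (metis restrict_apply')
qed

lemma chart_components:
  assumes "(U, \<phi>) \<in> charts G"
  obtains c where "\<forall>a\<in>{1..n}. components (v a) U \<phi> (c a)"
proof -
  have "\<forall>a. \<exists>c. a \<in> {1..n} \<longrightarrow> components (v a) U \<phi> c"
    using V_chart[OF v_V assms] by blast
  then obtain c where "\<forall>a. a \<in> {1..n} \<longrightarrow> components (v a) U \<phi> (c a)"
    using choice[of "\<lambda>a c. a \<in> {1..n} \<longrightarrow> components (v a) U \<phi> c"] by blast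
  then show ?thesis using that by blast
qed

lemma chart_components_combination:
  assumes U: "(U, \<phi>) \<in> charts G" "p \<in> U" and c: "\<And>a. a \<in> {1..n} \<Longrightarrow> components (v a) U \<phi> (c a)"
    and "f \<in> R"
  shows "frechet_derivative (\<lambda>y. f (inv_into U \<phi> y)) (at (\<phi> p)) (\<Sum>a=1..n. r a *\<^sub>R c a (\<phi> p))
    = (\<Sum>a=1..n. r a * v a f p)"
proof -
  have "linear (frechet_derivative (\<lambda>y. f (inv_into U \<phi> y)) (at (\<phi> p)))"
    by (rule has_derivative_linear[OF chart_derivative[OF assms(4) U]])
  then show ?thesis
    using componentsD(2)[OF c assms(4) U(2)]
    by (simp add: linear_sum linear_scale)
qed

lemma chart_components_independent:
  assumes U: "(U, \<phi>) \<in> charts G" "p \<in> U" and c: "\<And>a. a \<in> {1..n} \<Longrightarrow> components (v a) U \<phi> (c a)"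
    and 0: "(\<Sum>a=1..n. r a *\<^sub>R c a (\<phi> p)) = 0"
  shows "\<forall>a\<in>{1..n}. r a = 0"
proof (rule invariant_fields_independent_at[of _ p])
  fix f assume f: "f \<in> R"
  have "linear (frechet_derivative (\<lambda>y. f (inv_into U \<phi> y)) (at (\<phi> p)))"
    by (rule has_derivative_linear[OF chart_derivative[OF f U]])
  then show "(\<Sum>a=1..n. r a * v a f p) = 0"
    using chart_components_combination[OF U c f, of r] by (simp add: 0 linear_0)
qed

lemma chart_components_span:
  assumes U: "(U, \<phi>) \<in> charts G" "p \<in> U" and c: "\<And>a. a \<in> {1..n} \<Longrightarrow> components (v a) U \<phi> (c a)"
  obtains h where "x = (\<Sum>a=1..n. h a *\<^sub>R c a (\<phi> p))"
proof -
  obtain h where "x = (\<Sum>a=1..DIM('e). h a *\<^sub>R c a (\<phi> p))"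
    by (rule span_image_eq_UNIV[of "\<lambda>a. c a (\<phi> p)"])
      (use chart_components_independent[OF U c] in \<open>simp add: dim\<close>)
  then show ?thesis using that by (simp add: dim)
qed

text \<open>In a chart the components of the \<open>v a\<close> are a basis of the model space at each point. This yields
the coefficients pointwise. They do not depend on the chart, by independence of the \<open>v a\<close> at a point,
and they are smooth because they solve a linear system with smooth data.\<close>

lemma V_expansion:
  assumes "X \<in> V"
  obtains h where "\<forall>a\<in>{1..n}. h a \<in> R" "X = (\<Sum>a=1..n. vf_scale (h a) (v a))"
proof -
  have ex: "\<exists>k. \<forall>f\<in>R. X f p = (\<Sum>a=1..n. k a * v a f p)" for p
  proof -
    obtain U \<phi> where U: "(U, \<phi>) \<in> charts G" "p \<in> U" by (rule chart_at)
    obtain c where "\<forall>a\<in>{1..n}. components (v a) U \<phi> (c a)"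
      by (rule chart_components[OF U(1)])
  note c = bspec[OF this]
    obtain d where d: "components X U \<phi> d" using V_chart[OF assms U(1)] by blast
    obtain k where k: "d (\<phi> p) = (\<Sum>a=1..n. k a *\<^sub>R c a (\<phi> p))"
      by (rule chart_components_span[OF U c])
    have "X f p = (\<Sum>a=1..n. k a * v a f p)" if "f \<in> R" for f
      using chart_components_combination[OF U c that, of k] componentsD(2)[OF d that U(2)] k by simp
    then show ?thesis by blast
  qed
  have "\<exists>k. \<forall>p. \<forall>f\<in>R. X f p = (\<Sum>a=1..n. k p a * v a f p)"
    by (rule choice) (rule allI, rule ex)
  then obtain k where k0: "\<forall>p. \<forall>f\<in>R. X f p = (\<Sum>a=1..n. k p a * v a f p)" ..
  note k = k0[rule_format]
  let ?h = "\<lambda>a p. k p a"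
  have "?h a \<in> R" if a: "a \<in> {1..n}" for a
    unfolding R_iff
  proof (clarify)
    fix U \<phi> assume U: "(U, \<phi>) \<in> charts G"
    obtain c where "\<forall>a\<in>{1..n}. components (v a) U \<phi> (c a)"
      by (rule chart_components[OF U(1)])
  note c = bspec[OF this]
    obtain d where d: "components X U \<phi> d" using V_chart[OF assms U(1)] by blast
    have shift: "(\<Sum>i<n. t (Suc i)) = (\<Sum>a=1..n. t a)" for t :: "nat \<Rightarrow> 'e"
      unfolding One_nat_def sum.atLeast1_atMost_eq ..
    have "\<forall>i<n. smooth_on (\<phi> ` U) (\<lambda>y. k (inv_into U \<phi> y) (Suc i))"
    proof (rule smooth_coefficients[OF chart(2)[OF U], where c = "\<lambda>i. c (Suc i)" and X = d])
      show "smooth_on (\<phi> ` U) (c (Suc i))" if "i < n" for i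
        using componentsD(1)[OF c[of "Suc i"]] that by simp
      show "smooth_on (\<phi> ` U) d" by (rule componentsD(1)[OF d])
      show "\<forall>i<n. r i = 0" if y: "y \<in> \<phi> ` U" "(\<Sum>i<n. r i *\<^sub>R c (Suc i) y) = 0" for y and r :: "nat \<Rightarrow> real"
      proof -
        obtain p where p: "p \<in> U" "y = \<phi> p" using y(1) by auto
        have "(\<Sum>a=1..n. r (a - 1) *\<^sub>R c a (\<phi> p)) = 0"
          using y(2) shift[of "\<lambda>a. r (a - 1) *\<^sub>R c a (\<phi> p)"] by (simp add: p)
        from bspec[OF chart_components_independent[OF U p(1) c this], of "Suc _"] show ?thesis
          by simp
      qed
      show "d y = (\<Sum>i<n. k (inv_into U \<phi> y) (Suc i) *\<^sub>R c (Suc i) y)" if y: "y \<in> \<phi> ` U" for y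
      proof -
        obtain p where p: "p \<in> U" "y = \<phi> p" using y(1) by auto
        obtain k' where k': "d (\<phi> p) = (\<Sum>a=1..n. k' a *\<^sub>R c a (\<phi> p))"
          by (rule chart_components_span[OF U p(1) c])
        have "(\<Sum>a=1..n. (k' a - k p a) * v a f p) = 0" if f: "f \<in> R" for f
          unfolding left_diff_distrib sum_subtractf
          using chart_components_combination[OF U p(1) c f, of k', folded k'] componentsD(2)[OF d f p(1)] k[OF f, of p]
          by simp
        from invariant_fields_independent_at[OF this] have eq: "\<forall>a\<in>{1..n}. k' a = k p a" by simp
        have "d (\<phi> p) = (\<Sum>a=1..n. k p a *\<^sub>R c a (\<phi> p))"
          unfolding k' by (rule sum.cong) (use eq in auto)
        then show ?thesis
          unfolding p(2) chart(4)[OF U p(1)] shift[of "\<lambda>a. k p a *\<^sub>R c a (\<phi> p)"] .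
      qed
    qed
    then have "smooth_on (\<phi> ` U) (\<lambda>y. k (inv_into U \<phi> y) (Suc (a - 1)))"
      using a by (elim allE[of _ "a - 1"]) auto
    then show "smooth_on (\<phi> ` U) (\<lambda>y. k (inv_into U \<phi> y) a)"
      using a by simp
  qed
  then have "\<forall>a\<in>{1..n}. ?h a \<in> R" ..
  moreover have "X = (\<Sum>a=1..n. vf_scale (?h a) (v a))"
  proof (intro ext)
    fix f p
    show "X f p = (\<Sum>a=1..n. vf_scale (?h a) (v a)) f p"
    proof (cases "f \<in> R")
      case True
      then show ?thesis by (simp add: k sum_apply vf_scale_def)
    next
      case False
      then have "v a f p = 0" if "a \<in> {1..n}" for a using V_nonsmooth[OF v_V[OF that] False] by simp
      then show ?thesis using V_nonsmooth[OF assms False] by (simp add: sum_apply vf_scale_def)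
    qed
  qed
  ultimately show ?thesis by (rule that)
qed

lemma locally_constant_if_invariant_derivatives_vanish:
  assumes f: "f \<in> R" and 0: "\<And>a. a \<in> {1..n} \<Longrightarrow> v a f = 0"
  shows "\<exists>T. open T \<and> p \<in> T \<and> (\<forall>q\<in>T. f q = f p)"
proof -
  obtain U \<phi> where U: "(U, \<phi>) \<in> charts G" "p \<in> U" by (rule chart_at)
  obtain c where "\<forall>a\<in>{1..n}. components (v a) U \<phi> (c a)"
    by (rule chart_components[OF U(1)])
  note c = bspec[OF this]
  let ?f = "\<lambda>y. f (inv_into U \<phi> y)"
  have D: "(?f has_derivative (\<lambda>_. 0)) (at (\<phi> q))" if q: "q \<in> U" for q
  proof -
    have "frechet_derivative ?f (at (\<phi> q)) = (\<lambda>_. 0)"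
    proof
      fix x
      obtain h where h: "x = (\<Sum>a=1..n. h a *\<^sub>R c a (\<phi> q))" by (rule chart_components_span[OF U(1) q c])
      show "frechet_derivative ?f (at (\<phi> q)) x = 0"
        unfolding h by (rule trans[OF chart_components_combination[OF U(1) q c f]]) (assumption, rule sum.neutral, simp add: 0)
    qed
    then show ?thesis using chart_derivative[OF f U(1) q] by (simp only:)
  qed
  obtain r where r: "0 < r" "ball (\<phi> p) r \<subseteq> \<phi> ` U"
    by (rule openE[OF chart(2)[OF U(1)] imageI[OF U(2)]])
  have const: "?f y = ?f (\<phi> p)" if y: "y \<in> ball (\<phi> p) r" for y
  proof (rule has_derivative_zero_unique[of "ball (\<phi> p) r" ?f])
    show "(?f has_derivative (\<lambda>h. 0)) (at z within ball (\<phi> p) r)" if z: "z \<in> ball (\<phi> p) r" for z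
      proof -
      obtain q where "q \<in> U" "z = \<phi> q" using subsetD[OF r(2) z] by auto
      then show ?thesis using has_derivative_at_withinI[OF D] by simp
    qed
  qed (use y r(1) in simp_all)
  let ?T = "U \<inter> \<phi> -` ball (\<phi> p) r"
  have "open ?T"
    by (rule continuous_open_preimage[OF homeomorphism_cont1[OF chart(3)[OF U(1)]] chart(1)[OF U(1)] open_ball])
  moreover have "f q = f p" if "q \<in> ?T" for q
    using const[of "\<phi> q"] that unfolding chart(4)[OF U] by (simp add: chart(4)[OF U(1)])
  moreover have "p \<in> ?T" using r(1) U(2) by simp
  ultimately show ?thesis by (intro exI[of _ ?T] conjI ballI)
qed

lemma continuous_left_translation: "continuous_on UNIV (\<lambda>y. x \<otimes>\<^bsub>G\<^esub> y)"
proof -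
  have "continuous_on UNIV (\<lambda>(x, y). x \<otimes>\<^bsub>G\<^esub> y)"
    using lie by (simp add: is_lie_group_def smooth_map_def)
  then have "continuous_on UNIV (\<lambda>y. (\<lambda>(x, y). x \<otimes>\<^bsub>G\<^esub> y) (x, y))"
    by (rule continuous_on_compose2) (auto intro!: continuous_intros)
  then show ?thesis by simp
qed

text \<open>Smoothness of \<open>f\<close> composed with a translation can be read off the left-invariant fields. If it
failed, all \<open>v a\<close> would vanish on the translate and hence, by invariance, on \<open>f\<close>. Then \<open>f\<close> is locally
constant, and so is its translate, which is therefore smooth after all.\<close>

lemma R_lt_fn [intro]:
  assumes f: "f \<in> R" shows "lt_fn G x f \<in> R"
proof (rule ccontr)
  assume no: "lt_fn G x f \<notin> R"
  have 0: "v a f = 0" if "a \<in> {1..n}" for a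
  proof -
    have "lt_fn G x (v a f) = 0"
      unfolding left_inv_lt_fn[OF v_left_inv[OF that], symmetric]
      by (rule V_nonsmooth[OF v_V[OF that] no])
    then have "lt_fn G (inv\<^bsub>G\<^esub> x) (lt_fn G x (v a f)) = lt_fn G (inv\<^bsub>G\<^esub> x) 0" by simp
    then show ?thesis by (simp add: lt_fn_arith)
  qed
  have "lt_fn G x f \<in> R"
    unfolding R_iff
  proof (clarify)
    fix U \<phi> assume U: "(U, \<phi>) \<in> charts G"
    show "smooth_on (\<phi> ` U) (\<lambda>y. lt_fn G x f (inv_into U \<phi> y))"
    proof (rule smooth_on_locally_constant[OF chart(2)[OF U]])
      fix y assume y: "y \<in> \<phi> ` U"
      let ?q = "\<lambda>y. x \<otimes>\<^bsub>G\<^esub> inv_into U \<phi> y"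
      obtain T where T: "open T" "?q y \<in> T" "\<forall>q\<in>T. f q = f (?q y)"
        using locally_constant_if_invariant_derivatives_vanish[OF f 0, of "?q y"] by blast
      have "continuous_on (\<phi> ` U) ?q"
        by (rule continuous_on_compose2[OF continuous_left_translation homeomorphism_cont2[OF chart(3)[OF U]]]) simp
      then have "open (\<phi> ` U \<inter> ?q -` T)"
        using chart(2)[OF U] T(1) by (rule continuous_open_preimage)
      moreover have "y \<in> \<phi> ` U \<inter> ?q -` T" using y T(2) by simp
      moreover have "\<forall>z\<in>\<phi> ` U \<inter> ?q -` T. lt_fn G x f (inv_into U \<phi> z) = lt_fn G x f (inv_into U \<phi> y)"
        unfolding lt_fn_def using T(3) by blast
      ultimately show "\<exists>T. open T \<and> y \<in> T \<and> (\<forall>z\<in>T. lt_fn G x f (inv_into U \<phi> z) = lt_fn G x f (inv_into U \<phi> y))"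
        by blast
    qed
  qed
  with no show False by simp
qed

text \<open>Translating a field amounts to translating its coefficients with respect to the invariant frame.\<close>

lemma lt_vf_V [intro]:
  assumes X: "X \<in> V" shows "lt_vf G x X \<in> V"
proof -
  obtain h where h: "\<forall>a\<in>{1..n}. h a \<in> R" "X = (\<Sum>a=1..n. vf_scale (h a) (v a))"
    by (rule V_expansion[OF X])
  have "lt_vf G x X f = (\<Sum>a=1..n. vf_scale (lt_fn G x (h a)) (v a)) f" for f
  proof (rule ext)
    fix p
    have "v a (lt_fn G (inv\<^bsub>G\<^esub> x) f) (x \<otimes>\<^bsub>G\<^esub> p) = v a f p" if "a \<in> {1..n}" for a
      using fun_cong[OF left_inv_eq[OF v_left_inv[OF that], of x f], of p] by (simp add: lt_fn_def)
    then show "lt_vf G x X f p = (\<Sum>a=1..n. vf_scale (lt_fn G x (h a)) (v a)) f p"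
      by (simp add: h(2) lt_vf_def sum_apply vf_scale_def lt_fn_def[of _ _ "_ :: 'a fn"])
  qed
  then have "lt_vf G x X = (\<Sum>a=1..n. vf_scale (lt_fn G x (h a)) (v a))" by blast
  moreover have "(\<Sum>a=1..n. vf_scale (lt_fn G x (h a)) (v a)) \<in> V"
    by (intro V_sum V_scale R_lt_fn bspec[OF h(1)] v_V)
  ultimately show ?thesis by (simp only:)
qed

lemma lt_vf_cancel [simp]:
  "lt_vf G x (lt_vf G (inv\<^bsub>G\<^esub> x) X) = X" "lt_vf G (inv\<^bsub>G\<^esub> x) (lt_vf G x X) = X"
  by (simp_all add: lt_vf_def group_simps)

lemma lt_vf_V_iff: "lt_vf G x X \<in> V \<longleftrightarrow> X \<in> V"
  using lt_vf_V lt_vf_cancel by metis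

end

section \<open>One-forms and sections\<close>

text \<open>The real numbers as constant functions.\<close>

definition K :: "real \<Rightarrow> 'a \<Rightarrow> real" where "K c = (\<lambda>_. c)"

lemma K_arith:
  "K a + K b = K (a + b)" "K a * K b = K (a * b)" "K a - K b = K (a - b)" "- K a = K (- a)"
  "K 0 = 0" "K 1 = 1"
  by (auto simp: K_def)

lemma K_sum: "(\<Sum>i\<in>I. K (f i)) = K (\<Sum>i\<in>I. f i)"
  by (induction I rule: infinite_finite_induct) (simp_all add: K_arith)

lemma K_eq_iff [simp]: "K a = K b \<longleftrightarrow> a = b" "K a = 0 \<longleftrightarrow> a = 0"
  by (auto simp: K_def fun_eq_iff)

text \<open>\<open>K (1/2)\<close> is the factor in the definition of the scalar product; these rules absorb it.\<close>

lemma K_half: "K (1/2) * f + K (1/2) * f = f" "2 * (K (1/2) * f) = f" "K (1/2) * (2 * f) = f"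
  by (auto simp: K_def fun_eq_iff)

lemma vf_scale_apply: "vf_scale f X h = f * X h" by (simp add: vf_scale_def)

lemma lie_bracket_swap: "lie_bracket X Y = - lie_bracket Y X"
  by (intro ext) (simp add: lie_bracket_def)

context atlas_group
begin

abbreviation O1 where "O1 \<equiv> one_forms G"

lemma K_R [simp, intro]: "K c \<in> R" by (simp add: K_def)

lemma lie_bracket_add_right:
  assumes "X \<in> V" "Y \<in> V" "Z \<in> V"
  shows "lie_bracket X (Y + Z) = lie_bracket X Y + lie_bracket X Z"
proof
  fix f
  show "lie_bracket X (Y + Z) f = (lie_bracket X Y + lie_bracket X Z) f"
    by (simp add: lie_bracket_def deriv_add[OF assms(1) V_R[OF assms(2)] V_R[OF assms(3)]])
qed

lemma lie_bracket_add_left: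
  assumes "X \<in> V" "Y \<in> V" "Z \<in> V"
  shows "lie_bracket (Y + Z) X = lie_bracket Y X + lie_bracket Z X"
  using lie_bracket_add_right[OF assms]
  by (simp add: lie_bracket_swap[of _ X])

lemma lie_bracket_scale_right:
  assumes "X \<in> V" "Y \<in> V" "f \<in> R"
  shows "lie_bracket X (vf_scale f Y) = vf_scale f (lie_bracket X Y) + vf_scale (X f) Y"
proof
  fix h
  show "lie_bracket X (vf_scale f Y) h = (vf_scale f (lie_bracket X Y) + vf_scale (X f) Y) h"
    by (simp add: lie_bracket_def vf_scale_def deriv_mult[OF assms(1,3) V_R[OF assms(2)]] algebra_simps)
qed

lemma lie_bracket_scale_left:
  assumes "X \<in> V" "Y \<in> V" "f \<in> R"
  shows "lie_bracket (vf_scale f Y) X = vf_scale f (lie_bracket Y X) - vf_scale (X f) Y"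
proof
  fix h
  show "lie_bracket (vf_scale f Y) X h = (vf_scale f (lie_bracket Y X) - vf_scale (X f) Y) h"
    by (simp add: lie_bracket_def vf_scale_def deriv_mult[OF assms(1,3) V_R[OF assms(2)]] algebra_simps)
qed

lemma V_uminus: "X \<in> V \<Longrightarrow> - X \<in> V"
proof -
  assume "X \<in> V"
  then have "vf_scale (- 1) X \<in> V" by (intro V_scale R_uminus R_1)
  moreover have "vf_scale (- 1) X = - X" by (rule ext) (simp add: vf_scale_def)
  ultimately show ?thesis by simp
qed

lemma O1D:
  assumes "\<xi> \<in> O1"
  shows "X \<notin> V \<Longrightarrow> \<xi> X = 0" "X \<in> V \<Longrightarrow> \<xi> X \<in> R"
    "X \<in> V \<Longrightarrow> Y \<in> V \<Longrightarrow> \<xi> (X + Y) = \<xi> X + \<xi> Y"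
    "f \<in> R \<Longrightarrow> X \<in> V \<Longrightarrow> \<xi> (vf_scale f X) = f * \<xi> X"
  using assms by (simp_all add: one_forms_def)

lemma O1_0: "\<xi> \<in> O1 \<Longrightarrow> \<xi> 0 = 0"
  using O1D(3)[of \<xi> 0 0] by simp

lemma O1_uminus: "\<xi> \<in> O1 \<Longrightarrow> X \<in> V \<Longrightarrow> \<xi> (- X) = - \<xi> X"
  using O1D(3)[of \<xi> X "- X"] V_uminus[of X] O1_0[of \<xi>]
  by (simp add: eq_neg_iff_add_eq_0 add.commute)

lemma O1_diff: "\<xi> \<in> O1 \<Longrightarrow> X \<in> V \<Longrightarrow> Y \<in> V \<Longrightarrow> \<xi> (X - Y) = \<xi> X - \<xi> Y"
  using O1D(3)[of \<xi> X "- Y"] V_uminus[of Y] O1_uminus[of \<xi> Y] by simp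

lemma O1_sum: "\<xi> \<in> O1 \<Longrightarrow> (\<And>i. i \<in> I \<Longrightarrow> X i \<in> V) \<Longrightarrow> \<xi> (\<Sum>i\<in>I. X i) = (\<Sum>i\<in>I. \<xi> (X i))"
proof (induction I rule: infinite_finite_induct)
  case (insert i I)
  have "\<xi> (X i + sum X I) = \<xi> (X i) + \<xi> (sum X I)"
    using insert.prems by (intro O1D(3) V_sum) auto
  also have "\<xi> (sum X I) = (\<Sum>i\<in>I. \<xi> (X i))" using insert.IH insert.prems by blast
  finally show ?case unfolding sum.insert[OF insert.hyps(1,2)] .
next
  case (infinite A)
  then show ?case using O1_0[OF infinite.prems(1)] by simp
next
  case empty
  then show ?case using O1_0[OF empty.prems(1)] by simp
qed

lemma O1_I:
  assumes "\<And>X. X \<in> V \<Longrightarrow> \<xi> X \<in> R"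
    "\<And>X Y. X \<in> V \<Longrightarrow> Y \<in> V \<Longrightarrow> \<xi> (X + Y) = \<xi> X + \<xi> Y"
    "\<And>f X. f \<in> R \<Longrightarrow> X \<in> V \<Longrightarrow> \<xi> (vf_scale f X) = f * \<xi> X"
  shows "on_vfields G \<xi> \<in> O1"
  unfolding one_forms_def on_vfields_def by (simp add: assms)

lemma O1_add: "\<xi> \<in> O1 \<Longrightarrow> \<eta> \<in> O1 \<Longrightarrow> \<xi> + \<eta> \<in> O1"
  unfolding one_forms_def by (simp add: algebra_simps)

lemma O1_scale: "f \<in> R \<Longrightarrow> \<xi> \<in> O1 \<Longrightarrow> (\<lambda>Z. f * \<xi> Z) \<in> O1"
  unfolding one_forms_def by (simp add: algebra_simps)

lemma O1_zero: "0 \<in> O1"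
  unfolding one_forms_def by simp

lemma O1_neg: "\<xi> \<in> O1 \<Longrightarrow> - \<xi> \<in> O1"
  unfolding one_forms_def by simp

lemma O2D:
  assumes "\<omega> \<in> two_forms G" "X \<in> V" "Y \<in> V"
  shows "\<omega> X \<in> O1" "\<omega> X Y = - \<omega> Y X" "Z \<in> V \<Longrightarrow> \<omega> (X + Y) Z = \<omega> X Z + \<omega> Y Z"
    "f \<in> R \<Longrightarrow> \<omega> (vf_scale f X) Y = f * \<omega> X Y"
proof -
  have 1: "\<omega> X \<in> O1" if "X \<in> V" for X using assms(1) that by (simp add: two_forms_def)
  have 2: "\<omega> X Y = - \<omega> Y X" if "X \<in> V" "Y \<in> V" for X Y
    using assms(1) that unfolding two_forms_def by blast
  show "\<omega> X \<in> O1" by (rule 1[OF assms(2)])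
  show "\<omega> X Y = - \<omega> Y X" by (rule 2[OF assms(2,3)])
  show "\<omega> (X + Y) Z = \<omega> X Z + \<omega> Y Z" if "Z \<in> V"
    unfolding 2[OF V_add[OF assms(2,3)] that] 2[OF assms(2) that] 2[OF assms(3) that]
    using O1D(3)[OF 1[OF that] assms(2,3)] by simp
  show "\<omega> (vf_scale f X) Y = f * \<omega> X Y" if "f \<in> R"
    unfolding 2[OF V_scale[OF that assms(2)] assms(3)] 2[OF assms(2,3)]
    using O1D(4)[OF 1[OF assms(3)] that assms(2)] by simp
qed

lemma O3D:
  assumes "\<omega> \<in> three_forms G" "X \<in> V" "Y \<in> V" "Z \<in> V"
  shows "\<omega> X \<in> two_forms G" "\<omega> X Y Z = - \<omega> Y X Z" "\<omega> X Y Z = - \<omega> X Z Y"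
    "W \<in> V \<Longrightarrow> \<omega> (X + W) Y Z = \<omega> X Y Z + \<omega> W Y Z"
    "f \<in> R \<Longrightarrow> \<omega> (vf_scale f X) Y Z = f * \<omega> X Y Z"
proof -
  have 1: "\<omega> X \<in> two_forms G" if "X \<in> V" for X using assms(1) that by (simp add: three_forms_def)
  have "\<omega> X Y = - \<omega> Y X" if "X \<in> V" "Y \<in> V" for X Y
    using assms(1) that unfolding three_forms_def by blast
  then have 2: "\<omega> X Y Z = - \<omega> Y X Z" if "X \<in> V" "Y \<in> V" for X Y Z
    using that by (metis uminus_apply)
  show "\<omega> X \<in> two_forms G" by (rule 1[OF assms(2)])
  show "\<omega> X Y Z = - \<omega> Y X Z" by (rule 2[OF assms(2,3)])
  show "\<omega> X Y Z = - \<omega> X Z Y" by (rule O2D(2)[OF 1[OF assms(2)] assms(3,4)])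
  show "\<omega> (X + W) Y Z = \<omega> X Y Z + \<omega> W Y Z" if "W \<in> V"
    unfolding 2[OF V_add[OF assms(2) that] assms(3)] 2[OF assms(2,3)] 2[OF that assms(3)]
    using O2D(3)[OF 1[OF assms(3)] assms(2) that assms(4)] by simp
  show "\<omega> (vf_scale f X) Y Z = f * \<omega> X Y Z" if "f \<in> R"
    unfolding 2[OF V_scale[OF that assms(2)] assms(3)] 2[OF assms(2,3)]
    using O2D(4)[OF 1[OF assms(3)] assms(2,4) that] by simp
qed

abbreviation S where "S \<equiv> sections G"

lemma S_iff: "(X, \<xi>, l) \<in> S \<longleftrightarrow> X \<in> V \<and> \<xi> \<in> O1 \<and> l \<in> R"
  by (simp add: sections_def)

lemma S_add [simp, intro]: "u \<in> S \<Longrightarrow> w \<in> S \<Longrightarrow> u + w \<in> S"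
  by (cases u; cases w) (auto simp: S_iff O1_add)

lemma S_0 [simp, intro]: "0 \<in> S"
  by (simp add: zero_prod_def S_iff O1_zero)

lemma S_scale [simp, intro]: "f \<in> R \<Longrightarrow> u \<in> S \<Longrightarrow> scale f u \<in> S"
  by (cases u) (simp add: scale_def S_iff O1_scale V_scale[unfolded vf_scale_def])

lemma S_uminus [simp, intro]: "u \<in> S \<Longrightarrow> - u \<in> S"
  by (cases u) (auto simp: S_iff O1_neg V_uminus)

lemma S_diff [simp, intro]: "u \<in> S \<Longrightarrow> w \<in> S \<Longrightarrow> u - w \<in> S"
  using S_add[of u "- w"] by simp

lemma S_sum [intro]: "(\<And>i. i \<in> I \<Longrightarrow> u i \<in> S) \<Longrightarrow> (\<Sum>i\<in>I. u i) \<in> S"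
  by (induction I rule: infinite_finite_induct) auto

end

lemma scale_add_right: "scale f (u + w) = scale f u + scale f w"
  by (cases u; cases w) (auto simp: scale_def fun_eq_iff algebra_simps)

lemma scale_add_left: "scale (f + h) u = scale f u + scale h u"
  by (cases u) (auto simp: scale_def fun_eq_iff algebra_simps)

lemma scale_scale: "scale f (scale h u) = scale (f * h) u"
  by (cases u) (auto simp: scale_def fun_eq_iff algebra_simps)

lemma scale_1 [simp]: "scale 1 u = u"
  by (cases u) (auto simp: scale_def fun_eq_iff)

lemma scale_0 [simp]: "scale 0 u = 0" "scale f 0 = 0"
  by (cases u) (auto simp: scale_def zero_prod_def fun_eq_iff)

lemma scale_minus: "scale f (- u) = - scale f u" "scale (- f) u = - scale f u"
  by (cases u; auto simp: scale_def fun_eq_iff)+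

lemma scale_diff: "scale f (u - w) = scale f u - scale f w" "scale (f - h) u = scale f u - scale h u"
  by (cases u; cases w; auto simp: scale_def fun_eq_iff algebra_simps)+

lemma scale_sum: "scale f (\<Sum>i\<in>I. u i) = (\<Sum>i\<in>I. scale f (u i))"
  by (induction I rule: infinite_finite_induct) (simp_all add: scale_add_right)

lemma scale_sum_left: "scale (\<Sum>i\<in>I. f i) u = (\<Sum>i\<in>I. scale (f i) u)"
proof (induction I rule: infinite_finite_induct)
  case (insert i I)
  show ?case unfolding sum.insert[OF insert.hyps] scale_add_left insert.IH ..
next
  case (infinite I)
  show ?case unfolding sum.infinite[OF infinite] scale_0 ..
next
  case empty
  show ?case unfolding sum.empty scale_0 ..
qed

lemma anchor_add: "anchor (u + w) h = anchor u h + anchor w h"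
  by (simp add: anchor_def)

lemma anchor_scale: "anchor (scale f u) h = f * anchor u h"
  by (cases u) (simp add: anchor_def scale_def)

lemma pairing_commute: "pairing u w = pairing w u"
  by (cases u; cases w) (simp add: pairing_def algebra_simps)

context atlas_group
begin

lemma anchor_V: "u \<in> S \<Longrightarrow> anchor u \<in> V"
  by (cases u) (simp add: anchor_def S_iff)

lemma anchor_R [simp, intro]: "u \<in> S \<Longrightarrow> anchor u f \<in> R"
  by (rule V_R[OF anchor_V])

lemma anchor_deriv:
  assumes "u \<in> S"
  shows "f \<in> R \<Longrightarrow> h \<in> R \<Longrightarrow> anchor u (f + h) = anchor u f + anchor u h"
    "f \<in> R \<Longrightarrow> h \<in> R \<Longrightarrow> anchor u (f * h) = anchor u f * h + f * anchor u h"
    "anchor u (K c) = 0" "anchor u 0 = 0" "anchor u 1 = 0"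
proof -
  note X = anchor_V[OF assms]
  show "f \<in> R \<Longrightarrow> h \<in> R \<Longrightarrow> anchor u (f + h) = anchor u f + anchor u h" by (rule deriv_add[OF X])
  show "f \<in> R \<Longrightarrow> h \<in> R \<Longrightarrow> anchor u (f * h) = anchor u f * h + f * anchor u h" by (rule deriv_mult[OF X])
  show "anchor u (K c) = 0" unfolding K_def by (rule deriv_const[OF X])
  show "anchor u 0 = 0" by (rule deriv_0[OF X])
  show "anchor u 1 = 0" by (rule deriv_1[OF X])
qed

lemma pairing_R [simp, intro]:
  assumes "u \<in> S" "w \<in> S" shows "pairing u w \<in> R"
proof -
  obtain X \<xi> l where u: "u = (X, \<xi>, l)" by (cases u)
  obtain Y \<eta> \<mu> where w: "w = (Y, \<eta>, \<mu>)" by (cases w)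
  note uw = u w
  have m: "X \<in> V" "\<xi> \<in> O1" "l \<in> R" "Y \<in> V" "\<eta> \<in> O1" "\<mu> \<in> R"
    using assms by (simp_all add: uw S_iff)
  show ?thesis
    unfolding uw pairing_def prod.case
    by (rule R_add[OF R_mult[OF R_const R_add[OF O1D(2)[OF m(2,4)] O1D(2)[OF m(5,1)]]] R_mult[OF m(3,6)]])
qed

lemma pairing_add_left:
  assumes "u \<in> S" "u' \<in> S" "w \<in> S" shows "pairing (u + u') w = pairing u w + pairing u' w"
proof -
  obtain X \<xi> l where u: "u = (X, \<xi>, l)" by (cases u)
  obtain X' \<xi>' l' where u': "u' = (X', \<xi>', l')" by (cases u')
  obtain Y \<eta> \<mu> where w: "w = (Y, \<eta>, \<mu>)" by (cases w)
  note uw = u u' w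
  have "\<eta> (X + X') = \<eta> X + \<eta> X'" using assms by (intro O1D(3)) (simp_all add: uw S_iff)
  then show ?thesis
    unfolding uw pairing_def add_Pair prod.case by (simp only: plus_fun_apply) (simp only: algebra_simps)
qed

lemma pairing_scale_left:
  assumes "f \<in> R" "u \<in> S" "w \<in> S" shows "pairing (scale f u) w = f * pairing u w"
proof -
  obtain X \<xi> l where u: "u = (X, \<xi>, l)" by (cases u)
  obtain Y \<eta> \<mu> where w: "w = (Y, \<eta>, \<mu>)" by (cases w)
  note uw = u w
  have "\<eta> (\<lambda>h. f * X h) = f * \<eta> X"
    using O1D(4)[of \<eta> f X] assms by (simp add: uw S_iff vf_scale_def)
  then show ?thesis by (simp add: uw pairing_def scale_def algebra_simps)
qed

lemma pairing_add_right: "u \<in> S \<Longrightarrow> u' \<in> S \<Longrightarrow> w \<in> S \<Longrightarrow> pairing w (u + u') = pairing w u + pairing w u'"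
  using pairing_add_left[of u u' w] by (simp add: pairing_commute[of w])

lemma pairing_scale_right: "f \<in> R \<Longrightarrow> u \<in> S \<Longrightarrow> w \<in> S \<Longrightarrow> pairing w (scale f u) = f * pairing w u"
  using pairing_scale_left[of f u w] by (simp add: pairing_commute[of w])

lemma pairing_0 [simp]: "w \<in> S \<Longrightarrow> pairing 0 w = 0" "w \<in> S \<Longrightarrow> pairing w 0 = 0"
  using pairing_scale_left[of 0 0 w] by (simp_all add: pairing_commute[of w])

lemma pairing_minus_left: "u \<in> S \<Longrightarrow> w \<in> S \<Longrightarrow> pairing (- u) w = - pairing u w"
  using pairing_scale_left[of "- 1" u w] by (simp add: scale_minus)

lemma pairing_diff_left: "u \<in> S \<Longrightarrow> u' \<in> S \<Longrightarrow> w \<in> S \<Longrightarrow> pairing (u - u') w = pairing u w - pairing u' w"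
  using pairing_add_left[of u "- u'" w] by (simp add: pairing_minus_left)

lemma pairing_sum_left:
  "(\<And>i. i \<in> I \<Longrightarrow> u i \<in> S) \<Longrightarrow> w \<in> S \<Longrightarrow> pairing (\<Sum>i\<in>I. u i) w = (\<Sum>i\<in>I. pairing (u i) w)"
proof (induction I rule: infinite_finite_induct)
  case (insert i I)
  have "pairing (u i + sum u I) w = pairing (u i) w + pairing (sum u I) w"
    using insert.prems by (intro pairing_add_left S_sum) auto
  also have "pairing (sum u I) w = (\<Sum>i\<in>I. pairing (u i) w)" using insert.IH insert.prems by blast
  finally show ?case unfolding sum.insert[OF insert.hyps(1,2)] .
qed simp_all

end

section \<open>The Dorfman bracket\<close>

text \<open>From here on identities are proved in the ring of functions. The pointwise rules would expand
sums and products of functions into abstractions, which then match no other rule.\<close>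

declare plus_fun_apply [simp del] times_fun_apply [simp del] zero_fun_apply [simp del]
  one_fun_apply [simp del] minus_apply [simp del] uminus_apply [simp del]

context atlas_group
begin

text \<open>The image of \<open>d f\<close> in \<open>E\<close>. It measures the failure of the Dorfman bracket to be linear over
functions in its first argument.\<close>

definition grad :: "'a fn \<Rightarrow> 'a sec" where "grad f = (0, d0 G f, 0)"

lemma d0_apply: "X \<in> V \<Longrightarrow> d0 G f X = X f"
  by (simp add: d0_def on_vfields_def)

lemma d0_O1: "f \<in> R \<Longrightarrow> d0 G f \<in> O1"
  unfolding d0_def by (rule O1_I) (rule V_R plus_fun_apply vf_scale_apply, assumption?)+

lemma grad_S: "f \<in> R \<Longrightarrow> grad f \<in> S"
  by (simp add: grad_def S_iff d0_O1)

lemma pairing_grad: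
  assumes "f \<in> R" "w \<in> S" shows "pairing (grad f) w = K (1/2) * anchor w f"
proof -
  obtain Y \<eta> \<mu> where w: "w = (Y, \<eta>, \<mu>)" by (cases w)
  have m: "Y \<in> V" "\<eta> \<in> O1" using assms(2) by (simp_all add: w S_iff)
  show ?thesis
    unfolding grad_def w pairing_def anchor_def prod.case fst_conv d0_apply[OF m(1)] O1_0[OF m(2)]
      K_def[symmetric] mult_zero_left add_0_right ..
qed

end

lemma scale_eq: "scale f (X, \<xi>, l) = (vf_scale f X, \<lambda>Z. f * \<xi> Z, f * l)"
  by (simp add: scale_def vf_scale_def)

locale twisted_dorfman = atlas_group G for G :: "('a::{t2_space, second_countable_topology}, 'e::euclidean_space) lie_group" +
  fixes H :: "'a form3" and F :: "'a form2"
  assumes H_form: "H \<in> three_forms G" and F_form: "F \<in> two_forms G"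
begin

abbreviation br where "br \<equiv> dorfman G H F"

text \<open>The one-form part of the Dorfman bracket, with all Lie and exterior derivatives written out.\<close>

definition dorfman_form :: "'a vf \<Rightarrow> 'a form1 \<Rightarrow> 'a fn \<Rightarrow> 'a vf \<Rightarrow> 'a form1 \<Rightarrow> 'a fn \<Rightarrow> 'a form1" where
  "dorfman_form X \<xi> l Y \<eta> \<mu> Z = X (\<eta> Z) - \<eta> (lie_bracket X Z)
     - (Y (\<xi> Z) - Z (\<xi> Y) - \<xi> (lie_bracket Y Z)) + 2 * \<mu> * Z l + H Y X Z
     - 2 * (\<mu> * F X Z - l * F Y Z)"

lemma dorfman_eq: "br (X, \<xi>, l) (Y, \<eta>, \<mu>) =
    (lie_bracket X Y, on_vfields G (dorfman_form X \<xi> l Y \<eta> \<mu>), X \<mu> - Y l + F X Y)"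
  unfolding dorfman_def dorfman_form_def prod.case lie_deriv1_def d1_def on_vfields_def
  by (auto simp: fun_eq_iff d0_apply)

lemma anchor_dorfman: "anchor (br u w) f = anchor u (anchor w f) - anchor w (anchor u f)"
  by (cases u; cases w) (simp add: dorfman_def anchor_def lie_bracket_def)

lemma dorfman_form_O1:
  assumes "X \<in> V" "\<xi> \<in> O1" "l \<in> R" "Y \<in> V" "\<eta> \<in> O1" "\<mu> \<in> R"
  shows "on_vfields G (dorfman_form X \<xi> l Y \<eta> \<mu>) \<in> O1"
proof (rule O1_I)
  note HYX = O2D(1)[OF O3D(1)[OF H_form assms(4,4,4)] assms(1,1)]
  note FX = O2D(1)[OF F_form assms(1,1)]
  note FY = O2D(1)[OF F_form assms(4,4)]
  note \<eta> = O1D[OF assms(5)]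
  note \<xi> = O1D[OF assms(2)]
  note XR = V_R[OF assms(1)] and YR = V_R[OF assms(4)]
  show "dorfman_form X \<xi> l Y \<eta> \<mu> Z \<in> R" if Z: "Z \<in> V" for Z
  proof -
    note b = V_bracket[OF assms(1) Z] V_bracket[OF assms(4) Z]
    have two: "2 \<in> R" using R_add[OF R_1 R_1] by simp
    show ?thesis
      unfolding dorfman_form_def
      by (rule two R_diff R_add R_mult XR YR V_R[OF Z] \<eta>(2)[OF b(1)] \<xi>(2)[OF b(2)]
          O1D(2)[OF HYX Z] O1D(2)[OF FX Z] O1D(2)[OF FY Z] assms | assumption)+
  qed
  show "dorfman_form X \<xi> l Y \<eta> \<mu> (Z + Z') = dorfman_form X \<xi> l Y \<eta> \<mu> Z + dorfman_form X \<xi> l Y \<eta> \<mu> Z'"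
    if Z: "Z \<in> V" "Z' \<in> V" for Z Z'
    unfolding dorfman_form_def \<eta>(3)[OF Z] \<xi>(3)[OF Z]
      lie_bracket_add_right[OF assms(1) Z] lie_bracket_add_right[OF assms(4) Z]
      \<eta>(3)[OF V_bracket[OF assms(1) Z(1)] V_bracket[OF assms(1) Z(2)]]
      \<xi>(3)[OF V_bracket[OF assms(4) Z(1)] V_bracket[OF assms(4) Z(2)]]
      deriv_add[OF assms(1) \<eta>(2)[OF Z(1)] \<eta>(2)[OF Z(2)]]
      deriv_add[OF assms(4) \<xi>(2)[OF Z(1)] \<xi>(2)[OF Z(2)]]
      O1D(3)[OF HYX Z] O1D(3)[OF FX Z] O1D(3)[OF FY Z] plus_fun_apply[of Z Z' l]
      plus_fun_apply[of Z Z' "\<xi> Y"]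
    by (simp only: algebra_simps)
  show "dorfman_form X \<xi> l Y \<eta> \<mu> (vf_scale f Z) = f * dorfman_form X \<xi> l Y \<eta> \<mu> Z"
    if f: "f \<in> R" and Z: "Z \<in> V" for f Z
    unfolding dorfman_form_def \<eta>(4)[OF f Z] \<xi>(4)[OF f Z]
      lie_bracket_scale_right[OF assms(1) Z f] lie_bracket_scale_right[OF assms(4) Z f]
      \<eta>(3)[OF V_scale[OF f V_bracket[OF assms(1) Z]] V_scale[OF XR Z]]
      \<xi>(3)[OF V_scale[OF f V_bracket[OF assms(4) Z]] V_scale[OF YR Z]]
      \<eta>(4)[OF f V_bracket[OF assms(1) Z]] \<xi>(4)[OF f V_bracket[OF assms(4) Z]]
      \<eta>(4)[OF XR Z] \<xi>(4)[OF YR Z]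
      deriv_mult[OF assms(1) f \<eta>(2)[OF Z]] deriv_mult[OF assms(4) f \<xi>(2)[OF Z]]
      O1D(4)[OF HYX f Z] O1D(4)[OF FX f Z] O1D(4)[OF FY f Z] vf_scale_apply
    by (simp add: algebra_simps)
qed

lemma br_S [simp, intro]:
  assumes "u \<in> S" "w \<in> S" shows "br u w \<in> S"
proof -
  obtain X \<xi> l where u: "u = (X, \<xi>, l)" by (cases u)
  obtain Y \<eta> \<mu> where w: "w = (Y, \<eta>, \<mu>)" by (cases w)
  have m: "X \<in> V" "\<xi> \<in> O1" "l \<in> R" "Y \<in> V" "\<eta> \<in> O1" "\<mu> \<in> R"
    using assms by (simp_all add: u w S_iff)
  show ?thesis
    unfolding u w dorfman_eq S_iff
    using dorfman_form_O1[OF m] V_bracket[OF m(1,4)]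
      R_add[OF R_diff[OF V_R[OF m(1), of \<mu>] V_R[OF m(4), of l]] O1D(2)[OF O2D(1)[OF F_form m(1,1)] m(4)]]
    by (intro conjI)
qed

lemma on_vfields_eqI:
  "(\<And>Z. Z \<in> V \<Longrightarrow> \<theta> Z = \<theta>' Z) \<Longrightarrow> on_vfields G \<theta> = on_vfields G \<theta>'"
  by (rule ext) (simp add: on_vfields_def)

lemma on_vfields_add: "on_vfields G \<theta> + on_vfields G \<theta>' = on_vfields G (\<lambda>Z. \<theta> Z + \<theta>' Z)"
  by (rule ext) (simp add: on_vfields_def plus_fun_apply minus_apply)

lemma on_vfields_diff: "on_vfields G \<theta> - on_vfields G \<theta>' = on_vfields G (\<lambda>Z. \<theta> Z - \<theta>' Z)"
  by (rule ext) (simp add: on_vfields_def plus_fun_apply minus_apply)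

lemma on_vfields_scale: "(\<lambda>Z. f * on_vfields G \<theta> Z) = on_vfields G (\<lambda>Z. f * \<theta> Z)"
  by (rule ext) (simp add: on_vfields_def)

lemma on_vfields_O1: "\<xi> \<in> O1 \<Longrightarrow> on_vfields G \<xi> = \<xi>"
  by (rule ext) (simp add: on_vfields_def O1D(1)[of \<xi>])

lemma br_add_right:
  assumes "u \<in> S" "w \<in> S" "w' \<in> S" shows "br u (w + w') = br u w + br u w'"
proof -
  obtain X \<xi> l where u: "u = (X, \<xi>, l)" by (cases u)
  obtain Y \<eta> \<mu> where w: "w = (Y, \<eta>, \<mu>)" by (cases w)
  obtain Y' \<eta>' \<mu>' where w': "w' = (Y', \<eta>', \<mu>')" by (cases w')
  have m: "X \<in> V" "\<xi> \<in> O1" "l \<in> R" "Y \<in> V" "\<eta> \<in> O1" "\<mu> \<in> R" "Y' \<in> V" "\<eta>' \<in> O1" "\<mu>' \<in> R"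
    using assms by (simp_all add: u w w' S_iff)
  note FX = O2D(1)[OF F_form m(1,1)]
  have form: "dorfman_form X \<xi> l (Y + Y') (\<eta> + \<eta>') (\<mu> + \<mu>') Z =
      dorfman_form X \<xi> l Y \<eta> \<mu> Z + dorfman_form X \<xi> l Y' \<eta>' \<mu>' Z" if Z: "Z \<in> V" for Z
    unfolding dorfman_form_def plus_fun_apply[of \<eta> \<eta>' Z] plus_fun_apply[of \<eta> \<eta>' "lie_bracket X Z"]
      plus_fun_apply[of Y Y' "\<xi> Z"] lie_bracket_add_left[OF Z m(4,7)]
      deriv_add[OF m(1) O1D(2)[OF m(5) Z] O1D(2)[OF m(8) Z]] O1D(3)[OF m(2,4,7)]
      deriv_add[OF Z O1D(2)[OF m(2,4)] O1D(2)[OF m(2,7)]]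
      O1D(3)[OF m(2) V_bracket[OF m(4) Z] V_bracket[OF m(7) Z]]
      O2D(3)[OF F_form m(4,7) Z] O3D(4)[OF H_form m(4) m(1) Z m(7)]
    by (simp only: algebra_simps)
  have 2: "on_vfields G (dorfman_form X \<xi> l (Y + Y') (\<eta> + \<eta>') (\<mu> + \<mu>')) =
      on_vfields G (\<lambda>Z. dorfman_form X \<xi> l Y \<eta> \<mu> Z + dorfman_form X \<xi> l Y' \<eta>' \<mu>' Z)"
    by (rule on_vfields_eqI) (rule form)
  have 3: "X (\<mu> + \<mu>') - (Y + Y') l + F X (Y + Y') = (X \<mu> - Y l + F X Y) + (X \<mu>' - Y' l + F X Y')"
    unfolding deriv_add[OF m(1,6,9)] O1D(3)[OF FX m(4,7)] plus_fun_apply[of Y Y' l] by (simp only: algebra_simps)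
  show ?thesis
    unfolding u w w' add_Pair dorfman_eq on_vfields_add lie_bracket_add_right[OF m(1,4,7)] 2 3 ..
qed

lemma br_add_left:
  assumes "u \<in> S" "w \<in> S" "w' \<in> S" shows "br (w + w') u = br w u + br w' u"
proof -
  obtain X \<xi> l where u: "u = (X, \<xi>, l)" by (cases u)
  obtain Y \<eta> \<mu> where w: "w = (Y, \<eta>, \<mu>)" by (cases w)
  obtain Y' \<eta>' \<mu>' where w': "w' = (Y', \<eta>', \<mu>')" by (cases w')
  have m: "X \<in> V" "\<xi> \<in> O1" "l \<in> R" "Y \<in> V" "\<eta> \<in> O1" "\<mu> \<in> R" "Y' \<in> V" "\<eta>' \<in> O1" "\<mu>' \<in> R"
    using assms by (simp_all add: u w w' S_iff)
  note HX = O3D(1)[OF H_form m(1,1,1)]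
  have form: "dorfman_form (Y + Y') (\<eta> + \<eta>') (\<mu> + \<mu>') X \<xi> l Z =
      dorfman_form Y \<eta> \<mu> X \<xi> l Z + dorfman_form Y' \<eta>' \<mu>' X \<xi> l Z" if Z: "Z \<in> V" for Z
    unfolding dorfman_form_def plus_fun_apply[of \<eta> \<eta>' Z] plus_fun_apply[of \<eta> \<eta>' X]
      plus_fun_apply[of \<eta> \<eta>' "lie_bracket X Z"]
      plus_fun_apply[of Y Y' "\<xi> Z"] lie_bracket_add_left[OF Z m(4,7)]
      deriv_add[OF m(1) O1D(2)[OF m(5) Z] O1D(2)[OF m(8) Z]]
      deriv_add[OF Z O1D(2)[OF m(5,1)] O1D(2)[OF m(8,1)]] deriv_add[OF Z m(6,9)]
      O1D(3)[OF m(2) V_bracket[OF m(4) Z] V_bracket[OF m(7) Z]]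
      O2D(3)[OF F_form m(4,7) Z] O2D(3)[OF HX m(4,7) Z]
    by (simp only: algebra_simps)
  have 2: "on_vfields G (dorfman_form (Y + Y') (\<eta> + \<eta>') (\<mu> + \<mu>') X \<xi> l) =
      on_vfields G (\<lambda>Z. dorfman_form Y \<eta> \<mu> X \<xi> l Z + dorfman_form Y' \<eta>' \<mu>' X \<xi> l Z)"
    by (rule on_vfields_eqI) (rule form)
  have 3: "(Y + Y') l - X (\<mu> + \<mu>') + F (Y + Y') X = (Y l - X \<mu> + F Y X) + (Y' l - X \<mu>' + F Y' X)"
    unfolding deriv_add[OF m(1,6,9)] O2D(3)[OF F_form m(4,7,1)] plus_fun_apply[of Y Y' l] by (simp only: algebra_simps)
  show ?thesis
    unfolding u w w' add_Pair dorfman_eq on_vfields_add lie_bracket_add_left[OF m(1,4,7)] 2 3 ..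
qed

lemma br_scale_right:
  assumes "u \<in> S" "w \<in> S" "f \<in> R" shows "br u (scale f w) = scale f (br u w) + scale (anchor u f) w"
proof -
  obtain X \<xi> l where u: "u = (X, \<xi>, l)" by (cases u)
  obtain Y \<eta> \<mu> where w: "w = (Y, \<eta>, \<mu>)" by (cases w)
  have m: "X \<in> V" "\<xi> \<in> O1" "l \<in> R" "Y \<in> V" "\<eta> \<in> O1" "\<mu> \<in> R"
    using assms by (simp_all add: u w S_iff)
  note f = assms(3)
  note FX = O2D(1)[OF F_form m(1,1)]
  have form: "dorfman_form X \<xi> l (vf_scale f Y) (\<lambda>Z. f * \<eta> Z) (f * \<mu>) Z =
      f * dorfman_form X \<xi> l Y \<eta> \<mu> Z + X f * on_vfields G \<eta> Z" if Z: "Z \<in> V" for Z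
    unfolding dorfman_form_def vf_scale_apply lie_bracket_scale_left[OF Z m(4) f]
      O1D(4)[OF m(2) f m(4)] deriv_mult[OF m(1) f O1D(2)[OF m(5) Z]]
      deriv_mult[OF Z f O1D(2)[OF m(2,4)]]
      O1_diff[OF m(2) V_scale[OF f V_bracket[OF m(4) Z]] V_scale[OF V_R[OF Z] m(4)]]
      O1D(4)[OF m(2) f V_bracket[OF m(4) Z]] O1D(4)[OF m(2) V_R[OF Z] m(4)]
      O2D(4)[OF F_form m(4) Z f] O3D(5)[OF H_form m(4,1) Z f] on_vfields_O1[OF m(5)]
    by (simp add: algebra_simps)
  have 2: "on_vfields G (dorfman_form X \<xi> l (vf_scale f Y) (\<lambda>Z. f * \<eta> Z) (f * \<mu>)) =
      (\<lambda>Z. f * on_vfields G (dorfman_form X \<xi> l Y \<eta> \<mu>) Z) + (\<lambda>Z. X f * on_vfields G \<eta> Z)"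
    unfolding on_vfields_scale on_vfields_add using form by (intro on_vfields_eqI) (simp add: on_vfields_O1[OF m(5)])
  have 1: "lie_bracket X (vf_scale f Y) = vf_scale f (lie_bracket X Y) + vf_scale (X f) Y"
    by (rule lie_bracket_scale_right[OF m(1,4) f])
  have 3: "X (f * \<mu>) - vf_scale f Y l + F X (vf_scale f Y) = f * (X \<mu> - Y l + F X Y) + X f * \<mu>"
    unfolding deriv_mult[OF m(1) f m(6)] O1D(4)[OF FX f m(4)] vf_scale_apply[of f Y l] by (simp add: algebra_simps)
  show ?thesis
    unfolding u w scale_eq prod.case anchor_def fst_conv dorfman_eq add_Pair 1 2 3 on_vfields_O1[OF m(5)] by (intro conjI refl)
qed

text \<open>The last term is absent if \<open>u\<close> and \<open>w\<close> are orthogonal. This is what makes the curvature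
tensorial on \<open>E_+\<close> times \<open>E_-\<close>.\<close>

lemma br_scale_left:
  assumes "u \<in> S" "w \<in> S" "f \<in> R"
  shows "br (scale f u) w = scale f (br u w) - scale (anchor w f) u + scale (2 * pairing u w) (grad f)"
proof -
  obtain X \<xi> l where u: "u = (X, \<xi>, l)" by (cases u)
  obtain Y \<eta> \<mu> where w: "w = (Y, \<eta>, \<mu>)" by (cases w)
  have m: "X \<in> V" "\<xi> \<in> O1" "l \<in> R" "Y \<in> V" "\<eta> \<in> O1" "\<mu> \<in> R"
    using assms by (simp_all add: u w S_iff)
  note f = assms(3)
  note HY = O3D(1)[OF H_form m(4,4,4)]
  let ?p = "\<xi> Y + \<eta> X + 2 * (l * \<mu>)"
  have p: "2 * pairing u w = ?p"
    unfolding u w pairing_def prod.case K_def[symmetric] distrib_left K_half ..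
  have form: "dorfman_form (vf_scale f X) (\<lambda>Z. f * \<xi> Z) (f * l) Y \<eta> \<mu> Z =
      f * dorfman_form X \<xi> l Y \<eta> \<mu> Z - Y f * on_vfields G \<xi> Z + ?p * Z f" if Z: "Z \<in> V" for Z
    unfolding dorfman_form_def vf_scale_apply lie_bracket_scale_left[OF Z m(1) f]
      deriv_mult[OF m(4) f O1D(2)[OF m(2) Z]] deriv_mult[OF Z f O1D(2)[OF m(2,4)]] deriv_mult[OF Z f m(3)]
      O1_diff[OF m(5) V_scale[OF f V_bracket[OF m(1) Z]] V_scale[OF V_R[OF Z] m(1)]]
      O1D(4)[OF m(5) f V_bracket[OF m(1) Z]] O1D(4)[OF m(5) V_R[OF Z] m(1)]
      O2D(4)[OF F_form m(1) Z f] O2D(4)[OF HY m(1) Z f] on_vfields_O1[OF m(2)]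
    by (simp add: algebra_simps)
  have 2: "on_vfields G (dorfman_form (vf_scale f X) (\<lambda>Z. f * \<xi> Z) (f * l) Y \<eta> \<mu>) =
      (\<lambda>Z. f * on_vfields G (dorfman_form X \<xi> l Y \<eta> \<mu>) Z) - (\<lambda>Z. Y f * on_vfields G \<xi> Z)
      + (\<lambda>Z. ?p * on_vfields G (\<lambda>Z. Z f) Z)"
    unfolding on_vfields_scale on_vfields_add on_vfields_diff
    using form by (intro on_vfields_eqI) (simp add: on_vfields_O1[OF m(2)])
  have 1: "lie_bracket (vf_scale f X) Y = vf_scale f (lie_bracket X Y) - vf_scale (Y f) X"
    by (rule lie_bracket_scale_left[OF m(4,1) f])
  have 3: "vf_scale f X \<mu> - Y (f * l) + F (vf_scale f X) Y = f * (X \<mu> - Y l + F X Y) - Y f * l"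
    unfolding deriv_mult[OF m(4) f m(3)] O2D(4)[OF F_form m(1,4) f] vf_scale_apply[of f X \<mu>] by (simp add: algebra_simps)
  have 4: "vf_scale q 0 = 0" for q by (rule ext) (simp add: vf_scale_def zero_fun_apply)
  show ?thesis
    unfolding p
    unfolding u w scale_eq prod.case anchor_def fst_conv dorfman_eq add_Pair diff_Pair grad_def d0_def 1 2 3 4 on_vfields_O1[OF m(2)] mult_zero_right add_0_right by (intro conjI refl)
qed

end

section \<open>The orthonormal frame of the Courant algebroid\<close>

context lie_group_frame
begin

text \<open>Left translations act transitively.\<close>

lemma invariant_fn_const:
  assumes "\<And>x. lt_fn G x f = f" shows "f = K (f \<one>\<^bsub>G\<^esub>)"
proof
  fix x
  interpret group G using lie by (simp add: is_lie_group_def)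
  have "x \<otimes>\<^bsub>G\<^esub> \<one>\<^bsub>G\<^esub> = x" using lie by (simp add: is_lie_group_def)
  then have "f x = lt_fn G x f \<one>\<^bsub>G\<^esub>" by (simp add: lt_fn_def)
  then show "f x = K (f \<one>\<^bsub>G\<^esub>) x" unfolding assms K_def .
qed

lemma left_inv_lt: "X \<in> left_inv_vfields G \<Longrightarrow> lt_vf G x X = X"
  by (simp add: left_inv_vfields_def)

lemma left_inv2_constant:
  assumes "left_inv2 G \<omega>" "X \<in> left_inv_vfields G" "Y \<in> left_inv_vfields G"
  shows "\<omega> X Y = K (\<omega> X Y \<one>\<^bsub>G\<^esub>)"
proof (rule invariant_fn_const)
  fix x
  have "\<omega> (lt_vf G x X) (lt_vf G x Y) = lt_fn G x (\<omega> X Y)"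
    using assms left_inv_V unfolding left_inv2_def by blast
  then show "lt_fn G x (\<omega> X Y) = \<omega> X Y" unfolding left_inv_lt[OF assms(2)] left_inv_lt[OF assms(3)] ..
qed

lemma left_inv3_constant:
  assumes "left_inv3 G \<omega>" "X \<in> left_inv_vfields G" "Y \<in> left_inv_vfields G" "Z \<in> left_inv_vfields G"
  shows "\<omega> X Y Z = K (\<omega> X Y Z \<one>\<^bsub>G\<^esub>)"
proof (rule invariant_fn_const)
  fix x
  have "\<omega> (lt_vf G x X) (lt_vf G x Y) (lt_vf G x Z) = lt_fn G x (\<omega> X Y Z)"
    using assms left_inv_V unfolding left_inv3_def by blast
  then show "lt_fn G x (\<omega> X Y Z) = \<omega> X Y Z"
    unfolding left_inv_lt[OF assms(2)] left_inv_lt[OF assms(3)] left_inv_lt[OF assms(4)] ..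
qed

lemma O1_eq_0I:
  assumes "\<xi> \<in> O1" "\<And>a. a \<in> {1..n} \<Longrightarrow> \<xi> (v a) = 0" shows "\<xi> = 0"
proof
  fix X
  show "\<xi> X = 0 X"
  proof (cases "X \<in> V")
    case True
    obtain h where h: "\<forall>a\<in>{1..n}. h a \<in> R" "X = (\<Sum>a=1..n. vf_scale (h a) (v a))"
      by (rule V_expansion[OF True])
    have "\<xi> X = (\<Sum>a=1..n. \<xi> (vf_scale (h a) (v a)))"
      unfolding h(2) by (intro O1_sum assms(1) V_scale bspec[OF h(1)] v_V)
    also have "\<dots> = 0"
      using O1D(4)[OF assms(1) bspec[OF h(1)] v_V] assms(2) by (intro sum.neutral) simp
    finally show ?thesis by (simp add: zero_fun_apply)
  qed (simp add: O1D(1)[OF assms(1)] zero_fun_apply)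
qed

end

locale invariant_frame = lie_group_frame G n v + twisted_dorfman G H F
  for G :: "('a::{t2_space, second_countable_topology}, 'e::euclidean_space) lie_group"
    and n v H F +
  fixes g :: "'a form2"
  assumes H_inv: "left_inv3 G H" and F_inv: "left_inv2 G F"
    and metric: "pseudo_riemannian G g" and g_inv: "left_inv2 G g" and orth: "orthonormal g n v"
begin

abbreviation e where "e \<equiv> induced_basis g n v"
abbreviation \<epsilon> where "\<epsilon> \<equiv> basis_sign G g n v"
abbreviation B where "B \<equiv> dorfman_coeff G H F e"

lemma g_O1: "X \<in> V \<Longrightarrow> g X \<in> O1"
  using metric by (simp add: pseudo_riemannian_def)

lemma g_commute: "X \<in> V \<Longrightarrow> Y \<in> V \<Longrightarrow> g X Y = g Y X"
  using metric unfolding pseudo_riemannian_def by blast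

lemma g_v: "a \<in> {1..n} \<Longrightarrow> b \<in> {1..n} \<Longrightarrow> g (v a) (v b) = K (if a = b then \<epsilon> a else 0)"
proof -
  assume a: "a \<in> {1..n}" "b \<in> {1..n}"
  show ?thesis
  proof (cases "a = b")
    case True
    have "\<epsilon> a = g (v a) (v a) \<one>\<^bsub>G\<^esub>" using a by (simp add: basis_sign_def)
    then show ?thesis using left_inv2_constant[OF g_inv v_left_inv v_left_inv, of a a] a True by simp
  next
    case False
    then show ?thesis using orth a unfolding orthonormal_def by (simp add: K_arith)
  qed
qed

lemma \<epsilon>_cases:
  assumes "A \<in> {0..2*n}" shows "\<epsilon> A = 1 \<or> \<epsilon> A = - 1"
proof -
  have 1: "g (v a) (v a) \<one>\<^bsub>G\<^esub> = 1 \<or> g (v a) (v a) \<one>\<^bsub>G\<^esub> = - 1" if "a \<in> {1..n}" for a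
  proof -
    have "g (v a) (v a) = 1 \<or> g (v a) (v a) = -1" using orth that unfolding orthonormal_def by blast
    then show ?thesis by (elim disjE) (simp_all add: one_fun_apply uminus_apply)
  qed
  consider "A = 0" | "A \<in> {1..n}" | "A \<in> {n+1..2*n}" using assms by fastforce
  then show ?thesis
  proof cases
    case 1 then show ?thesis by (simp add: basis_sign_def)
  next
    case 2 then show ?thesis using 1[of A] by (simp add: basis_sign_def)
  next
    case 3
    then have "A - n \<in> {1..n}" by auto
    from 1[OF this] 3 show ?thesis by (auto simp: basis_sign_def)
  qed
qed

lemma \<epsilon>_square: "A \<in> {0..2*n} \<Longrightarrow> \<epsilon> A * \<epsilon> A = 1"
  using \<epsilon>_cases[of A] by auto

lemma e_simps:
  "e 0 = (0, 0, 1)" "a \<in> {1..n} \<Longrightarrow> e a = (v a, g (v a), 0)"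
  "a \<in> {1..n} \<Longrightarrow> e (n + a) = (v a, - g (v a), 0)"
  by (auto simp: induced_basis_def)

lemma \<epsilon>_simps: "\<epsilon> 0 = 1" "a \<in> {1..n} \<Longrightarrow> \<epsilon> (n + a) = - \<epsilon> a"
  by (auto simp: basis_sign_def)

lemma index_cases:
  assumes "A \<in> {0..2*n}"
  obtains "A = 0" | a where "a \<in> {1..n}" "A = a" | a where "a \<in> {1..n}" "A = n + a"
proof (cases "A \<le> n")
  case True
  then show ?thesis using that(1) that(2)[of A] by (cases "A = 0") auto
next
  case False
  then show ?thesis using that(3)[of "A - n"] assms by auto
qed

lemma e_S [simp, intro]: assumes "A \<in> {0..2*n}" shows "e A \<in> S"
  using assms
proof (cases rule: index_cases)
  case 1 then show ?thesis by (simp add: e_simps S_iff O1_zero)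
next
  case (2 a) then show ?thesis by (simp only: e_simps S_iff) (simp add: g_O1 v_V)
next
  case (3 a) then show ?thesis by (simp only: e_simps S_iff) (simp add: g_O1 v_V O1_neg)
qed

lemma pairing_e:
  assumes "A \<in> {0..2*n}" "C \<in> {0..2*n}"
  shows "pairing (e A) (e C) = K (if A = C then \<epsilon> A else 0)"
proof -
  have z: "(0 :: 'a form1) X = 0" "(- \<xi>) X = - \<xi> X" for X and \<xi> :: "'a form1"
    by (simp_all add: zero_fun_apply uminus_apply)
  have gz: "g (v a) 0 = 0" if "a \<in> {1..n}" for a using that by (intro O1_0 g_O1 v_V)
  show ?thesis
    using assms(1)
  proof (cases rule: index_cases)
    case A: 1
    from assms(2) show ?thesis
      by (cases rule: index_cases) (simp_all add: A pairing_def e_simps z gz K_arith \<epsilon>_simps)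
  next
    case A: (2 a)
    from assms(2) show ?thesis
    proof (cases rule: index_cases)
      case 1 then show ?thesis using A by (simp add: pairing_def e_simps z gz K_arith)
    next
      case (2 c)
      then show ?thesis using A
        by (simp add: pairing_def e_simps z g_v K_def[symmetric] K_arith K_half)
    next
      case (3 c)
      then show ?thesis using A
        by (simp add: pairing_def e_simps z g_v K_def[symmetric] K_arith K_half)
    qed
  next
    case A: (3 a)
    from assms(2) show ?thesis
    proof (cases rule: index_cases)
      case 1 then show ?thesis using A by (simp add: pairing_def e_simps z gz K_arith)
    next
      case (2 c)
      then show ?thesis using A
        by (simp add: pairing_def e_simps z g_v K_def[symmetric] K_arith K_half)
    next
      case (3 c)
      then show ?thesis using A
        by (simp add: pairing_def e_simps z g_v K_def[symmetric] \<epsilon>_simps K_arith K_half)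
    qed
  qed
qed

text \<open>Nondegeneracy of the scalar product: \<open>e a\<close> and \<open>e (n + a)\<close> together test the one-form on \<open>v a\<close> and
the vector field against \<open>v a\<close>.\<close>

lemma sections_eq_0I:
  assumes "u \<in> S" "\<And>A. A \<in> {0..2*n} \<Longrightarrow> pairing u (e A) = 0" shows "u = 0"
proof -
  obtain X \<xi> l where u: "u = (X, \<xi>, l)" by (cases u)
  have m: "X \<in> V" "\<xi> \<in> O1" "l \<in> R" using assms(1) by (simp_all add: u S_iff)
  have "pairing u (e 0) = l"
    unfolding u e_simps pairing_def prod.case O1_0[OF m(2)] by (simp add: zero_fun_apply)
  then have l: "l = 0" using assms(2)[of 0] by simp
  have a: "\<xi> (v a) = 0 \<and> g (v a) X = 0" if a: "a \<in> {1..n}" for a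
  proof -
    have "K (1/2) * (\<xi> (v a) + g (v a) X) = 0"
      using assms(2)[of a] a unfolding u e_simps(2)[OF a] pairing_def prod.case K_def by simp
    moreover have "K (1/2) * (\<xi> (v a) + (- g (v a)) X) = 0"
      using assms(2)[of "n + a"] a unfolding u e_simps(3)[OF a] pairing_def prod.case K_def by simp
    ultimately show ?thesis
      by (auto simp: fun_eq_iff K_def uminus_apply minus_apply plus_fun_apply times_fun_apply zero_fun_apply)
  qed
  have \<xi>: "\<xi> = 0" using a by (intro O1_eq_0I m) blast
  obtain h where h: "\<forall>a\<in>{1..n}. h a \<in> R" "X = (\<Sum>a=1..n. vf_scale (h a) (v a))"
    by (rule V_expansion[OF m(1)])
  have "h b = 0" if b: "b \<in> {1..n}" for b
  proof -
    have "g (v b) X = (\<Sum>a=1..n. g (v b) (vf_scale (h a) (v a)))"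
      unfolding h(2) by (intro O1_sum g_O1 V_scale bspec[OF h(1)] v_V b)
    also have "\<dots> = (\<Sum>a=1..n. if a = b then h b * K (\<epsilon> b) else 0)"
      using b h(1) O1D(4)[OF g_O1[OF v_V[OF b]] bspec[OF h(1)] v_V]
      by (intro sum.cong refl) (simp add: g_v K_arith)
    also have "\<dots> = h b * K (\<epsilon> b)" using b by simp
    finally have "h b * K (\<epsilon> b) = 0" using a[OF b] by simp
    then have "(h b * K (\<epsilon> b)) * K (\<epsilon> b) = 0" by simp
    then show ?thesis using \<epsilon>_square[of b] b by (simp add: mult.assoc K_arith)
  qed
  then have "X = (\<Sum>a=1..n. 0)"
    unfolding h(2) by (intro sum.cong refl ext) (simp add: vf_scale_def zero_fun_apply)
  then show ?thesis by (simp add: u l \<xi> zero_prod_def)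
qed

text \<open>The sections of the subbundle spanned by the \<open>e A\<close> with \<open>A \<in> P\<close>, described by orthogonality to the
other frame elements. It is all of \<open>E\<close> for \<open>P = {0..2*n}\<close>, and \<open>E_+\<close> and \<open>E_-\<close> for the two halves.\<close>

definition Sub :: "nat set \<Rightarrow> 'a sec set" where
  "Sub P = {u \<in> S. \<forall>A\<in>{0..2*n} - P. pairing u (e A) = 0}"

lemma Sub_S: "u \<in> Sub P \<Longrightarrow> u \<in> S"
  by (simp add: Sub_def)

lemma e_Sub: "A \<in> P \<Longrightarrow> P \<subseteq> {0..2*n} \<Longrightarrow> e A \<in> Sub P"
  by (auto simp: Sub_def pairing_e subset_iff K_arith)

text \<open>Since the frame is orthonormal up to signs, the scalar product recovers the coefficients.\<close>

definition coeff :: "'a sec \<Rightarrow> nat \<Rightarrow> 'a fn" where "coeff u A = K (\<epsilon> A) * pairing u (e A)"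

lemma coeff_R: "u \<in> S \<Longrightarrow> A \<in> {0..2*n} \<Longrightarrow> coeff u A \<in> R"
  unfolding coeff_def by (intro R_mult pairing_R e_S) (simp_all add: K_def)

lemma pairing_frame_sum:
  assumes "P \<subseteq> {0..2*n}" "\<And>A. A \<in> P \<Longrightarrow> f A \<in> R" "C \<in> {0..2*n}"
  shows "pairing (\<Sum>A\<in>P. scale (f A) (e A)) (e C) = (if C \<in> P then K (\<epsilon> C) * f C else 0)"
proof -
  have P: "A \<in> {0..2*n}" if "A \<in> P" for A using assms(1) that by blast
  have "pairing (\<Sum>A\<in>P. scale (f A) (e A)) (e C) = (\<Sum>A\<in>P. pairing (scale (f A) (e A)) (e C))"
    using P assms(2,3) by (intro pairing_sum_left) auto
  also have "\<dots> = (\<Sum>A\<in>P. if A = C then K (\<epsilon> C) * f C else 0)"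
  proof (rule sum.cong[OF refl])
    fix A assume A: "A \<in> P"
    show "pairing (scale (f A) (e A)) (e C) = (if A = C then K (\<epsilon> C) * f C else 0)"
      unfolding pairing_scale_left[OF assms(2)[OF A] e_S[OF P[OF A]] e_S[OF assms(3)]]
        pairing_e[OF P[OF A] assms(3)] by (simp add: K_arith mult.commute)
  qed
  also have "\<dots> = (if C \<in> P then K (\<epsilon> C) * f C else 0)"
    using finite_subset[OF assms(1)] by simp
  finally show ?thesis .
qed

lemma Sub_expansion:
  assumes "P \<subseteq> {0..2*n}" "u \<in> Sub P" shows "u = (\<Sum>A\<in>P. scale (coeff u A) (e A))"
proof -
  have P: "A \<in> {0..2*n}" if "A \<in> P" for A using assms(1) that by blast
  have u: "u \<in> S" by (rule Sub_S[OF assms(2)])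
  have c: "coeff u A \<in> R" if "A \<in> P" for A by (rule coeff_R[OF u P[OF that]])
  have s: "(\<Sum>A\<in>P. scale (coeff u A) (e A)) \<in> S" using P c by (intro S_sum) auto
  have "u - (\<Sum>A\<in>P. scale (coeff u A) (e A)) = 0"
  proof (rule sections_eq_0I)
    show "u - (\<Sum>A\<in>P. scale (coeff u A) (e A)) \<in> S" using u s by blast
    fix C assume C: "C \<in> {0..2*n}"
    have 1: "pairing (\<Sum>A\<in>P. scale (coeff u A) (e A)) (e C) = (if C \<in> P then K (\<epsilon> C) * coeff u C else 0)"
      by (rule pairing_frame_sum[OF assms(1) c C])
    have 2: "pairing u (e C) = (if C \<in> P then K (\<epsilon> C) * coeff u C else 0)"
    proof (cases "C \<in> P")
      case True
      have "K (\<epsilon> C) * coeff u C = (K (\<epsilon> C) * K (\<epsilon> C)) * pairing u (e C)"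
        unfolding coeff_def by (simp only: mult.assoc)
      then show ?thesis using True \<epsilon>_square[OF C] by (simp add: K_arith)
    next
      case False
      then show ?thesis using assms(2) C by (simp add: Sub_def)
    qed
    show "pairing (u - (\<Sum>A\<in>P. scale (coeff u A) (e A))) (e C) = 0"
      unfolding pairing_diff_left[OF u s e_S[OF C]] 1 2 by simp
  qed
  then show ?thesis by simp
qed

lemma Sub_UNIV: "Sub {0..2*n} = S" by (auto simp: Sub_def)

lemma E_minus_eq: "E_minus G g = Sub {n+1..2*n}"
proof (intro Set.set_eqI iffI)
  fix u assume "u \<in> E_minus G g"
  then obtain X where X: "X \<in> V" "u = (X, - g X, 0)" by (auto simp: E_minus_def)
  have "pairing u (e A) = 0" if "A \<in> {0..2*n} - {n+1..2*n}" for A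
  proof -
    from that have "A = 0 \<or> A \<in> {1..n}" by auto
    then show ?thesis
    proof
      assume "A = 0"
      then show ?thesis
        using O1_0[OF O1_neg[OF g_O1[OF X(1)]]] by (simp add: X pairing_def e_simps zero_fun_apply)
    next
      assume A: "A \<in> {1..n}"
      show ?thesis using g_commute[OF X(1) v_V[OF A]]
        unfolding X pairing_def e_simps(2)[OF A] prod.case by (simp add: uminus_apply)
    qed
  qed
  moreover have "u \<in> S" using X by (simp add: S_iff O1_neg g_O1)
  ultimately show "u \<in> Sub {n+1..2*n}" unfolding Sub_def by blast
next
  fix u assume u': "u \<in> Sub {n+1..2*n}"
  obtain X \<xi> l where u: "u = (X, \<xi>, l)" by (cases u)
  have m: "X \<in> V" "\<xi> \<in> O1" "l \<in> R" using Sub_S[OF u'] by (simp_all add: u S_iff)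
  have p: "pairing u (e A) = 0" if "A \<in> {0..n}" for A using u' that by (auto simp: Sub_def)
  have "pairing u (e 0) = l"
    unfolding u e_simps pairing_def prod.case O1_0[OF m(2)] by (simp add: zero_fun_apply)
  then have l: "l = 0" using p[of 0] by simp
  have "\<xi> + g X = 0"
  proof (rule O1_eq_0I)
    show "\<xi> + g X \<in> O1" by (intro O1_add m g_O1)
    fix a assume a: "a \<in> {1..n}"
    have "K (1/2) * (\<xi> (v a) + g (v a) X) = 0"
      using p[of a] a unfolding u e_simps(2)[OF a] pairing_def prod.case K_def by simp
    then have "2 * (K (1/2) * (\<xi> (v a) + g X (v a))) = 0" using g_commute[OF m(1) v_V[OF a]] by simp
    then show "(\<xi> + g X) (v a) = 0" unfolding K_half by (simp add: plus_fun_apply)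
  qed
  then have "\<xi> = - g X" by (simp add: eq_neg_iff_add_eq_0)
  then show "u \<in> E_minus G g" using m(1) l u by (auto simp: E_minus_def)
qed

lemma E_plus_eq: "E_plus G g = Sub {0..n}"
proof (intro Set.set_eqI iffI)
  fix u assume "u \<in> E_plus G g"
  then have u: "u \<in> S" "\<And>w. w \<in> Sub {n+1..2*n} \<Longrightarrow> pairing u w = 0"
    by (auto simp: E_plus_def E_minus_eq)
  have "pairing u (e A) = 0" if "A \<in> {0..2*n} - {0..n}" for A
    using that by (intro u(2) e_Sub) auto
  then show "u \<in> Sub {0..n}" using u(1) by (simp add: Sub_def)
next
  fix u assume u: "u \<in> Sub {0..n}"
  have uS: "u \<in> S" by (rule Sub_S[OF u])
  have "pairing u w = 0" if w: "w \<in> Sub {n+1..2*n}" for w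
  proof -
    have wS: "w \<in> S" by (rule Sub_S[OF w])
    have "w = (\<Sum>A\<in>{n+1..2*n}. scale (coeff w A) (e A))" by (rule Sub_expansion[OF _ w]) auto
    then have "pairing u w = pairing (\<Sum>A\<in>{n+1..2*n}. scale (coeff w A) (e A)) u"
      using pairing_commute by metis
    also have "\<dots> = (\<Sum>A\<in>{n+1..2*n}. pairing (scale (coeff w A) (e A)) u)"
      using uS coeff_R[OF wS] by (intro pairing_sum_left S_scale e_S) auto
    also have "\<dots> = 0"
    proof (rule sum.neutral, rule ballI)
      fix A assume A: "A \<in> {n+1..2*n}"
      then have A': "A \<in> {0..2*n}" by auto
      have "pairing (e A) u = 0" unfolding pairing_commute[of "e A"] using u A by (auto simp: Sub_def)
      then show "pairing (scale (coeff w A) (e A)) u = 0"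
        unfolding pairing_scale_left[OF coeff_R[OF wS A'] e_S[OF A'] uS] by simp
    qed
    finally show ?thesis .
  qed
  then show "u \<in> E_plus G g" using uS by (simp add: E_plus_def E_minus_eq)
qed

end

section \<open>Structure constants\<close>

context invariant_frame
begin

text \<open>All that matters about the frame in the computation of brackets: the vector field is
left-invariant, the one-form is constant on left-invariant fields, and the function is constant.\<close>

lemma frame_components:
  assumes "A \<in> {0..2*n}"
  obtains X \<xi> l where "e A = (X, \<xi>, K l)" "X \<in> left_inv_vfields G" "\<xi> \<in> O1"
    "\<forall>Y\<in>left_inv_vfields G. \<exists>c. \<xi> Y = K c"
  using assms
proof (cases rule: index_cases)
  case 1
  have "\<forall>Y\<in>left_inv_vfields G. \<exists>c. (0 :: 'a form1) Y = K c"
    by (auto simp: zero_fun_apply K_arith(5)[symmetric] intro!: exI[of _ 0])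
  then show ?thesis using that[of 0 0 1] 1 left_inv_0 O1_zero by (simp add: e_simps K_arith)
next
  case (2 a)
  have "\<forall>Y\<in>left_inv_vfields G. \<exists>c. g (v a) Y = K c"
    using left_inv2_constant[OF g_inv v_left_inv[OF 2(1)]] by blast
  then show ?thesis using that[of "v a" "g (v a)" 0] v_left_inv[OF 2(1)] g_O1[OF v_V[OF 2(1)]]
    unfolding 2(2) e_simps(2)[OF 2(1)] by (simp add: K_arith)
next
  case (3 a)
  have "\<exists>c. (- g (v a)) Y = K c" if Y: "Y \<in> left_inv_vfields G" for Y
  proof -
    have "g (v a) Y = K (g (v a) Y \<one>\<^bsub>G\<^esub>)" by (rule left_inv2_constant[OF g_inv v_left_inv[OF 3(1)] Y])
    then have "(- g (v a)) Y = K (- g (v a) Y \<one>\<^bsub>G\<^esub>)" unfolding uminus_apply[of "g (v a)"]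
      by (metis K_arith(4))
    then show ?thesis by blast
  qed
  then show ?thesis using that[of "v a" "- g (v a)" 0] v_left_inv[OF 3(1)] O1_neg[OF g_O1[OF v_V[OF 3(1)]]]
    unfolding 3(2) e_simps(3)[OF 3(1)] by (simp add: K_arith)
qed

text \<open>The value of \<open>\<langle>[u, w], x\<rangle>\<close> on left-invariant sections, in a form that exhibits its total
antisymmetry: each group of terms is a cyclic sum.\<close>

definition structure_fn :: "'a sec \<Rightarrow> 'a sec \<Rightarrow> 'a sec \<Rightarrow> 'a fn" where
  "structure_fn = (\<lambda>(X, \<xi>, l) (Y, \<eta>, \<mu>) (Z, \<zeta>, \<nu>).
     K (1/2) * (\<zeta> (lie_bracket X Y) + \<xi> (lie_bracket Y Z) + \<eta> (lie_bracket Z X) - H X Y Z)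
       + (\<nu> * F X Y + l * F Y Z + \<mu> * F Z X))"

lemma pairing_br_e:
  assumes "A \<in> {0..2*n}" "C \<in> {0..2*n}" "D \<in> {0..2*n}"
  shows "pairing (br (e A) (e C)) (e D) = structure_fn (e A) (e C) (e D)"
    and "structure_fn (e C) (e A) (e D) = - structure_fn (e A) (e C) (e D)"
    and "structure_fn (e A) (e D) (e C) = - structure_fn (e A) (e C) (e D)"
    and "\<exists>c. structure_fn (e A) (e C) (e D) = K c"
proof -
  obtain X \<xi> l where A: "e A = (X, \<xi>, K l)" "X \<in> left_inv_vfields G" "\<xi> \<in> O1"
    "\<forall>Y\<in>left_inv_vfields G. \<exists>c. \<xi> Y = K c" by (rule frame_components[OF assms(1)])
  obtain Y \<eta> \<mu> where C: "e C = (Y, \<eta>, K \<mu>)" "Y \<in> left_inv_vfields G" "\<eta> \<in> O1"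
    "\<forall>Y\<in>left_inv_vfields G. \<exists>c. \<eta> Y = K c" by (rule frame_components[OF assms(2)])
  obtain Z \<zeta> \<nu> where D: "e D = (Z, \<zeta>, K \<nu>)" "Z \<in> left_inv_vfields G" "\<zeta> \<in> O1"
    "\<forall>Y\<in>left_inv_vfields G. \<exists>c. \<zeta> Y = K c" by (rule frame_components[OF assms(3)])
  note X = left_inv_V[OF A(2)] and Y = left_inv_V[OF C(2)] and Z = left_inv_V[OF D(2)]
  have k: "W (K c) = 0" if "W \<in> V" for W c unfolding K_def by (rule deriv_const[OF that])
  obtain c1 where c1: "\<eta> Z = K c1" using C(4) D(2) by blast
  obtain c2 where c2: "\<xi> Z = K c2" using A(4) D(2) by blast
  obtain c3 where c3: "\<xi> Y = K c3" using A(4) C(2) by blast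
  have br: "br (e A) (e C) = (lie_bracket X Y, on_vfields G (dorfman_form X \<xi> (K l) Y \<eta> (K \<mu>)), F X Y)"
    unfolding A(1) C(1) dorfman_eq k[OF X] k[OF Y] by simp
  have swap: "\<theta> (lie_bracket W W') = - \<theta> (lie_bracket W' W)" if "W \<in> V" "W' \<in> V" "\<theta> \<in> O1" for W W' \<theta>
    unfolding lie_bracket_swap[of W] by (rule O1_uminus[OF that(3) V_bracket[OF that(2,1)]])
  note F2 = O2D(2)[OF F_form] and H2 = O3D(2,3)[OF H_form]
  have "on_vfields G (dorfman_form X \<xi> (K l) Y \<eta> (K \<mu>)) Z =
      - \<eta> (lie_bracket X Z) + \<xi> (lie_bracket Y Z) + H Y X Z - 2 * (K \<mu> * F X Z - K l * F Y Z)"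
    unfolding on_vfields_def dorfman_form_def c1 c2 c3 k[OF X] k[OF Y] k[OF Z]
    using Z by simp
  also have "\<dots> = \<eta> (lie_bracket Z X) + \<xi> (lie_bracket Y Z) - H X Y Z + 2 * (K \<mu> * F Z X + K l * F Y Z)"
    unfolding swap[OF X Z C(3)] F2[OF X Z] H2(1)[OF Y X Z] by (simp add: algebra_simps)
  finally have form: "on_vfields G (dorfman_form X \<xi> (K l) Y \<eta> (K \<mu>)) Z = \<dots>" .
  have "pairing (br (e A) (e C)) (e D) = K (1/2) * (\<eta> (lie_bracket Z X) + \<xi> (lie_bracket Y Z) - H X Y Z
      + 2 * (K \<mu> * F Z X + K l * F Y Z) + \<zeta> (lie_bracket X Y)) + F X Y * K \<nu>"
    unfolding br D(1) pairing_def prod.case form K_def[symmetric] ..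
  also have "\<dots> = structure_fn (e A) (e C) (e D)"
    unfolding A(1) C(1) D(1) structure_fn_def prod.case
    by (simp only: distrib_left K_half right_diff_distrib) (simp add: algebra_simps)
  finally show "pairing (br (e A) (e C)) (e D) = structure_fn (e A) (e C) (e D)" .
  show "structure_fn (e C) (e A) (e D) = - structure_fn (e A) (e C) (e D)"
    unfolding A(1) C(1) D(1) structure_fn_def prod.case
      swap[OF Y X D(3)] swap[OF Z Y A(3)] swap[OF X Z C(3)] F2[OF Y X] F2[OF X Z] F2[OF Z Y]
      H2(1)[OF Y X Z]
    by (simp add: algebra_simps)
  show "structure_fn (e A) (e D) (e C) = - structure_fn (e A) (e C) (e D)"
    unfolding A(1) C(1) D(1) structure_fn_def prod.case
      swap[OF Y X D(3)] swap[OF Z Y A(3)] swap[OF X Z C(3)] F2[OF Y X] F2[OF X Z] F2[OF Z Y]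
      H2(2)[OF X Z Y]
    by (simp add: algebra_simps)
  obtain d1 where d1: "\<zeta> (lie_bracket X Y) = K d1" using D(4) left_inv_bracket[OF A(2) C(2)] by blast
  obtain d2 where d2: "\<xi> (lie_bracket Y Z) = K d2" using A(4) left_inv_bracket[OF C(2) D(2)] by blast
  obtain d3 where d3: "\<eta> (lie_bracket Z X) = K d3" using C(4) left_inv_bracket[OF D(2) A(2)] by blast
  obtain d4 where d4: "H X Y Z = K d4" using left_inv3_constant[OF H_inv A(2) C(2) D(2)] by blast
  obtain d5 where d5: "F X Y = K d5" using left_inv2_constant[OF F_inv A(2) C(2)] by blast
  obtain d6 where d6: "F Y Z = K d6" using left_inv2_constant[OF F_inv C(2) D(2)] by blast
  obtain d7 where d7: "F Z X = K d7" using left_inv2_constant[OF F_inv D(2) A(2)] by blast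
  show "\<exists>c. structure_fn (e A) (e C) (e D) = K c"
    unfolding A(1) C(1) D(1) structure_fn_def prod.case d1 d2 d3 d4 d5 d6 d7 K_arith by blast
qed

lemma pairing_br_e_const:
  assumes "A \<in> {0..2*n}" "C \<in> {0..2*n}" "D \<in> {0..2*n}"
  shows "pairing (br (e A) (e C)) (e D) = K (B A C D)"
proof -
  obtain c where "pairing (br (e A) (e C)) (e D) = K c"
    using pairing_br_e(1,4)[OF assms] by metis
  then show ?thesis by (simp add: dorfman_coeff_def K_def)
qed

lemma B_antisym:
  assumes "A \<in> {0..2*n}" "C \<in> {0..2*n}" "D \<in> {0..2*n}"
  shows "B C A D = - B A C D" "B A D C = - B A C D"
proof -
  note c = pairing_br_e_const[OF assms] pairing_br_e_const[OF assms(2,1,3)] pairing_br_e_const[OF assms(1,3,2)]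
  have "(K (B C A D) :: 'a fn) = - K (B A C D)"
    unfolding c[symmetric] pairing_br_e(1)[OF assms] pairing_br_e(1)[OF assms(2,1,3)]
    by (rule pairing_br_e(2)[OF assms])
  moreover have "(K (B A D C) :: 'a fn) = - K (B A C D)"
    unfolding c[symmetric] pairing_br_e(1)[OF assms] pairing_br_e(1)[OF assms(1,3,2)]
    by (rule pairing_br_e(3)[OF assms])
  ultimately show "B C A D = - B A C D" "B A D C = - B A C D" by (simp_all add: K_arith)
qed

lemma B_cyclic:
  assumes "A \<in> {0..2*n}" "C \<in> {0..2*n}" "D \<in> {0..2*n}"
  shows "B C D A = B A C D"
  using B_antisym(1)[OF assms] B_antisym(2)[OF assms(2,1,3)] by simp

text \<open>Pairing with \<open>e 0\<close> extracts the function part of the bracket, which on the other frame elements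
is given by \<open>F\<close>.\<close>

lemma B_0:
  assumes "a \<in> {1..n}" "c \<in> {1..n}"
  shows "B a c 0 = F (v a) (v c) \<one>\<^bsub>G\<^esub>" "B (n + a) c 0 = F (v a) (v c) \<one>\<^bsub>G\<^esub>"
    "B (n + a) (n + c) 0 = F (v a) (v c) \<one>\<^bsub>G\<^esub>"
proof -
  have k: "W 0 = 0" if "W \<in> V" for W by (rule deriv_0[OF that])
  have p: "pairing w (e 0) = snd (snd w)" if "w \<in> S" for w
  proof -
    obtain X \<xi> l where w: "w = (X, \<xi>, l)" by (cases w)
    have "\<xi> \<in> O1" using that by (simp add: w S_iff)
    then show ?thesis unfolding w e_simps pairing_def prod.case O1_0[OF \<open>\<xi> \<in> O1\<close>]
      by (simp add: zero_fun_apply)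
  qed
  have m: "a \<in> {0..2*n}" "c \<in> {0..2*n}" "n + a \<in> {0..2*n}" "n + c \<in> {0..2*n}" using assms by auto
  have s: "snd (snd (br (v a, \<xi>, 0) (v c, \<eta>, 0))) = F (v a) (v c)" for \<xi> \<eta>
    unfolding dorfman_eq k[OF v_V[OF assms(1)]] k[OF v_V[OF assms(2)]] by simp
  show "B a c 0 = F (v a) (v c) \<one>\<^bsub>G\<^esub>" "B (n + a) c 0 = F (v a) (v c) \<one>\<^bsub>G\<^esub>"
    "B (n + a) (n + c) 0 = F (v a) (v c) \<one>\<^bsub>G\<^esub>"
    unfolding dorfman_coeff_def p[OF br_S[OF e_S[OF m(1)] e_S[OF m(2)]]]
      p[OF br_S[OF e_S[OF m(3)] e_S[OF m(2)]]] p[OF br_S[OF e_S[OF m(3)] e_S[OF m(4)]]]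
    unfolding e_simps(2)[OF assms(1)] e_simps(2)[OF assms(2)] e_simps(3)[OF assms(1)] e_simps(3)[OF assms(2)] s
    by (rule refl)+
qed

end

section \<open>Subbundles spanned by frame elements and traces\<close>

context invariant_frame
begin

lemma Sub_add: "u \<in> Sub P \<Longrightarrow> w \<in> Sub P \<Longrightarrow> u + w \<in> Sub P"
  by (simp add: Sub_def pairing_add_left)

lemma Sub_scale: "f \<in> R \<Longrightarrow> u \<in> Sub P \<Longrightarrow> scale f u \<in> Sub P"
  by (simp add: Sub_def pairing_scale_left)

lemma Sub_0: "0 \<in> Sub P"
  by (simp add: Sub_def)

lemma Sub_diff: "u \<in> Sub P \<Longrightarrow> w \<in> Sub P \<Longrightarrow> u - w \<in> Sub P"
  by (simp add: Sub_def pairing_diff_left)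

lemma Sub_sum: "(\<And>i. i \<in> I \<Longrightarrow> u i \<in> Sub P) \<Longrightarrow> (\<Sum>i\<in>I. u i) \<in> Sub P"
  by (induction I rule: infinite_finite_induct) (simp_all add: Sub_0 Sub_add)

lemma Sub_induct:
  assumes "P \<subseteq> {0..2*n}" "u \<in> Sub P" "Q 0" "\<And>A. A \<in> P \<Longrightarrow> Q (e A)"
    "\<And>u w. u \<in> Sub P \<Longrightarrow> w \<in> Sub P \<Longrightarrow> Q u \<Longrightarrow> Q w \<Longrightarrow> Q (u + w)"
    "\<And>f u. f \<in> R \<Longrightarrow> u \<in> Sub P \<Longrightarrow> Q u \<Longrightarrow> Q (scale f u)"
  shows "Q u"
proof -
  have P: "A \<in> {0..2*n}" if "A \<in> P" for A using assms(1) that by blast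
  have "Q (\<Sum>A\<in>T. scale (coeff u A) (e A)) \<and> (\<Sum>A\<in>T. scale (coeff u A) (e A)) \<in> Sub P"
    if "finite T" "T \<subseteq> P" for T
    using that
  proof (induction T rule: finite_induct)
    case empty
    show ?case using assms(3) Sub_0 by simp
  next
    case (insert A T)
    have A: "A \<in> P" using insert.prems by simp
    have c: "coeff u A \<in> R" by (rule coeff_R[OF Sub_S[OF assms(2)] P[OF A]])
    have "Q (scale (coeff u A) (e A))" by (rule assms(6)[OF c e_Sub[OF A assms(1)] assms(4)[OF A]])
    moreover have "scale (coeff u A) (e A) \<in> Sub P" by (rule Sub_scale[OF c e_Sub[OF A assms(1)]])
    ultimately show ?case
      unfolding sum.insert[OF insert.hyps] using insert.IH insert.prems assms(5) Sub_add by simp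
  qed
  then have "Q (\<Sum>A\<in>P. scale (coeff u A) (e A))" using finite_subset[OF assms(1)] by simp
  then show ?thesis unfolding Sub_expansion[OF assms(1,2), symmetric] .
qed

lemma Sub_orthogonal:
  assumes "u \<in> Sub P" "w \<in> Sub Q" "P \<inter> Q = {}" "Q \<subseteq> {0..2*n}"
  shows "pairing u w = 0"
proof (rule Sub_induct[OF assms(4,2)])
  note u = Sub_S[OF assms(1)]
  show "pairing u 0 = 0" using u by simp
  show "pairing u (e A) = 0" if "A \<in> Q" for A using assms that by (auto simp: Sub_def)
  show "pairing u (x + y) = 0" if "x \<in> Sub Q" "y \<in> Sub Q" "pairing u x = 0" "pairing u y = 0" for x y
    unfolding pairing_add_right[OF Sub_S[OF that(1)] Sub_S[OF that(2)] u] that(3,4) by simp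
  show "pairing u (scale f x) = 0" if "f \<in> R" "x \<in> Sub Q" "pairing u x = 0" for f x
    unfolding pairing_scale_right[OF that(1) Sub_S[OF that(2)] u] that(3) by simp
qed

lemma global_frame_unique:
  assumes "global_frame G W m b" "(\<Sum>i<m. scale (c i) (b i)) \<in> W"
    "\<And>i. i < m \<Longrightarrow> c i \<in> R" "\<And>i. i < m \<Longrightarrow> d i \<in> R"
    "(\<Sum>i<m. scale (c i) (b i)) = (\<Sum>i<m. scale (d i) (b i))" "i < m"
  shows "c i = d i"
proof -
  let ?w = "\<Sum>i<m. scale (c i) (b i)"
  let ?P = "\<lambda>c. c \<in> {..<m} \<rightarrow>\<^sub>E R \<and> ?w = (\<Sum>i<m. scale (c i) (b i))"
  have "\<exists>!c. ?P c" using assms(1,2) unfolding global_frame_def by blast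
  then obtain k where k: "\<forall>c. ?P c \<longrightarrow> c = k" unfolding Ex1_def by blast
  have 1: "?P (restrict c {..<m})" using assms(3) by (auto intro!: sum.cong)
  have 2: "?P (restrict d {..<m})" using assms(4) unfolding assms(5) by (auto intro!: sum.cong)
  have "restrict c {..<m} = restrict d {..<m}"
    using k[rule_format, OF 1] k[rule_format, OF 2] by (simp only:)
  from fun_cong[OF this, of i] show ?thesis using assms(6) by simp
qed

lemma coeff_sum:
  assumes "\<And>i. i \<in> I \<Longrightarrow> f i \<in> R" "\<And>i. i \<in> I \<Longrightarrow> u i \<in> S" "A \<in> {0..2*n}"
  shows "coeff (\<Sum>i\<in>I. scale (f i) (u i)) A = (\<Sum>i\<in>I. f i * coeff (u i) A)"
proof -
  have "pairing (\<Sum>i\<in>I. scale (f i) (u i)) (e A) = (\<Sum>i\<in>I. pairing (scale (f i) (u i)) (e A))"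
    using assms by (intro pairing_sum_left) auto
  also have "\<dots> = (\<Sum>i\<in>I. f i * pairing (u i) (e A))"
    by (intro sum.cong refl pairing_scale_left assms e_S)
  finally show ?thesis unfolding coeff_def by (simp add: sum_distrib_left mult.left_commute)
qed

definition linear_on :: "'a sec set \<Rightarrow> ('a sec \<Rightarrow> 'a sec) \<Rightarrow> bool" where
  "linear_on W T \<longleftrightarrow> (\<forall>u\<in>W. T u \<in> W) \<and> (\<forall>u\<in>W. \<forall>w\<in>W. T (u + w) = T u + T w) \<and>
     (\<forall>f\<in>R. \<forall>u\<in>W. T (scale f u) = scale f (T u))"

lemma linear_onD:
  assumes "linear_on W T"
  shows "u \<in> W \<Longrightarrow> T u \<in> W" "u \<in> W \<Longrightarrow> w \<in> W \<Longrightarrow> T (u + w) = T u + T w"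
    "f \<in> R \<Longrightarrow> u \<in> W \<Longrightarrow> T (scale f u) = scale f (T u)"
  using assms by (simp_all add: linear_on_def)

lemma linear_on_sum:
  assumes "linear_on (Sub P) T" "finite I" "\<And>i. i \<in> I \<Longrightarrow> f i \<in> R" "\<And>i. i \<in> I \<Longrightarrow> u i \<in> Sub P"
  shows "T (\<Sum>i\<in>I. scale (f i) (u i)) = (\<Sum>i\<in>I. scale (f i) (T (u i)))"
  using assms(2-)
proof (induction I rule: finite_induct)
  case empty
  have "T (scale 0 0) = scale 0 (T 0)" by (rule linear_onD(3)[OF assms(1) R_0 Sub_0])
  then show ?case by simp
next
  case (insert i I)
  have "T (scale (f i) (u i) + (\<Sum>i\<in>I. scale (f i) (u i))) =
      T (scale (f i) (u i)) + T (\<Sum>i\<in>I. scale (f i) (u i))"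
    using insert.prems by (intro linear_onD(2)[OF assms(1)] Sub_scale Sub_sum) auto
  moreover have "T (scale (f i) (u i)) = scale (f i) (T (u i))"
    using insert.prems by (intro linear_onD(3)[OF assms(1)]) auto
  moreover have "T (\<Sum>i\<in>I. scale (f i) (u i)) = (\<Sum>i\<in>I. scale (f i) (T (u i)))"
    using insert.IH insert.prems by blast
  ultimately show ?case unfolding sum.insert[OF insert.hyps] by simp
qed

text \<open>If \<open>p\<close> and \<open>q\<close> are the transition matrices between \<open>b\<close> and the frame \<open>e\<close>, the product of \<open>p\<close> and
\<open>q\<close> is the identity by uniqueness of coefficients, and the trace of \<open>q c p\<close> is the trace of \<open>c\<close>.\<close>

lemma trace_in_frame:
  assumes P: "P \<subseteq> {0..2*n}" and T: "linear_on (Sub P) T" and b: "global_frame G (Sub P) m b"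
    and c: "\<forall>i<m. \<forall>j<m. c i j \<in> R" "\<forall>i<m. T (b i) = (\<Sum>j<m. scale (c i j) (b j))"
  shows "(\<Sum>i<m. c i i) = (\<Sum>A\<in>P. coeff (T (e A)) A)"
proof -
  have PI: "A \<in> {0..2*n}" if "A \<in> P" for A using P that by blast
  have finP: "finite P" using P finite_subset by blast
  have bW: "b i \<in> Sub P" if "i < m" for i using b that by (simp add: global_frame_def)
  have "\<forall>A. \<exists>q. A \<in> P \<longrightarrow> (\<forall>i<m. q i \<in> R) \<and> e A = (\<Sum>i<m. scale (q i) (b i))"
  proof
    fix A
    show "\<exists>q. A \<in> P \<longrightarrow> (\<forall>i<m. q i \<in> R) \<and> e A = (\<Sum>i<m. scale (q i) (b i))"
    proof (cases "A \<in> P")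
      case True
      have "\<exists>!c. c \<in> {..<m} \<rightarrow>\<^sub>E R \<and> e A = (\<Sum>i<m. scale (c i) (b i))"
        using b e_Sub[OF True P] unfolding global_frame_def by blast
      then obtain q where "q \<in> {..<m} \<rightarrow>\<^sub>E R" "e A = (\<Sum>i<m. scale (q i) (b i))" by blast
      then show ?thesis by (intro exI[of _ q]) auto
    qed simp
  qed
  from choice[OF this] obtain q where q0:
    "\<forall>A. A \<in> P \<longrightarrow> (\<forall>i<m. q A i \<in> R) \<and> e A = (\<Sum>i<m. scale (q A i) (b i))" ..
  have q: "q A i \<in> R" if "A \<in> P" "i < m" for A i using q0 that by blast
  have eA: "e A = (\<Sum>i<m. scale (q A i) (b i))" if "A \<in> P" for A using q0 that by blast
  let ?p = "\<lambda>j A. coeff (b j) A"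
  have p: "?p j A \<in> R" if "j < m" "A \<in> P" for j A by (rule coeff_R[OF Sub_S[OF bW[OF that(1)]] PI[OF that(2)]])
  \<comment> \<open>expand \<open>b j\<close> in the frame \<open>e\<close> and back, and compare coefficients\<close>
  have delta: "(\<Sum>A\<in>P. ?p j A * q A i) = (if i = j then 1 else 0)" if j: "j < m" and i: "i < m" for i j
  proof -
    have "(\<Sum>i<m. scale (if i = j then 1 else 0) (b i)) = (\<Sum>i<m. if i = j then b i else 0)"
      by (intro sum.cong) auto
    also have "\<dots> = b j" using j by simp
    finally have 1: "(\<Sum>i<m. scale (if i = j then 1 else 0) (b i)) = b j" .
    have "b j = (\<Sum>A\<in>P. scale (?p j A) (e A))" by (rule Sub_expansion[OF P bW[OF j]])
    also have "\<dots> = (\<Sum>A\<in>P. \<Sum>i<m. scale (?p j A * q A i) (b i))"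
    proof (rule sum.cong[OF refl])
      fix A assume "A \<in> P"
      show "scale (?p j A) (e A) = (\<Sum>i<m. scale (?p j A * q A i) (b i))"
        unfolding eA[OF \<open>A \<in> P\<close>] scale_sum scale_scale ..
    qed
    also have "\<dots> = (\<Sum>i<m. \<Sum>A\<in>P. scale (?p j A * q A i) (b i))" by (rule sum.swap)
    also have "\<dots> = (\<Sum>i<m. scale (\<Sum>A\<in>P. ?p j A * q A i) (b i))" unfolding scale_sum_left ..
    finally have 2: "(\<Sum>i<m. scale (\<Sum>A\<in>P. ?p j A * q A i) (b i)) = b j" ..
    show ?thesis
    proof (rule global_frame_unique[OF b _ _ _ _ i, where d = "\<lambda>i. if i = j then 1 else 0"
          and c = "\<lambda>i. \<Sum>A\<in>P. ?p j A * q A i"])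
      show "(\<Sum>i<m. scale (\<Sum>A\<in>P. ?p j A * q A i) (b i)) \<in> Sub P" unfolding 2 by (rule bW[OF j])
      show "(\<Sum>A\<in>P. ?p j A * q A i) \<in> R" if "i < m" for i
        using p[OF j] q that by (intro R_sum R_mult) auto
      show "(if i = j then 1 else 0) \<in> R" for i by simp
      show "(\<Sum>i<m. scale (\<Sum>A\<in>P. ?p j A * q A i) (b i)) = (\<Sum>i<m. scale (if i = j then 1 else 0) (b i))"
        unfolding 1 2 ..
    qed
  qed
  have "coeff (T (e A)) A = (\<Sum>i<m. \<Sum>j<m. c i j * (?p j A * q A i))" if A: "A \<in> P" for A
  proof -
    have "T (e A) = (\<Sum>i<m. scale (q A i) (T (b i)))"
      unfolding eA[OF A] using q[OF A] bW by (intro linear_on_sum[OF T]) auto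
    then have "coeff (T (e A)) A = (\<Sum>i<m. q A i * coeff (T (b i)) A)"
      using q[OF A] Sub_S[OF linear_onD(1)[OF T bW]] by (simp only:) (rule coeff_sum, use PI[OF A] in auto)
    also have "\<dots> = (\<Sum>i<m. q A i * (\<Sum>j<m. c i j * ?p j A))"
    proof (rule sum.cong[OF refl])
      fix i assume i: "i \<in> {..<m}"
      have "coeff (T (b i)) A = (\<Sum>j<m. c i j * ?p j A)"
        unfolding c(2)[rule_format, OF i[unfolded lessThan_iff]]
        using i c(1) Sub_S[OF bW] PI[OF A] by (intro coeff_sum) auto
      then show "q A i * coeff (T (b i)) A = q A i * (\<Sum>j<m. c i j * ?p j A)" by simp
    qed
    finally show ?thesis by (simp add: sum_distrib_left algebra_simps)
  qed
  then have "(\<Sum>A\<in>P. coeff (T (e A)) A) = (\<Sum>A\<in>P. \<Sum>i<m. \<Sum>j<m. c i j * (?p j A * q A i))" by simp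
  also have "\<dots> = (\<Sum>i<m. \<Sum>A\<in>P. \<Sum>j<m. c i j * (?p j A * q A i))" by (rule sum.swap)
  also have "\<dots> = (\<Sum>i<m. \<Sum>j<m. \<Sum>A\<in>P. c i j * (?p j A * q A i))"
    by (rule sum.cong[OF refl]) (rule sum.swap)
  also have "\<dots> = (\<Sum>i<m. \<Sum>j<m. c i j * (if i = j then 1 else 0))"
    unfolding sum_distrib_left[symmetric] by (intro sum.cong refl) (simp add: delta)
  also have "\<dots> = (\<Sum>i<m. \<Sum>j<m. if i = j then c i j else 0)"
    by (intro sum.cong refl) simp
  also have "\<dots> = (\<Sum>i<m. c i i)" by simp
  finally show ?thesis ..
qed

lemma trace_on_Sub:
  assumes P: "P \<subseteq> {0..2*n}" and T: "linear_on (Sub P) T"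
  shows "trace_on G (Sub P) T = (\<Sum>A\<in>P. K (\<epsilon> A) * pairing (T (e A)) (e A))"
proof -
  have PI: "A \<in> {0..2*n}" if "A \<in> P" for A using P that by blast
  have finP: "finite P" using P finite_subset by blast
  obtain b where "bij_betw b {0..<card P} P" using ex_bij_betw_nat_finite[OF finP] by blast
  then have b: "bij_betw b {..<card P} P" unfolding lessThan_atLeast0 .
  let ?m = "card P"
  have bP: "b i \<in> P" if "i < ?m" for i using b that by (auto simp: bij_betw_def)
  have reindex: "(\<Sum>i<?m. h (b i)) = (\<Sum>A\<in>P. h A)" for h :: "nat \<Rightarrow> 'x::comm_monoid_add"
    by (rule sum.reindex_bij_betw[OF b])
  have frame: "global_frame G (Sub P) ?m (\<lambda>i. e (b i))"
    unfolding global_frame_def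
  proof (intro conjI allI impI ballI)
    show "e (b i) \<in> Sub P" if "i < ?m" for i by (rule e_Sub[OF bP[OF that] P])
    fix w assume w: "w \<in> Sub P"
    show "\<exists>!c. c \<in> {..<?m} \<rightarrow>\<^sub>E R \<and> w = (\<Sum>i<?m. scale (c i) (e (b i)))"
    proof (rule ex1I[of _ "restrict (\<lambda>i. coeff w (b i)) {..<?m}"])
      have "w = (\<Sum>i<?m. scale (coeff w (b i)) (e (b i)))"
        unfolding reindex[of "\<lambda>A. scale (coeff w A) (e A)"] by (rule Sub_expansion[OF P w])
      also have "\<dots> = (\<Sum>i<?m. scale (restrict (\<lambda>i. coeff w (b i)) {..<?m} i) (e (b i)))"
        by (rule sum.cong) simp_all
      finally show "restrict (\<lambda>i. coeff w (b i)) {..<?m} \<in> {..<?m} \<rightarrow>\<^sub>E R \<and>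
          w = (\<Sum>i<?m. scale (restrict (\<lambda>i. coeff w (b i)) {..<?m} i) (e (b i)))"
        using coeff_R[OF Sub_S[OF w] PI[OF bP]] by auto
    next
      fix c assume c: "c \<in> {..<?m} \<rightarrow>\<^sub>E R \<and> w = (\<Sum>i<?m. scale (c i) (e (b i)))"
      show "c = restrict (\<lambda>i. coeff w (b i)) {..<?m}"
      proof
        fix i
        show "c i = restrict (\<lambda>i. coeff w (b i)) {..<?m} i"
        proof (cases "i < ?m")
          case False
          then show ?thesis using c by (auto simp: PiE_def extensional_def)
        next
          case True
          have cR: "c j \<in> R" if "j < ?m" for j using c that by auto
          have "coeff w (b i) = (\<Sum>j<?m. c j * coeff (e (b j)) (b i))"
            unfolding conjunct2[OF c] using cR PI bP True by (intro coeff_sum) auto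
          also have "\<dots> = (\<Sum>j<?m. if j = i then c i else 0)"
          proof (rule sum.cong[OF refl])
            fix j assume j: "j \<in> {..<?m}"
            have "b j = b i \<longleftrightarrow> j = i" using b j True by (auto simp: bij_betw_def inj_on_def)
            then show "c j * coeff (e (b j)) (b i) = (if j = i then c i else 0)"
              using j True \<epsilon>_square[OF PI[OF bP[OF True]]] pairing_e[OF PI[OF bP] PI[OF bP[OF True]], of j]
              by (auto simp: coeff_def K_arith)
          qed
          also have "\<dots> = c i" using True by simp
          finally show ?thesis using True by simp
        qed
      qed
    qed
  qed
  have TS: "T (e A) \<in> Sub P" if "A \<in> P" for A by (rule linear_onD(1)[OF T e_Sub[OF that P]])
  have coeff: "(\<Sum>A\<in>P. K (\<epsilon> A) * pairing (T (e A)) (e A)) = (\<Sum>A\<in>P. coeff (T (e A)) A)"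
    unfolding coeff_def ..
  show ?thesis
    unfolding trace_on_def coeff
  proof (rule the_equality)
    let ?c = "\<lambda>i j. coeff (T (e (b i))) (b j)"
    have "\<forall>i<?m. \<forall>j<?m. ?c i j \<in> R" using coeff_R[OF Sub_S[OF TS[OF bP]] PI[OF bP]] by blast
    moreover have "\<forall>i<?m. T (e (b i)) = (\<Sum>j<?m. scale (?c i j) (e (b j)))"
    proof (intro allI impI)
      fix i assume i: "i < ?m"
      show "T (e (b i)) = (\<Sum>j<?m. scale (?c i j) (e (b j)))"
        unfolding reindex[of "\<lambda>A. scale (coeff (T (e (b i))) A) (e A)"]
        by (rule Sub_expansion[OF P TS[OF bP[OF i]]])
    qed
    moreover have "(\<Sum>A\<in>P. coeff (T (e A)) A) = (\<Sum>i<?m. ?c i i)"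
      unfolding reindex[of "\<lambda>A. coeff (T (e A)) A"] ..
    ultimately show "\<exists>m b c. global_frame G (Sub P) m b \<and> (\<forall>i<m. \<forall>j<m. c i j \<in> R) \<and>
        (\<forall>i<m. T (b i) = (\<Sum>j<m. scale (c i j) (b j))) \<and> (\<Sum>A\<in>P. coeff (T (e A)) A) = (\<Sum>i<m. c i i)"
      using frame by (intro exI[of _ ?m] exI[of _ "\<lambda>i. e (b i)"] exI[of _ ?c] conjI)
  next
    fix t assume "\<exists>m b c. global_frame G (Sub P) m b \<and> (\<forall>i<m. \<forall>j<m. c i j \<in> R) \<and>
        (\<forall>i<m. T (b i) = (\<Sum>j<m. scale (c i j) (b j))) \<and> t = (\<Sum>i<m. c i i)"
    then show "t = (\<Sum>A\<in>P. coeff (T (e A)) A)" using trace_in_frame[OF P T] by blast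
  qed
qed

end

section \<open>The Ricci tensor of a Levi-Civita generalized connection\<close>

text \<open>A torsion-free connection that respects an orthogonal decomposition into the subbundles of \<open>P\<close>
and \<open>Q\<close>, with divergence given by \<open>d\<close> on the frame of the first. The two Ricci tensors arise from
each other by exchanging \<open>P\<close> and \<open>Q\<close>.\<close>

locale split_connection = invariant_frame G n v H F g
  for G :: "('a::{t2_space, second_countable_topology}, 'e::euclidean_space) lie_group"
    and n v H F g +
  fixes D :: "'a sec \<Rightarrow> 'a sec \<Rightarrow> 'a sec" and P Q :: "nat set" and d :: "nat \<Rightarrow> real"
  assumes conn: "gen_connection G D"
    and tor: "\<And>u w x. u \<in> S \<Longrightarrow> w \<in> S \<Longrightarrow> x \<in> S \<Longrightarrow> torsion G H F D u w x = 0"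
    and PQ: "P \<union> Q = {0..2*n}" "P \<inter> Q = {}"
    and pres_P: "\<And>u w. u \<in> S \<Longrightarrow> w \<in> Sub P \<Longrightarrow> D u w \<in> Sub P"
    and pres_Q: "\<And>u w. u \<in> S \<Longrightarrow> w \<in> Sub Q \<Longrightarrow> D u w \<in> Sub Q"
    and div: "\<And>b. b \<in> P \<Longrightarrow> (\<Sum>a\<in>P. K (\<epsilon> a) * pairing (D (e a) (e b)) (e a)) = K (d b)"
begin

lemma sub: "P \<subseteq> {0..2*n}" "Q \<subseteq> {0..2*n}" "finite P" "finite Q"
  using PQ finite_subset[of _ "{0..2*n}"] by auto

lemma in_I: "A \<in> P \<Longrightarrow> A \<in> {0..2*n}" "A \<in> Q \<Longrightarrow> A \<in> {0..2*n}"
  using PQ by auto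

lemma D_S [simp, intro]: "u \<in> S \<Longrightarrow> w \<in> S \<Longrightarrow> D u w \<in> S"
  using conn by (simp add: gen_connection_def)

lemma D_add_left: "u \<in> S \<Longrightarrow> u' \<in> S \<Longrightarrow> w \<in> S \<Longrightarrow> D (u + u') w = D u w + D u' w"
  using conn by (simp add: gen_connection_def)

lemma D_scale_left: "f \<in> R \<Longrightarrow> u \<in> S \<Longrightarrow> w \<in> S \<Longrightarrow> D (scale f u) w = scale f (D u w)"
  using conn by (simp add: gen_connection_def)

lemma D_add_right: "u \<in> S \<Longrightarrow> w \<in> S \<Longrightarrow> w' \<in> S \<Longrightarrow> D u (w + w') = D u w + D u w'"
  using conn by (simp add: gen_connection_def)

lemma D_scale_right: "f \<in> R \<Longrightarrow> u \<in> S \<Longrightarrow> w \<in> S \<Longrightarrow>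
    D u (scale f w) = scale (anchor u f) w + scale f (D u w)"
  using conn by (simp add: gen_connection_def)

lemma D_metric: "u \<in> S \<Longrightarrow> w \<in> S \<Longrightarrow> x \<in> S \<Longrightarrow>
    anchor u (pairing w x) = pairing (D u w) x + pairing w (D u x)"
  using conn by (simp add: gen_connection_def)

lemma D_0_left: "w \<in> S \<Longrightarrow> D 0 w = 0"
  using D_scale_left[of 0 0 w] by simp

lemma D_0_right: "u \<in> S \<Longrightarrow> D u 0 = 0"
  using D_add_right[of u 0 0] by simp

lemma D_sum_right:
  assumes "u \<in> S" "finite T" "\<And>A. A \<in> T \<Longrightarrow> w A \<in> S"
  shows "D u (\<Sum>A\<in>T. scale (K (k A)) (w A)) = (\<Sum>A\<in>T. scale (K (k A)) (D u (w A)))"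
  using assms(2,3)
proof (induction T rule: finite_induct)
  case empty then show ?case using D_0_right[OF assms(1)] by simp
next
  case (insert A T)
  have "D u (scale (K (k A)) (w A) + (\<Sum>A\<in>T. scale (K (k A)) (w A))) =
      D u (scale (K (k A)) (w A)) + D u (\<Sum>A\<in>T. scale (K (k A)) (w A))"
    using insert.prems by (intro D_add_right assms(1) S_sum S_scale) auto
  moreover have "D u (scale (K (k A)) (w A)) = scale (K (k A)) (D u (w A))"
    using insert.prems assms(1) by (simp add: D_scale_right anchor_deriv)
  moreover have "D u (\<Sum>A\<in>T. scale (K (k A)) (w A)) = (\<Sum>A\<in>T. scale (K (k A)) (D u (w A)))"
    using insert.IH insert.prems by blast
  ultimately show ?case unfolding sum.insert[OF insert.hyps] by simp
qed

lemma D_sum_left: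
  assumes "w \<in> S" "finite T" "\<And>A. A \<in> T \<Longrightarrow> u A \<in> S"
  shows "D (\<Sum>A\<in>T. scale (K (k A)) (u A)) w = (\<Sum>A\<in>T. scale (K (k A)) (D (u A) w))"
  using assms(2,3)
proof (induction T rule: finite_induct)
  case empty then show ?case using D_0_left[OF assms(1)] by simp
next
  case (insert A T)
  have "D (scale (K (k A)) (u A) + (\<Sum>A\<in>T. scale (K (k A)) (u A))) w =
      D (scale (K (k A)) (u A)) w + D (\<Sum>A\<in>T. scale (K (k A)) (u A)) w"
    using insert.prems by (intro D_add_left assms(1) S_sum S_scale) auto
  moreover have "D (scale (K (k A)) (u A)) w = scale (K (k A)) (D (u A) w)"
    using insert.prems assms(1) by (intro D_scale_left) auto
  moreover have "D (\<Sum>A\<in>T. scale (K (k A)) (u A)) w = (\<Sum>A\<in>T. scale (K (k A)) (D (u A) w))"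
    using insert.IH insert.prems by blast
  ultimately show ?case unfolding sum.insert[OF insert.hyps] by simp
qed

definition \<omega> where "\<omega> A C E = pairing (D (e A) (e C)) (e E)"

lemma \<omega>_R: "A \<in> {0..2*n} \<Longrightarrow> C \<in> {0..2*n} \<Longrightarrow> E \<in> {0..2*n} \<Longrightarrow> \<omega> A C E \<in> R"
  unfolding \<omega>_def by (intro pairing_R D_S e_S)

lemma \<omega>_antisym:
  assumes "A \<in> {0..2*n}" "C \<in> {0..2*n}" "E \<in> {0..2*n}"
  shows "\<omega> A E C = - \<omega> A C E"
proof -
  have "anchor (e A) (pairing (e C) (e E)) = 0"
    unfolding pairing_e[OF assms(2,3)] by (rule anchor_deriv(3)[OF e_S[OF assms(1)]])
  then have "\<omega> A C E + \<omega> A E C = 0"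
    unfolding D_metric[OF e_S[OF assms(1)] e_S[OF assms(2)] e_S[OF assms(3)]] \<omega>_def
      pairing_commute[of "e C" "D (e A) (e E)"] .
  then show ?thesis by (simp add: eq_neg_iff_add_eq_0 add.commute)
qed

lemma \<omega>_mixed: "A \<in> {0..2*n} \<Longrightarrow> b \<in> P \<Longrightarrow> j \<in> Q \<Longrightarrow> \<omega> A b j = 0"
  unfolding \<omega>_def
  by (rule Sub_orthogonal[OF pres_P[OF e_S e_Sub[OF _ sub(1)]] e_Sub[OF _ sub(2)] PQ(2) sub(2)])

text \<open>Of the three terms in the torsion condition, two have their last indices in different halves.\<close>

lemma \<omega>_B:
  assumes "i \<in> Q" "b \<in> P" "c \<in> P" shows "\<omega> i b c = K (B i b c)"
proof -
  note i = in_I(2)[OF assms(1)] and b = in_I(1)[OF assms(2)] and c = in_I(1)[OF assms(3)]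
  have "torsion G H F D (e i) (e b) (e c) = 0" by (rule tor[OF e_S[OF i] e_S[OF b] e_S[OF c]])
  then have "\<omega> i b c - \<omega> b i c - K (B i b c) + \<omega> c i b = 0"
    unfolding torsion_def \<omega>_def pairing_br_e_const[OF i b c, symmetric] pairing_commute[of "e b"]
    using e_S[OF i] e_S[OF b] e_S[OF c] by (simp add: pairing_diff_left)
  moreover have "\<omega> b i c = 0" using \<omega>_mixed[OF b assms(3,1)] \<omega>_antisym[OF b c i] by simp
  moreover have "\<omega> c i b = 0" using \<omega>_mixed[OF c assms(2,1)] \<omega>_antisym[OF c b i] by simp
  ultimately show ?thesis by simp
qed

abbreviation Rm where "Rm \<equiv> curvature G H F D"

text \<open>Orthogonality of the first two arguments removes the gradient term of the bracket.\<close>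

lemma Rm_scale_1:
  assumes "w \<in> S" "u \<in> S" "x \<in> S" "f \<in> R" "pairing w u = 0"
  shows "Rm (scale f w) u x = scale f (Rm w u x)"
proof -
  have "br (scale f w) u = scale f (br w u) - scale (anchor u f) w"
    unfolding br_scale_left[OF assms(1,2,4)] assms(5) by simp
  then have "D (br (scale f w) u) x + D (scale (anchor u f) w) x = D (scale f (br w u)) x"
    using assms by (simp add: D_add_left[symmetric])
  then have br: "D (br (scale f w) u) x = scale f (D (br w u) x) - scale (anchor u f) (D w x)"
    using assms by (simp add: D_scale_left algebra_simps)
  show ?thesis
    unfolding curvature_def br using assms
    by (simp add: D_scale_left D_scale_right scale_diff)
qed

lemma Rm_scale_2:
  assumes "w \<in> S" "u \<in> S" "x \<in> S" "f \<in> R"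
  shows "Rm w (scale f u) x = scale f (Rm w u x)"
  unfolding curvature_def using assms
  by (simp add: br_scale_right D_scale_left D_scale_right D_add_left scale_diff)

text \<open>The second derivatives of \<open>f\<close> cancel because the anchor maps the Dorfman bracket to the Lie
bracket.\<close>

lemma Rm_scale_3:
  assumes "w \<in> S" "u \<in> S" "x \<in> S" "f \<in> R"
  shows "Rm w u (scale f x) = scale f (Rm w u x)"
  unfolding curvature_def using assms
  by (simp add: D_scale_left D_scale_right D_add_right scale_diff scale_add_right anchor_dorfman algebra_simps)

lemma Rm_add_1:
  assumes "w \<in> S" "w' \<in> S" "u \<in> S" "x \<in> S" shows "Rm (w + w') u x = Rm w u x + Rm w' u x"
  unfolding curvature_def using assms by (simp add: br_add_left D_add_left D_add_right)

lemma Rm_add_2: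
  assumes "w \<in> S" "u' \<in> S" "u \<in> S" "x \<in> S" shows "Rm w (u + u') x = Rm w u x + Rm w u' x"
  unfolding curvature_def using assms by (simp add: br_add_right D_add_left D_add_right)

lemma Rm_add_3:
  assumes "w \<in> S" "x' \<in> S" "u \<in> S" "x \<in> S" shows "Rm w u (x + x') = Rm w u x + Rm w u x'"
  unfolding curvature_def using assms by (simp add: D_add_left D_add_right)

lemma Rm_S: "w \<in> S \<Longrightarrow> u \<in> S \<Longrightarrow> x \<in> S \<Longrightarrow> Rm w u x \<in> S"
  unfolding curvature_def by (intro S_diff D_S br_S)

lemma linear_Rm:
  assumes "u \<in> Sub Q" "x \<in> Sub P" shows "linear_on (Sub P) (\<lambda>w. Rm w u x)"
  unfolding linear_on_def
proof (intro conjI ballI)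
  note u = Sub_S[OF assms(1)] and x = Sub_S[OF assms(2)]
  show "Rm w u x \<in> Sub P" if "w \<in> Sub P" for w
    unfolding curvature_def using Sub_S[OF that] u by (intro Sub_diff pres_P assms(2) br_S)
  show "Rm (w + w') u x = Rm w u x + Rm w' u x" if "w \<in> Sub P" "w' \<in> Sub P" for w w'
    by (rule Rm_add_1[OF Sub_S[OF that(1)] Sub_S[OF that(2)] u x])
  show "Rm (scale f w) u x = scale f (Rm w u x)" if "f \<in> R" "w \<in> Sub P" for f w
    by (rule Rm_scale_1[OF Sub_S[OF that(2)] u x that(1) Sub_orthogonal[OF that(2) assms(1) PQ(2) sub(2)]])
qed

definition ric where "ric u x = trace_on G (Sub P) (\<lambda>w. Rm w u x)"

lemma ric_eq:
  assumes "u \<in> Sub Q" "x \<in> Sub P"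
  shows "ric u x = (\<Sum>A\<in>P. K (\<epsilon> A) * pairing (Rm (e A) u x) (e A))"
  unfolding ric_def by (rule trace_on_Sub[OF sub(1) linear_Rm[OF assms]])

lemma ric_tensorial:
  shows "u \<in> Sub Q \<Longrightarrow> u' \<in> Sub Q \<Longrightarrow> x \<in> Sub P \<Longrightarrow> ric (u + u') x = ric u x + ric u' x"
    "u \<in> Sub Q \<Longrightarrow> x' \<in> Sub P \<Longrightarrow> x \<in> Sub P \<Longrightarrow> ric u (x + x') = ric u x + ric u x'"
    "f \<in> R \<Longrightarrow> u \<in> Sub Q \<Longrightarrow> x \<in> Sub P \<Longrightarrow> ric (scale f u) x = f * ric u x"
    "f \<in> R \<Longrightarrow> u \<in> Sub Q \<Longrightarrow> x \<in> Sub P \<Longrightarrow> ric u (scale f x) = f * ric u x"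
    "u \<in> Sub Q \<Longrightarrow> x \<in> Sub P \<Longrightarrow> ric 0 x = 0" "u \<in> Sub Q \<Longrightarrow> x \<in> Sub P \<Longrightarrow> ric u 0 = 0"
proof -
  have p: "pairing (y + z) (e A) = pairing y (e A) + pairing z (e A)" if "y \<in> S" "z \<in> S" "A \<in> P" for y z A
    by (rule pairing_add_left[OF that(1,2) e_S[OF in_I(1)[OF that(3)]]])
  have q: "pairing (scale f y) (e A) = f * pairing y (e A)" if "y \<in> S" "f \<in> R" "A \<in> P" for y f A
    by (rule pairing_scale_left[OF that(2,1) e_S[OF in_I(1)[OF that(3)]]])
  have e: "e A \<in> S" if "A \<in> P" for A by (rule e_S[OF in_I(1)[OF that]])
  show "u \<in> Sub Q \<Longrightarrow> u' \<in> Sub Q \<Longrightarrow> x \<in> Sub P \<Longrightarrow> ric (u + u') x = ric u x + ric u' x"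
    using Sub_S[of u Q] Sub_S[of u' Q] Sub_S[of x P] e
    by (simp add: ric_eq Sub_add Rm_add_2 p Rm_S distrib_left sum.distrib)
  show "u \<in> Sub Q \<Longrightarrow> x' \<in> Sub P \<Longrightarrow> x \<in> Sub P \<Longrightarrow> ric u (x + x') = ric u x + ric u x'"
    using Sub_S[of u Q] Sub_S[of x' P] Sub_S[of x P] e
    by (simp add: ric_eq Sub_add Rm_add_3 p Rm_S distrib_left sum.distrib)
  show s1: "ric (scale f u) x = f * ric u x" if "f \<in> R" "u \<in> Sub Q" "x \<in> Sub P" for f u x
    using that Sub_S[of u Q] Sub_S[of x P] e
    by (simp add: ric_eq Sub_scale Rm_scale_2 q Rm_S sum_distrib_left mult.left_commute)
  show s2: "ric u (scale f x) = f * ric u x" if "f \<in> R" "u \<in> Sub Q" "x \<in> Sub P" for f u x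
    using that Sub_S[of u Q] Sub_S[of x P] e
    by (simp add: ric_eq Sub_scale Rm_scale_3 q Rm_S sum_distrib_left mult.left_commute)
  show "u \<in> Sub Q \<Longrightarrow> x \<in> Sub P \<Longrightarrow> ric 0 x = 0" "u \<in> Sub Q \<Longrightarrow> x \<in> Sub P \<Longrightarrow> ric u 0 = 0"
    using s1[OF R_0, of u x] s2[OF R_0, of u x] by simp_all
qed

lemma ric_vanishes_iff:
  "(\<forall>u\<in>Sub Q. \<forall>x\<in>Sub P. ric u x = 0) \<longleftrightarrow> (\<forall>i\<in>Q. \<forall>b\<in>P. ric (e i) (e b) = 0)"
proof (intro iffI ballI)
  show "ric (e i) (e b) = 0" if "\<forall>u\<in>Sub Q. \<forall>x\<in>Sub P. ric u x = 0" "i \<in> Q" "b \<in> P" for i b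
    using that e_Sub[OF that(2) sub(2)] e_Sub[OF that(3) sub(1)] by blast
next
  fix u x assume 0: "\<forall>i\<in>Q. \<forall>b\<in>P. ric (e i) (e b) = 0" and u: "u \<in> Sub Q" and x: "x \<in> Sub P"
  have 1: "ric (e i) x = 0" if i: "i \<in> Q" for i
  proof (rule Sub_induct[OF sub(1) x])
    note ei = e_Sub[OF i sub(2)]
    show "ric (e i) 0 = 0" by (rule ric_tensorial(6)[OF ei x])
    show "ric (e i) (e A) = 0" if "A \<in> P" for A using 0 i that by blast
    show "ric (e i) (y + z) = 0" if "y \<in> Sub P" "z \<in> Sub P" "ric (e i) y = 0" "ric (e i) z = 0" for y z
      unfolding ric_tensorial(2)[OF ei that(2,1)] that(3,4) by simp
    show "ric (e i) (scale f y) = 0" if "f \<in> R" "y \<in> Sub P" "ric (e i) y = 0" for f y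
      unfolding ric_tensorial(4)[OF that(1) ei that(2)] that(3) by simp
  qed
  show "ric u x = 0"
  proof (rule Sub_induct[OF sub(2) u])
    show "ric 0 x = 0" by (rule ric_tensorial(5)[OF u x])
    show "ric (e A) x = 0" if "A \<in> Q" for A by (rule 1[OF that])
    show "ric (y + z) x = 0" if "y \<in> Sub Q" "z \<in> Sub Q" "ric y x = 0" "ric z x = 0" for y z
      unfolding ric_tensorial(1)[OF that(1,2) x] that(3,4) by simp
    show "ric (scale f y) x = 0" if "f \<in> R" "y \<in> Sub Q" "ric y x = 0" for f y
      unfolding ric_tensorial(3)[OF that(1,2) x] that(3) by simp
  qed
qed

lemma D_e_mixed:
  assumes "i \<in> Q" "b \<in> P" shows "D (e i) (e b) = (\<Sum>c\<in>P. scale (K (\<epsilon> c * B i b c)) (e c))"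
proof -
  have "D (e i) (e b) = (\<Sum>c\<in>P. scale (coeff (D (e i) (e b)) c) (e c))"
    by (rule Sub_expansion[OF sub(1) pres_P[OF e_S[OF in_I(2)[OF assms(1)]] e_Sub[OF assms(2) sub(1)]]])
  also have "\<dots> = (\<Sum>c\<in>P. scale (K (\<epsilon> c * B i b c)) (e c))"
    by (intro sum.cong refl)
      (simp add: coeff_def \<omega>_def[symmetric] \<omega>_B[OF assms] K_arith)
  finally show ?thesis .
qed

lemma br_e:
  assumes "A \<in> {0..2*n}" "C \<in> {0..2*n}"
  shows "br (e A) (e C) = (\<Sum>E\<in>{0..2*n}. scale (K (\<epsilon> E * B A C E)) (e E))"
proof -
  have "br (e A) (e C) = (\<Sum>E\<in>{0..2*n}. scale (coeff (br (e A) (e C)) E) (e E))"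
    by (rule Sub_expansion) (use assms in \<open>simp_all only: Sub_UNIV br_S e_S order_refl\<close>)
  also have "\<dots> = (\<Sum>E\<in>{0..2*n}. scale (K (\<epsilon> E * B A C E)) (e E))"
    by (intro sum.cong refl) (simp only: coeff_def pairing_br_e_const[OF assms] K_arith)
  finally show ?thesis .
qed

lemma pairing_D_sum_right:
  assumes "a \<in> P" "i \<in> Q" "b \<in> P" "y \<in> P"
  shows "pairing (D (e a) (D (e i) (e b))) (e y) = (\<Sum>c\<in>P. K (\<epsilon> c * B i b c) * \<omega> a c y)"
proof -
  have ea: "e a \<in> S" and ey: "e y \<in> S" using assms in_I by blast+
  have ec: "e c \<in> S" if "c \<in> P" for c using that in_I by blast
  have 1: "D (e a) (\<Sum>c\<in>P. scale (K (\<epsilon> c * B i b c)) (e c)) =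
      (\<Sum>c\<in>P. scale (K (\<epsilon> c * B i b c)) (D (e a) (e c)))"
    by (rule D_sum_right[OF ea sub(3)]) (rule ec)
  have "pairing (D (e a) (D (e i) (e b))) (e y) =
      (\<Sum>c\<in>P. pairing (scale (K (\<epsilon> c * B i b c)) (D (e a) (e c))) (e y))"
    unfolding D_e_mixed[OF assms(2,3)] 1
    using ea ey ec by (intro pairing_sum_left S_scale D_S) auto
  also have "\<dots> = (\<Sum>c\<in>P. K (\<epsilon> c * B i b c) * \<omega> a c y)"
    unfolding \<omega>_def using ea ey ec by (intro sum.cong refl pairing_scale_left D_S) auto
  finally show ?thesis .
qed

lemma pairing_D_D:
  assumes "a \<in> P" "i \<in> Q" "b \<in> P"
  shows "pairing (D (e i) (D (e a) (e b))) (e a) =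
    anchor (e i) (\<omega> a b a) - (\<Sum>c\<in>P. K (\<epsilon> c * B i a c) * \<omega> a b c)"
proof -
  have e: "e a \<in> S" "e i \<in> S" "e b \<in> S" using assms in_I by blast+
  have ec: "e c \<in> S" if "c \<in> P" for c using that in_I by blast
  have "anchor (e i) (\<omega> a b a) =
      pairing (D (e i) (D (e a) (e b))) (e a) + pairing (D (e a) (e b)) (D (e i) (e a))"
    unfolding \<omega>_def by (rule D_metric[OF e(2) D_S[OF e(1,3)] e(1)])
  moreover have "pairing (D (e a) (e b)) (D (e i) (e a)) =
      (\<Sum>c\<in>P. pairing (scale (K (\<epsilon> c * B i a c)) (e c)) (D (e a) (e b)))"
    unfolding pairing_commute[of "D (e a) (e b)"] D_e_mixed[OF assms(2,1)]
    using e ec by (intro pairing_sum_left S_scale D_S) auto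
  moreover have "\<dots> = (\<Sum>c\<in>P. K (\<epsilon> c * B i a c) * \<omega> a b c)"
    unfolding \<omega>_def pairing_commute[of "D (e a) (e b)"]
    using e ec by (intro sum.cong refl pairing_scale_left D_S) auto
  ultimately show ?thesis by simp
qed

lemma pairing_D_br:
  assumes "a \<in> P" "i \<in> Q" "b \<in> P"
  shows "pairing (D (br (e a) (e i)) (e b)) (e a) =
    (\<Sum>c\<in>P. K (\<epsilon> c * B a i c) * \<omega> c b a) + (\<Sum>j\<in>Q. K (\<epsilon> j * B a i j * B j b a))"
proof -
  have I: "a \<in> {0..2*n}" "i \<in> {0..2*n}" using assms in_I by blast+
  have e: "e a \<in> S" "e i \<in> S" "e b \<in> S" using assms in_I by blast+
  have 1: "D (\<Sum>E\<in>{0..2*n}. scale (K (\<epsilon> E * B a i E)) (e E)) (e b) =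
      (\<Sum>E\<in>{0..2*n}. scale (K (\<epsilon> E * B a i E)) (D (e E) (e b)))"
    by (rule D_sum_left[OF e(3) finite_atLeastAtMost]) (rule e_S)
  have "pairing (D (br (e a) (e i)) (e b)) (e a) =
      (\<Sum>E\<in>{0..2*n}. pairing (scale (K (\<epsilon> E * B a i E)) (D (e E) (e b))) (e a))"
    unfolding br_e[OF I] 1
    by (rule pairing_sum_left[OF S_scale[OF K_R D_S[OF e_S e(3)]] e(1)])
  also have "\<dots> = (\<Sum>E\<in>{0..2*n}. K (\<epsilon> E * B a i E) * \<omega> E b a)"
    unfolding \<omega>_def by (rule sum.cong[OF refl]) (rule pairing_scale_left[OF K_R D_S[OF e_S e(3)] e(1)])
  also have "\<dots> = (\<Sum>c\<in>P. K (\<epsilon> c * B a i c) * \<omega> c b a) + (\<Sum>j\<in>Q. K (\<epsilon> j * B a i j) * \<omega> j b a)"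
    by (rule sum.union_disjoint[OF sub(3,4) PQ(2), unfolded PQ(1)])
  finally have "pairing (D (br (e a) (e i)) (e b)) (e a) =
    (\<Sum>c\<in>P. K (\<epsilon> c * B a i c) * \<omega> c b a) + (\<Sum>j\<in>Q. K (\<epsilon> j * B a i j) * \<omega> j b a)" .
  moreover have "(\<Sum>j\<in>Q. K (\<epsilon> j * B a i j) * \<omega> j b a) = (\<Sum>j\<in>Q. K (\<epsilon> j * B a i j * B j b a))"
    by (rule sum.cong[OF refl]) (simp only: \<omega>_B[OF _ assms(3,1)] K_arith mult.assoc)
  ultimately show ?thesis by (simp only:)
qed

text \<open>The trace of the curvature is a sum of five terms. The first one is the divergence, contracted
with \<open>B\<close>. The second one is the derivative of the divergence, which is constant on the frame. The third
and the fourth one cancel after exchanging the names of the summation indices, by cyclic symmetry of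
\<open>B\<close>. The last one involves only coefficients of \<open>D\<close> that the torsion condition determines.\<close>

lemma ric_e:
  assumes i: "i \<in> Q" and b: "b \<in> P"
  shows "ric (e i) (e b) = K ((\<Sum>c\<in>P. \<epsilon> c * B i b c * d c) - (\<Sum>a\<in>P. \<Sum>j\<in>Q. \<epsilon> a * \<epsilon> j * B a i j * B j b a))"
proof -
  note iI = in_I(2)[OF i] and bI = in_I(1)[OF b]
  have e: "e i \<in> S" "e b \<in> S" using iI bI by blast+
  have ea: "e a \<in> S" if "a \<in> P" for a using in_I(1)[OF that] by blast
  let ?s1 = "\<Sum>a\<in>P. \<Sum>c\<in>P. K (\<epsilon> a) * (K (\<epsilon> c * B i b c) * \<omega> a c a)"
  let ?s2 = "\<Sum>a\<in>P. K (\<epsilon> a) * anchor (e i) (\<omega> a b a)"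
  let ?s3 = "\<Sum>a\<in>P. \<Sum>c\<in>P. K (\<epsilon> a) * (K (\<epsilon> c * B i a c) * \<omega> a b c)"
  let ?s4 = "\<Sum>a\<in>P. \<Sum>c\<in>P. K (\<epsilon> a) * (K (\<epsilon> c * B a i c) * \<omega> c b a)"
  let ?s5 = "\<Sum>a\<in>P. \<Sum>j\<in>Q. K (\<epsilon> a) * K (\<epsilon> j * B a i j * B j b a)"
  have "ric (e i) (e b) = (\<Sum>a\<in>P. K (\<epsilon> a) * pairing (Rm (e a) (e i) (e b)) (e a))"
    by (rule ric_eq[OF e_Sub[OF i sub(2)] e_Sub[OF b sub(1)]])
  also have "\<dots> = (\<Sum>a\<in>P. (\<Sum>c\<in>P. K (\<epsilon> a) * (K (\<epsilon> c * B i b c) * \<omega> a c a))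
      - K (\<epsilon> a) * anchor (e i) (\<omega> a b a) + (\<Sum>c\<in>P. K (\<epsilon> a) * (K (\<epsilon> c * B i a c) * \<omega> a b c))
      - (\<Sum>c\<in>P. K (\<epsilon> a) * (K (\<epsilon> c * B a i c) * \<omega> c b a))
      - (\<Sum>j\<in>Q. K (\<epsilon> a) * K (\<epsilon> j * B a i j * B j b a)))"
  proof (rule sum.cong[OF refl])
    fix a assume a: "a \<in> P"
    have h: "pairing (Rm (e a) (e i) (e b)) (e a) = pairing (D (e a) (D (e i) (e b))) (e a)
        - pairing (D (e i) (D (e a) (e b))) (e a) - pairing (D (br (e a) (e i)) (e b)) (e a)"
      unfolding curvature_def using ea[OF a] e by (simp add: pairing_diff_left)
    show "K (\<epsilon> a) * pairing (Rm (e a) (e i) (e b)) (e a) =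
        (\<Sum>c\<in>P. K (\<epsilon> a) * (K (\<epsilon> c * B i b c) * \<omega> a c a))
      - K (\<epsilon> a) * anchor (e i) (\<omega> a b a) + (\<Sum>c\<in>P. K (\<epsilon> a) * (K (\<epsilon> c * B i a c) * \<omega> a b c))
      - (\<Sum>c\<in>P. K (\<epsilon> a) * (K (\<epsilon> c * B a i c) * \<omega> c b a))
      - (\<Sum>j\<in>Q. K (\<epsilon> a) * K (\<epsilon> j * B a i j * B j b a))"
      unfolding h pairing_D_sum_right[OF a i b a] pairing_D_D[OF a i b] pairing_D_br[OF a i b]
        sum_distrib_left[symmetric]
      by (simp add: algebra_simps)
  qed
  also have "\<dots> = ?s1 - ?s2 + ?s3 - ?s4 - ?s5"
    by (simp only: sum.distrib sum_subtractf)
  finally have ric: "ric (e i) (e b) = ?s1 - ?s2 + ?s3 - ?s4 - ?s5" .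
  have s1: "?s1 = K (\<Sum>c\<in>P. \<epsilon> c * B i b c * d c)"
  proof -
    have "?s1 = (\<Sum>c\<in>P. \<Sum>a\<in>P. K (\<epsilon> a) * (K (\<epsilon> c * B i b c) * \<omega> a c a))" by (rule sum.swap)
    also have "\<dots> = (\<Sum>c\<in>P. K (\<epsilon> c * B i b c) * (\<Sum>a\<in>P. K (\<epsilon> a) * \<omega> a c a))"
      by (simp only: sum_distrib_left mult.left_commute)
    also have "\<dots> = (\<Sum>c\<in>P. K (\<epsilon> c * B i b c * d c))"
      by (intro sum.cong refl) (simp add: \<omega>_def div K_arith)
    finally show ?thesis by (simp only: K_sum)
  qed
  have s2: "?s2 = 0"
  proof -
    have "anchor (e i) (\<Sum>a\<in>P. K (\<epsilon> a) * \<omega> a b a) = (\<Sum>a\<in>P. anchor (e i) (K (\<epsilon> a) * \<omega> a b a))"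
      by (rule deriv_sum[OF anchor_V[OF e(1)]]) (intro R_mult K_R \<omega>_R in_I(1) bI)
    also have "\<dots> = ?s2"
    proof (rule sum.cong[OF refl])
      fix a assume a: "a \<in> P"
      show "anchor (e i) (K (\<epsilon> a) * \<omega> a b a) = K (\<epsilon> a) * anchor (e i) (\<omega> a b a)"
        unfolding anchor_deriv(2)[OF e(1) K_R \<omega>_R[OF in_I(1)[OF a] bI in_I(1)[OF a]]]
          anchor_deriv(3)[OF e(1)] by simp
    qed
    finally show ?thesis using div[OF b] anchor_deriv(3)[OF e(1)] by (simp add: \<omega>_def)
  qed
  have s4: "?s4 = ?s3"
  proof -
    have "?s4 = (\<Sum>c\<in>P. \<Sum>a\<in>P. K (\<epsilon> a) * (K (\<epsilon> c * B a i c) * \<omega> c b a))" by (rule sum.swap)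
    also have "\<dots> = ?s3"
    proof (intro sum.cong refl)
      fix c a assume c: "c \<in> P" and a: "a \<in> P"
      \<comment> \<open>the two summands agree once \<open>a\<close> and \<open>c\<close> have exchanged their roles\<close>
      have "B a i c = B i c a" using B_cyclic[OF in_I(1)[OF a] iI in_I(1)[OF c]] by simp
      then have "(K (\<epsilon> a) * K (\<epsilon> c * B a i c) :: 'a fn) = K (\<epsilon> c) * K (\<epsilon> a * B i c a)"
        by (simp add: K_arith mult_ac)
      then show "K (\<epsilon> a) * (K (\<epsilon> c * B a i c) * \<omega> c b a) = K (\<epsilon> c) * (K (\<epsilon> a * B i c a) * \<omega> c b a)"
        unfolding mult.assoc[symmetric] by simp
    qed
    finally show ?thesis .
  qed
  have s5: "?s5 = K (\<Sum>a\<in>P. \<Sum>j\<in>Q. \<epsilon> a * \<epsilon> j * B a i j * B j b a)"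
    by (simp only: K_sum K_arith mult.assoc)
  show ?thesis unfolding ric s1 s2 s4 s5 by (simp add: K_arith)
qed

end

section \<open>Constructing a Levi-Civita generalized connection\<close>

context invariant_frame
begin

lemma S_induct [consumes 1, case_names zero frame add scale]:
  assumes "u \<in> S" "\<Phi> 0" "\<And>A. A \<in> {0..2*n} \<Longrightarrow> \<Phi> (e A)"
    "\<And>u w. u \<in> S \<Longrightarrow> w \<in> S \<Longrightarrow> \<Phi> u \<Longrightarrow> \<Phi> w \<Longrightarrow> \<Phi> (u + w)"
    "\<And>f u. f \<in> R \<Longrightarrow> u \<in> S \<Longrightarrow> \<Phi> u \<Longrightarrow> \<Phi> (scale f u)"
  shows "\<Phi> u"
  using Sub_induct[of "{0..2*n}" u \<Phi>, unfolded Sub_UNIV, OF order_refl assms] .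

text \<open>Metric compatibility and vanishing torsion are both identities between tensors, so that it is
enough to know them on the frame.\<close>

lemma trilinear_eq_0I:
  fixes \<Phi> :: "'a sec \<Rightarrow> 'a sec \<Rightarrow> 'a sec \<Rightarrow> 'a fn"
  assumes add: "\<And>u u' w x. u \<in> S \<Longrightarrow> u' \<in> S \<Longrightarrow> w \<in> S \<Longrightarrow> x \<in> S \<Longrightarrow> \<Phi> (u + u') w x = \<Phi> u w x + \<Phi> u' w x"
    "\<And>u w w' x. u \<in> S \<Longrightarrow> w \<in> S \<Longrightarrow> w' \<in> S \<Longrightarrow> x \<in> S \<Longrightarrow> \<Phi> u (w + w') x = \<Phi> u w x + \<Phi> u w' x"
    "\<And>u w x x'. u \<in> S \<Longrightarrow> w \<in> S \<Longrightarrow> x \<in> S \<Longrightarrow> x' \<in> S \<Longrightarrow> \<Phi> u w (x + x') = \<Phi> u w x + \<Phi> u w x'"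
    and scale: "\<And>f u w x. f \<in> R \<Longrightarrow> u \<in> S \<Longrightarrow> w \<in> S \<Longrightarrow> x \<in> S \<Longrightarrow> \<Phi> (scale f u) w x = f * \<Phi> u w x"
    "\<And>f u w x. f \<in> R \<Longrightarrow> u \<in> S \<Longrightarrow> w \<in> S \<Longrightarrow> x \<in> S \<Longrightarrow> \<Phi> u (scale f w) x = f * \<Phi> u w x"
    "\<And>f u w x. f \<in> R \<Longrightarrow> u \<in> S \<Longrightarrow> w \<in> S \<Longrightarrow> x \<in> S \<Longrightarrow> \<Phi> u w (scale f x) = f * \<Phi> u w x"
    and frame: "\<And>A C E. A \<in> {0..2*n} \<Longrightarrow> C \<in> {0..2*n} \<Longrightarrow> E \<in> {0..2*n} \<Longrightarrow> \<Phi> (e A) (e C) (e E) = 0"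
    and S: "u \<in> S" "w \<in> S" "x \<in> S"
  shows "\<Phi> u w x = 0"
proof -
  have 1: "\<Phi> (e A) (e C) x = 0" if "A \<in> {0..2*n}" "C \<in> {0..2*n}" "x \<in> S" for A C x
    using that(3)
  proof (induction rule: S_induct)
    case zero show ?case using scale(3)[OF R_0 e_S[OF that(1)] e_S[OF that(2)] S_0] by simp
  next
    case (frame E) show ?case by (rule assms(7)[OF that(1,2) frame])
  next
    case (add y z) show ?case
      unfolding assms(3)[OF e_S[OF that(1)] e_S[OF that(2)] add(1,2)] add(3,4) by simp
  next
    case (scale f y) show ?case
      unfolding assms(6)[OF scale(1) e_S[OF that(1)] e_S[OF that(2)] scale(2)] scale(3) by simp
  qed
  have 2: "\<Phi> (e A) w x = 0" if "A \<in> {0..2*n}" "w \<in> S" "x \<in> S" for A w x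
    using that(2)
  proof (induction rule: S_induct)
    case zero show ?case using scale(2)[OF R_0 e_S[OF that(1)] S_0 that(3)] by simp
  next
    case (frame E) show ?case by (rule 1[OF that(1) frame that(3)])
  next
    case (add y z) show ?case
      unfolding assms(2)[OF e_S[OF that(1)] add(1,2) that(3)] add(3,4) by simp
  next
    case (scale f y) show ?case
      unfolding assms(5)[OF scale(1) e_S[OF that(1)] scale(2) that(3)] scale(3) by simp
  qed
  show ?thesis
    using S(1)
  proof (induction rule: S_induct)
    case zero show ?case using scale(1)[OF R_0 S_0 S(2,3)] by simp
  next
    case (frame E) show ?case by (rule 2[OF frame S(2,3)])
  next
    case (add y z) show ?case
      unfolding assms(1)[OF add(1,2) S(2,3)] add(3,4) by simp
  next
    case (scale f y) show ?case
      unfolding assms(4)[OF scale(1,2) S(2,3)] scale(3) by simp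
  qed
qed

lemma coeff_add: "u \<in> S \<Longrightarrow> w \<in> S \<Longrightarrow> A \<in> {0..2*n} \<Longrightarrow> coeff (u + w) A = coeff u A + coeff w A"
  unfolding coeff_def by (simp only: pairing_add_left e_S distrib_left)

lemma coeff_scale: "f \<in> R \<Longrightarrow> u \<in> S \<Longrightarrow> A \<in> {0..2*n} \<Longrightarrow> coeff (scale f u) A = f * coeff u A"
  unfolding coeff_def by (simp only: pairing_scale_left e_S mult.left_commute)

lemma coeff_e: "A \<in> {0..2*n} \<Longrightarrow> C \<in> {0..2*n} \<Longrightarrow> coeff (e C) A = (if A = C then 1 else 0)"
  unfolding coeff_def using \<epsilon>_square[of A] by (simp only: pairing_e) (auto simp: K_arith)

lemma S_expansion: "u \<in> S \<Longrightarrow> u = (\<Sum>A\<in>{0..2*n}. scale (coeff u A) (e A))"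
  using Sub_expansion[of "{0..2*n}" u] by (simp only: Sub_UNIV order_refl)

lemma anchor_sum: "anchor (\<Sum>i\<in>I. u i) f = (\<Sum>i\<in>I. anchor (u i) f)"
proof (induction I rule: infinite_finite_induct)
  case (insert i I)
  show ?case unfolding sum.insert[OF insert.hyps] anchor_add insert.IH ..
qed (simp_all add: anchor_def zero_fun_apply)

lemma anchor_frame: "u \<in> S \<Longrightarrow> anchor u f = (\<Sum>A\<in>{0..2*n}. coeff u A * anchor (e A) f)"
  by (subst S_expansion, assumption) (simp only: anchor_sum anchor_scale)

lemma divergence_of_eq:
  assumes "gen_connection G D" "u \<in> S"
  shows "divergence_of G D u = (\<Sum>A\<in>{0..2*n}. K (\<epsilon> A) * pairing (D (e A) u) (e A))"
proof -
  have "linear_on (Sub {0..2*n}) (\<lambda>w. D w u)"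
    unfolding linear_on_def Sub_UNIV using assms by (simp add: gen_connection_def)
  then show ?thesis
    unfolding divergence_of_def using trace_on_Sub[OF order_refl, of "\<lambda>w. D w u"] by (simp only: Sub_UNIV)
qed

text \<open>The connection with constant coefficients \<open>\<Gamma>\<close> in the frame: the derivative of the coefficients of
\<open>w\<close>, plus a part that is bilinear over functions.\<close>

definition constant_connection :: "(nat \<Rightarrow> nat \<Rightarrow> nat \<Rightarrow> real) \<Rightarrow> 'a sec \<Rightarrow> 'a sec \<Rightarrow> 'a sec" where
  "constant_connection \<Gamma> u w = (\<Sum>C\<in>{0..2*n}. scale (anchor u (coeff w C)) (e C) +
     (\<Sum>A\<in>{0..2*n}. scale (coeff u A * coeff w C)
        (\<Sum>E\<in>{0..2*n}. scale (K (\<epsilon> E * \<Gamma> A C E)) (e E))))"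

lemma constant_connection_rules:
  assumes D: "D = constant_connection \<Gamma>" and u: "u \<in> S" and w: "w \<in> S"
  shows "D u w \<in> S"
    and "u' \<in> S \<Longrightarrow> D (u + u') w = D u w + D u' w"
    and "f \<in> R \<Longrightarrow> D (scale f u) w = scale f (D u w)"
    and "w' \<in> S \<Longrightarrow> D u (w + w') = D u w + D u w'"
    and "f \<in> R \<Longrightarrow> D u (scale f w) = scale (anchor u f) w + scale f (D u w)"
proof -
  let ?I = "{0..2*n}"
  let ?N = "\<lambda>A C. \<Sum>E\<in>?I. scale (K (\<epsilon> E * \<Gamma> A C E)) (e E)"
  have N: "?N A C \<in> S" for A C by (intro S_sum S_scale K_R e_S)
  show "D u w \<in> S"
    unfolding D constant_connection_def
    by (intro S_sum S_add S_scale anchor_R R_mult coeff_R u w e_S K_R)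
  show "D (u + u') w = D u w + D u' w" if "u' \<in> S"
    unfolding D constant_connection_def sum.distrib[symmetric]
  proof (rule sum.cong[OF refl])
    fix C
    have "(\<Sum>A\<in>?I. scale (coeff (u + u') A * coeff w C) (?N A C)) =
        (\<Sum>A\<in>?I. scale (coeff u A * coeff w C) (?N A C) + scale (coeff u' A * coeff w C) (?N A C))"
      by (rule sum.cong[OF refl]) (simp only: coeff_add[OF u that] distrib_right scale_add_left)
    then show "scale (anchor (u + u') (coeff w C)) (e C) + (\<Sum>A\<in>?I. scale (coeff (u + u') A * coeff w C) (?N A C)) =
        scale (anchor u (coeff w C)) (e C) + (\<Sum>A\<in>?I. scale (coeff u A * coeff w C) (?N A C)) +
        (scale (anchor u' (coeff w C)) (e C) + (\<Sum>A\<in>?I. scale (coeff u' A * coeff w C) (?N A C)))"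
      by (simp only: anchor_add scale_add_left sum.distrib ac_simps)
  qed
  show "D (scale f u) w = scale f (D u w)" if "f \<in> R"
    unfolding D constant_connection_def scale_sum[of f]
  proof (rule sum.cong[OF refl])
    fix C
    have "(\<Sum>A\<in>?I. scale (coeff (scale f u) A * coeff w C) (?N A C)) =
        scale f (\<Sum>A\<in>?I. scale (coeff u A * coeff w C) (?N A C))"
      unfolding scale_sum[of f]
      by (rule sum.cong[OF refl]) (simp only: coeff_scale[OF that u] scale_scale mult.assoc)
    then show "scale (anchor (scale f u) (coeff w C)) (e C) + (\<Sum>A\<in>?I. scale (coeff (scale f u) A * coeff w C) (?N A C)) =
        scale f (scale (anchor u (coeff w C)) (e C) + (\<Sum>A\<in>?I. scale (coeff u A * coeff w C) (?N A C)))"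
      by (simp only: anchor_scale scale_add_right scale_scale)
  qed
  show "D u (w + w') = D u w + D u w'" if "w' \<in> S"
    unfolding D constant_connection_def sum.distrib[symmetric]
  proof (rule sum.cong[OF refl])
    fix C assume C: "C \<in> ?I"
    note R = coeff_R[OF w C] coeff_R[OF that C]
    show "scale (anchor u (coeff (w + w') C)) (e C) + (\<Sum>A\<in>?I. scale (coeff u A * coeff (w + w') C) (?N A C)) =
        scale (anchor u (coeff w C)) (e C) + (\<Sum>A\<in>?I. scale (coeff u A * coeff w C) (?N A C)) +
        (scale (anchor u (coeff w' C)) (e C) + (\<Sum>A\<in>?I. scale (coeff u A * coeff w' C) (?N A C)))"
      by (simp only: coeff_add[OF w that C] anchor_deriv(1)[OF u R] distrib_left scale_add_left sum.distrib ac_simps)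
  qed
  show "D u (scale f w) = scale (anchor u f) w + scale f (D u w)" if "f \<in> R"
  proof -
    have "D u (scale f w) = (\<Sum>C\<in>?I. scale (anchor u f * coeff w C) (e C) + scale f (scale (anchor u (coeff w C)) (e C) +
      (\<Sum>A\<in>?I. scale (coeff u A * coeff w C) (?N A C))))"
      unfolding D constant_connection_def
    proof (rule sum.cong[OF refl])
      fix C assume C: "C \<in> ?I"
      have "(\<Sum>A\<in>?I. scale (coeff u A * coeff (scale f w) C) (?N A C)) =
          scale f (\<Sum>A\<in>?I. scale (coeff u A * coeff w C) (?N A C))"
        unfolding scale_sum[of f]
        by (rule sum.cong[OF refl]) (simp only: coeff_scale[OF that w C] scale_scale mult.left_commute)
      then show "scale (anchor u (coeff (scale f w) C)) (e C) + (\<Sum>A\<in>?I. scale (coeff u A * coeff (scale f w) C) (?N A C)) =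
        scale (anchor u f * coeff w C) (e C) + scale f (scale (anchor u (coeff w C)) (e C) +
          (\<Sum>A\<in>?I. scale (coeff u A * coeff w C) (?N A C)))"
        by (simp only: coeff_scale[OF that w C] anchor_deriv(2)[OF u that coeff_R[OF w C]]
            scale_add_left scale_add_right scale_scale add.assoc)
    qed
    also have "\<dots> = (\<Sum>C\<in>?I. scale (anchor u f * coeff w C) (e C)) + scale f (D u w)"
      unfolding D constant_connection_def sum.distrib[of "\<lambda>C. scale (anchor u f * coeff w C) (e C)"]
        scale_sum[of f] ..
    also have "(\<Sum>C\<in>?I. scale (anchor u f * coeff w C) (e C)) = scale (anchor u f) w"
      by (subst (2) S_expansion[OF w]) (simp only: scale_sum scale_scale)
    finally show ?thesis .
  qed
qed

lemma constant_connection_e: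
  assumes D: "D = constant_connection \<Gamma>" and I: "A \<in> {0..2*n}" "C \<in> {0..2*n}"
  shows "D (e A) (e C) = (\<Sum>E\<in>{0..2*n}. scale (K (\<epsilon> E * \<Gamma> A C E)) (e E))"
    and "E \<in> {0..2*n} \<Longrightarrow> pairing (D (e A) (e C)) (e E) = K (\<Gamma> A C E)"
proof -
  let ?I = "{0..2*n}"
  let ?N = "\<lambda>A C. \<Sum>E\<in>?I. scale (K (\<epsilon> E * \<Gamma> A C E)) (e E)"
  have "D (e A) (e C) = (\<Sum>C'\<in>?I. if C' = C then ?N A C else 0)"
    unfolding D constant_connection_def
  proof (rule sum.cong[OF refl])
    fix C' assume C': "C' \<in> ?I"
    have "(\<Sum>A'\<in>?I. scale (coeff (e A) A' * coeff (e C) C') (?N A' C')) =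
        (\<Sum>A'\<in>?I. if A' = A then (if C' = C then ?N A C else 0) else 0)"
      by (rule sum.cong[OF refl]) (simp add: coeff_e[OF _ I(1)] coeff_e[OF C' I(2)] del: atLeastAtMost_iff)
    also have "\<dots> = (if C' = C then ?N A C else 0)"
      using I(1) by (simp only: sum.delta finite_atLeastAtMost if_True)
    finally have 1: "(\<Sum>A'\<in>?I. scale (coeff (e A) A' * coeff (e C) C') (?N A' C')) = (if C' = C then ?N A C else 0)" .
    have 2: "anchor (e A) (coeff (e C) C') = 0"
      unfolding coeff_e[OF C' I(2)] using anchor_deriv(4,5)[OF e_S[OF I(1)]] by simp
    show "scale (anchor (e A) (coeff (e C) C')) (e C') +
        (\<Sum>A'\<in>?I. scale (coeff (e A) A' * coeff (e C) C') (?N A' C')) = (if C' = C then ?N A C else 0)"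
      unfolding 1 2 by simp
  qed
  also have "\<dots> = ?N A C"
    using I(2) by (simp only: sum.delta finite_atLeastAtMost if_True)
  finally show 1: "D (e A) (e C) = ?N A C" .
  show "pairing (D (e A) (e C)) (e E) = K (\<Gamma> A C E)" if E: "E \<in> ?I"
  proof -
    have "pairing (?N A C) (e E) = (if E \<in> ?I then K (\<epsilon> E) * K (\<epsilon> E * \<Gamma> A C E) else 0)"
      by (rule pairing_frame_sum[OF order_refl K_R E])
    then show ?thesis unfolding 1 using E \<epsilon>_square[OF E]
      by (simp add: K_arith mult.assoc[symmetric] del: atLeastAtMost_iff)
  qed
qed

lemma constant_connection_gen:
  assumes D: "D = constant_connection \<Gamma>"
    and anti: "\<And>A C E. A \<in> {0..2*n} \<Longrightarrow> C \<in> {0..2*n} \<Longrightarrow> E \<in> {0..2*n} \<Longrightarrow> \<Gamma> A E C = - \<Gamma> A C E"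
  shows "gen_connection G D"
proof -
  note r = constant_connection_rules[OF D]
  have metric: "anchor u (pairing w x) - (pairing (D u w) x + pairing w (D u x)) = 0"
    if "u \<in> S" "w \<in> S" "x \<in> S" for u w x
  proof (rule trilinear_eq_0I[where \<Phi> = "\<lambda>u w x. anchor u (pairing w x) - (pairing (D u w) x + pairing w (D u x))", OF _ _ _ _ _ _ _ that])
    fix A C E assume I: "A \<in> {0..2*n}" "C \<in> {0..2*n}" "E \<in> {0..2*n}"
    have "anchor (e A) (pairing (e C) (e E)) = 0"
      unfolding pairing_e[OF I(2,3)] by (rule anchor_deriv(3)[OF e_S[OF I(1)]])
    moreover have "pairing (e C) (D (e A) (e E)) = K (\<Gamma> A E C)"
      unfolding pairing_commute[of "e C"] by (rule constant_connection_e(2)[OF D I(1,3,2)])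
    ultimately show "anchor (e A) (pairing (e C) (e E)) - (pairing (D (e A) (e C)) (e E) + pairing (e C) (D (e A) (e E))) = 0"
      using anti[OF I] by (simp add: constant_connection_e(2)[OF D I] K_arith)
  qed (simp_all add: r pairing_add_left pairing_add_right pairing_scale_left pairing_scale_right
      anchor_deriv anchor_add anchor_scale algebra_simps)
  then show ?thesis unfolding gen_connection_def using r by simp
qed

lemma constant_connection_torsion:
  assumes D: "D = constant_connection \<Gamma>"
    and tor: "\<And>A C E. A \<in> {0..2*n} \<Longrightarrow> C \<in> {0..2*n} \<Longrightarrow> E \<in> {0..2*n} \<Longrightarrow>
      \<Gamma> A C E - \<Gamma> C A E - B A C E + \<Gamma> E A C = 0"
    and S: "u \<in> S" "w \<in> S" "x \<in> S"
  shows "torsion G H F D u w x = 0"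
proof (rule trilinear_eq_0I[where \<Phi> = "torsion G H F D", OF _ _ _ _ _ _ _ S])
  note r = constant_connection_rules[OF D]
  note rules = r br_add_left br_add_right pairing_add_left pairing_add_right pairing_diff_left
  show "torsion G H F D (u + u') w x = torsion G H F D u w x + torsion G H F D u' w x"
    if "u \<in> S" "u' \<in> S" "w \<in> S" "x \<in> S" for u u' w x
    unfolding torsion_def using that by (simp add: rules algebra_simps)
  show "torsion G H F D u (w + w') x = torsion G H F D u w x + torsion G H F D u w' x"
    if "u \<in> S" "w \<in> S" "w' \<in> S" "x \<in> S" for u w w' x
    unfolding torsion_def using that by (simp add: rules algebra_simps)
  show "torsion G H F D u w (x + x') = torsion G H F D u w x + torsion G H F D u w x'"
    if "u \<in> S" "w \<in> S" "x \<in> S" "x' \<in> S" for u w x x'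
    unfolding torsion_def using that by (simp add: rules algebra_simps)
  show "torsion G H F D (scale f u) w x = f * torsion G H F D u w x"
    if f: "f \<in> R" and m: "u \<in> S" "w \<in> S" "x \<in> S" for f u w x
  proof -
    have two: "2 * pairing u w \<in> R"
      unfolding mult_2 using m by (intro R_add pairing_R)
    have g: "2 * pairing (grad f) x = anchor x f"
      unfolding pairing_grad[OF f m(3)] K_half ..
    show ?thesis
      unfolding torsion_def br_scale_left[OF m(1,2) f] using f m two
      by (simp add: r pairing_add_left pairing_add_right pairing_diff_left pairing_scale_left
          pairing_scale_right g grad_S pairing_commute[of w u] algebra_simps)
  qed
  show "torsion G H F D u (scale f w) x = f * torsion G H F D u w x"
    if f: "f \<in> R" and m: "u \<in> S" "w \<in> S" "x \<in> S" for f u w x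
    unfolding torsion_def br_scale_right[OF m(1,2) f] using f m
    by (simp add: r pairing_add_left pairing_add_right pairing_diff_left pairing_scale_left
        pairing_scale_right algebra_simps)
  show "torsion G H F D u w (scale f x) = f * torsion G H F D u w x"
    if f: "f \<in> R" and m: "u \<in> S" "w \<in> S" "x \<in> S" for f u w x
    unfolding torsion_def using f m
    by (simp add: r pairing_scale_right algebra_simps)
  show "torsion G H F D (e A) (e C) (e E) = 0"
    if I: "A \<in> {0..2*n}" "C \<in> {0..2*n}" "E \<in> {0..2*n}" for A C E
  proof -
    note m = e_S[OF I(1)] e_S[OF I(2)] e_S[OF I(3)]
    have "pairing (D (e A) (e C) - D (e C) (e A) - br (e A) (e C)) (e E) + pairing (e C) (D (e E) (e A)) =
        K (\<Gamma> A C E) - K (\<Gamma> C A E) - K (B A C E) + K (\<Gamma> E A C)"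
      unfolding pairing_diff_left[OF S_diff[OF r(1)[OF m(1,2)] r(1)[OF m(2,1)]] br_S[OF m(1,2)] m(3)]
        pairing_diff_left[OF r(1)[OF m(1,2)] r(1)[OF m(2,1)] m(3)] pairing_commute[of "e C"]
        constant_connection_e(2)[OF D I] constant_connection_e(2)[OF D I(2,1,3)]
        constant_connection_e(2)[OF D I(3,1,2)] pairing_br_e_const[OF I] ..
    then show ?thesis unfolding torsion_def using tor[OF I] by (simp add: K_arith)
  qed
qed

lemma constant_connection_preserves:
  assumes D: "D = constant_connection \<Gamma>" and P: "P \<subseteq> {0..2*n}"
    and block: "\<And>A C E. A \<in> {0..2*n} \<Longrightarrow> C \<in> P \<Longrightarrow> E \<in> {0..2*n} - P \<Longrightarrow> \<Gamma> A C E = 0"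
    and u: "u \<in> S" and w: "w \<in> Sub P"
  shows "D u w \<in> Sub P"
proof (rule Sub_induct[OF P w])
  note r = constant_connection_rules[OF D]
  have 0: "D u 0 = 0" using r(4)[OF u S_0 S_0] by simp
  show "D u 0 \<in> Sub P" unfolding 0 by (rule Sub_0)
  show "D u (e C) \<in> Sub P" if C: "C \<in> P" for C
    using u
  proof (induction rule: S_induct)
    have CI: "C \<in> {0..2*n}" using C P by blast
    note eC = e_S[OF CI]
    case zero
    have "D 0 (e C) = 0" using r(2)[OF S_0 eC S_0] by simp
    then show ?case by (simp add: Sub_0)
  next
    have CI: "C \<in> {0..2*n}" using C P by blast
    note eC = e_S[OF CI]
    case (frame A)
    have "pairing (D (e A) (e C)) (e E) = 0" if "E \<in> {0..2*n} - P" for E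
      using constant_connection_e(2)[OF D frame CI, of E] block[OF frame C that] that by (simp add: K_arith)
    then show ?case unfolding Sub_def using r(1)[OF e_S[OF frame] eC] by blast
  next
    have CI: "C \<in> {0..2*n}" using C P by blast
    note eC = e_S[OF CI]
    case (add y z)
    show ?case unfolding r(2)[OF add(1) eC add(2)] by (rule Sub_add[OF add(3,4)])
  next
    have CI: "C \<in> {0..2*n}" using C P by blast
    note eC = e_S[OF CI]
    case (scale f y)
    show ?case unfolding r(3)[OF scale(2) eC scale(1)] by (rule Sub_scale[OF scale(1,3)])
  qed
  show "D u (y + z) \<in> Sub P" if "y \<in> Sub P" "z \<in> Sub P" "D u y \<in> Sub P" "D u z \<in> Sub P" for y z
    unfolding r(4)[OF u Sub_S[OF that(1)] Sub_S[OF that(2)]] by (rule Sub_add[OF that(3,4)])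
  show "D u (scale f y) \<in> Sub P" if "f \<in> R" "y \<in> Sub P" "D u y \<in> Sub P" for f y
    unfolding r(5)[OF u Sub_S[OF that(2)] that(1)]
    by (rule Sub_add[OF Sub_scale[OF anchor_R[OF u] that(2)] Sub_scale[OF that(1,3)]])
qed

lemma divergence_of_scale:
  assumes D: "gen_connection G D" and f: "f \<in> R" and u: "u \<in> S"
  shows "divergence_of G D (scale f u) = anchor u f + f * divergence_of G D u"
proof -
  have DS: "D (e A) u \<in> S" if "A \<in> {0..2*n}" for A
    using D u e_S[OF that] by (simp add: gen_connection_def)
  have "K (\<epsilon> A) * pairing (D (e A) (scale f u)) (e A) =
      coeff u A * anchor (e A) f + f * (K (\<epsilon> A) * pairing (D (e A) u) (e A))" if A: "A \<in> {0..2*n}" for A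
  proof -
    note eA = e_S[OF A]
    have "D (e A) (scale f u) = scale (anchor (e A) f) u + scale f (D (e A) u)"
      using D f u eA by (simp add: gen_connection_def)
    then have "pairing (D (e A) (scale f u)) (e A) = anchor (e A) f * pairing u (e A) + f * pairing (D (e A) u) (e A)"
      using f u eA DS[OF A] by (simp add: pairing_add_left pairing_scale_left)
    then show ?thesis by (simp add: coeff_def algebra_simps)
  qed
  then show ?thesis
    unfolding divergence_of_eq[OF D u] divergence_of_eq[OF D S_scale[OF f u]] anchor_frame[OF u]
    by (simp add: sum.distrib sum_distrib_left del: atLeastAtMost_iff)
qed

lemma divergence_of_add:
  assumes D: "gen_connection G D" and u: "u \<in> S" and w: "w \<in> S"
  shows "divergence_of G D (u + w) = divergence_of G D u + divergence_of G D w"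
proof -
  have "K (\<epsilon> A) * pairing (D (e A) (u + w)) (e A) =
      K (\<epsilon> A) * pairing (D (e A) u) (e A) + K (\<epsilon> A) * pairing (D (e A) w) (e A)" if A: "A \<in> {0..2*n}" for A
  proof -
    note eA = e_S[OF A]
    have "D (e A) (u + w) = D (e A) u + D (e A) w" "D (e A) u \<in> S" "D (e A) w \<in> S"
      using D u w eA by (simp_all add: gen_connection_def)
    then show ?thesis using eA by (simp add: pairing_add_left distrib_left)
  qed
  then show ?thesis
    unfolding divergence_of_eq[OF D u] divergence_of_eq[OF D w] divergence_of_eq[OF D S_add[OF u w]]
    by (simp add: sum.distrib del: atLeastAtMost_iff)
qed

text \<open>Both sides satisfy the same Leibniz rule, so that they can be compared on the frame.\<close>

lemma divergence_of_eqI: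
  assumes D: "gen_connection G D" and \<delta>: "divergence_operator G \<delta>"
    and frame: "\<And>A. A \<in> {0..2*n} \<Longrightarrow> divergence_of G D (e A) = \<delta> (e A)" and u: "u \<in> S"
  shows "divergence_of G D u = \<delta> u"
  using u
proof (induction rule: S_induct)
  case zero
  have "divergence_of G D 0 = 0" using divergence_of_scale[OF D R_0 S_0] anchor_deriv(4)[OF S_0] by simp
  moreover have "\<delta> (0 + 0) = \<delta> 0 + \<delta> 0" using \<delta> S_0 unfolding divergence_operator_def by blast
  ultimately show ?case by simp
next
  case (frame A) show ?case by (rule assms(3)[OF frame])
next
  case (add y z)
  have "\<delta> (y + z) = \<delta> y + \<delta> z" using \<delta> add(1,2) unfolding divergence_operator_def by blast
  then show ?case using divergence_of_add[OF D add(1,2)] add(3,4) by simp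
next
  case (scale f y)
  have "\<delta> (scale f y) = anchor y f + f * \<delta> y" using \<delta> scale(1,2) unfolding divergence_operator_def by blast
  then show ?case using divergence_of_scale[OF D scale(1,2)] scale(3) by simp
qed

end

section \<open>The Einstein equations in the frame\<close>

locale invariant_divergence = invariant_frame G n v H F g
  for G :: "('a::{t2_space, second_countable_topology}, 'e::euclidean_space) lie_group"
    and n v H F g +
  fixes \<delta> :: "'a sec \<Rightarrow> 'a fn"
  assumes \<delta>: "left_inv_divergence G \<delta>" and n_ge_2: "n \<ge> 2"
begin

text \<open>Invariance of \<open>g\<close> applies to vector fields only; all other arguments have to be seen to stay
outside the vector fields under translation.\<close>

lemma lt_form1_g:
  assumes "X \<in> left_inv_vfields G" shows "lt_form1 G x (g X) = g X"
proof
  fix Z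
  show "lt_form1 G x (g X) Z = g X Z"
  proof (cases "Z \<in> V")
    case True
    \<comment> \<open>invariance, applied to \<open>X\<close> and the back-translated \<open>Z\<close>\<close>
    have "g (lt_vf G x X) (lt_vf G x (lt_vf G (inv\<^bsub>G\<^esub> x) Z)) = lt_fn G x (g X (lt_vf G (inv\<^bsub>G\<^esub> x) Z))"
      using g_inv left_inv_V[OF assms] lt_vf_V[OF True] unfolding left_inv2_def by blast
    then show ?thesis unfolding lt_form1_def left_inv_lt[OF assms] lt_vf_cancel ..
  next
    case False
    then have nV: "lt_vf G (inv\<^bsub>G\<^esub> x) Z \<notin> V" by (simp add: lt_vf_V_iff)
    show ?thesis
      unfolding lt_form1_def O1D(1)[OF g_O1[OF left_inv_V[OF assms]] nV]
        O1D(1)[OF g_O1[OF left_inv_V[OF assms]] False] by (rule lt_fn_arith(4))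
  qed
qed

lemma lt_sec_e:
  assumes "A \<in> {0..2*n}" shows "lt_sec G x (e A) = e A"
  using assms
proof (cases rule: index_cases)
  case 1
  have "lt_vf G x 0 = 0" by (rule left_inv_lt[OF left_inv_0])
  moreover have "lt_form1 G x 0 = 0" by (rule ext) (simp add: lt_form1_def zero_fun_apply lt_fn_arith)
  moreover have "lt_fn G x 1 = 1" by (rule ext) (simp add: lt_fn_def one_fun_apply)
  ultimately show ?thesis by (simp only: 1 e_simps lt_sec_def prod.case)
next
  case (2 a)
  show ?thesis
    unfolding 2(2) e_simps(2)[OF 2(1)] lt_sec_def prod.case
      left_inv_lt[OF v_left_inv[OF 2(1)]] lt_form1_g[OF v_left_inv[OF 2(1)]] lt_fn_arith ..
next
  case (3 a)
  have "lt_form1 G x (- g (v a)) = - lt_form1 G x (g (v a))"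
    by (intro ext) (simp add: lt_form1_def uminus_apply lt_fn_def)
  then show ?thesis
    unfolding 3(2) e_simps(3)[OF 3(1)] lt_sec_def prod.case
      left_inv_lt[OF v_left_inv[OF 3(1)]] lt_form1_g[OF v_left_inv[OF 3(1)]] lt_fn_arith by simp
qed

abbreviation d where "d A \<equiv> \<delta> (e A) \<one>\<^bsub>G\<^esub>"

lemma \<delta>_e: assumes "A \<in> {0..2*n}" shows "\<delta> (e A) = K (d A)"
proof (rule invariant_fn_const)
  fix x
  have "\<delta> (lt_sec G x (e A)) = lt_fn G x (\<delta> (e A))"
    using \<delta> e_S[OF assms] unfolding left_inv_divergence_def by blast
  then show "lt_fn G x (\<delta> (e A)) = \<delta> (e A)" unfolding lt_sec_e[OF assms] ..
qed

text \<open>The first two cases are forced. For three indices of the same half, a third of \<open>B\<close> has the right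
torsion, and any tensor can be added that is antisymmetric in the last two indices and whose cyclic sum
vanishes. The multiples of \<open>\<langle>e A, e E\<rangle> d C - \<langle>e A, e C\<rangle> d E\<close> are such tensors. The trace of
this tensor over a half of rank \<open>r\<close> is \<open>(r - 1) d C\<close>; the rank is \<open>n + 1\<close> for the plus half and \<open>n\<close> for the minus half, whence the denominators.\<close>

definition LC_coeff :: "nat \<Rightarrow> nat \<Rightarrow> nat \<Rightarrow> real" where
  "LC_coeff A C E = (if (C \<le> n) \<noteq> (E \<le> n) then 0
     else if (A \<le> n) \<noteq> (C \<le> n) then B A C E
     else B A C E / 3 + (if A = E then \<epsilon> A * d C else 0) / (if C \<le> n then real n else real n - 1)
       - (if A = C then \<epsilon> A * d E else 0) / (if C \<le> n then real n else real n - 1))"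

lemma LC_coeff_antisym:
  assumes "A \<in> {0..2*n}" "C \<in> {0..2*n}" "E \<in> {0..2*n}"
  shows "LC_coeff A E C = - LC_coeff A C E"
  using B_antisym(2)[OF assms] by (auto simp: LC_coeff_def)

lemma LC_coeff_torsion:
  assumes "A \<in> {0..2*n}" "C \<in> {0..2*n}" "E \<in> {0..2*n}"
  shows "LC_coeff A C E - LC_coeff C A E - B A C E + LC_coeff E A C = 0"
proof -
  define x where "x = B A C E"
  have b: "B C A E = - x" "B E A C = x"
    using B_antisym(1)[OF assms] B_cyclic[OF assms(3,1,2)] by (simp_all add: x_def)
  have t: "(if C = A then \<epsilon> C * y else 0) = (if A = C then \<epsilon> A * y else 0)"
    "(if E = A then \<epsilon> E * y else 0) = (if A = E then \<epsilon> A * y else 0)"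
    "(if E = C then \<epsilon> E * y else 0) = (if C = E then \<epsilon> C * y else 0)" for y
    by auto
  show ?thesis
    unfolding LC_coeff_def t b x_def[symmetric]
    by (cases "A \<le> n"; cases "C \<le> n"; cases "E \<le> n") simp_all
qed

lemma LC_coeff_trace:
  assumes C: "C \<in> {0..2*n}" shows "(\<Sum>A\<in>{0..2*n}. \<epsilon> A * LC_coeff A C A) = d C"
proof -
  define P where "P = (if C \<le> n then {0..n} else {n+1..2*n})"
  define \<kappa> where "\<kappa> = (if C \<le> n then real n else real n - 1)"
  have P: "P \<subseteq> {0..2*n}" "finite P" "C \<in> P" "real (card P) = \<kappa> + 1" "\<kappa> \<noteq> 0"
    using C n_ge_2 by (auto simp: P_def \<kappa>_def)
  have side: "A \<in> P \<longleftrightarrow> (A \<le> n) = (C \<le> n)" if "A \<in> {0..2*n}" for A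
    using that by (auto simp: P_def)
  have "(\<Sum>A\<in>{0..2*n}. \<epsilon> A * LC_coeff A C A) = (\<Sum>A\<in>P. \<epsilon> A * LC_coeff A C A)"
  proof (rule sum.mono_neutral_right[OF _ P(1)])
    show "\<forall>A\<in>{0..2*n} - P. \<epsilon> A * LC_coeff A C A = 0"
      using side by (auto simp: LC_coeff_def)
  qed simp
  also have "\<dots> = (\<Sum>A\<in>P. d C / \<kappa> - (if A = C then d C / \<kappa> else 0))"
  proof (rule sum.cong[OF refl])
    fix A assume A: "A \<in> P"
    then have AI: "A \<in> {0..2*n}" using P by blast
    have "B A C A = 0" using B_antisym(2)[OF AI AI C] B_antisym(1)[OF AI AI C] B_cyclic[OF AI AI C] by simp
    moreover have "(A \<le> n) = (C \<le> n)" using side[OF AI] A by blast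
    ultimately have "LC_coeff A C A = \<epsilon> A * d C / \<kappa> - (if A = C then \<epsilon> A * d A / \<kappa> else 0)"
      by (auto simp: LC_coeff_def \<kappa>_def)
    moreover have "\<epsilon> A * (\<epsilon> A * y / \<kappa>) = y / \<kappa>" for y
      using \<epsilon>_square[OF AI] by (simp add: mult.assoc[symmetric])
    ultimately show "\<epsilon> A * LC_coeff A C A = d C / \<kappa> - (if A = C then d C / \<kappa> else 0)"
      by (auto simp: right_diff_distrib)
  qed
  also have "\<dots> = (\<kappa> + 1) * (d C / \<kappa>) - d C / \<kappa>"
    using P by (simp add: sum_subtractf)
  also have "\<dots> = d C" using P(5) by (simp add: field_simps)
  finally show ?thesis .
qed

lemma ex_levi_civita:
  obtains D where "levi_civita G H F g D" "\<forall>u\<in>S. divergence_of G D u = \<delta> u"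
proof -
  define D where "D = constant_connection LC_coeff"
  have conn: "gen_connection G D"
    by (rule constant_connection_gen[OF D_def]) (rule LC_coeff_antisym)
  have "torsion G H F D u w x = 0" if "u \<in> S" "w \<in> S" "x \<in> S" for u w x
    by (rule constant_connection_torsion[OF D_def LC_coeff_torsion that])
  moreover have "D u w \<in> E_minus G g" if "u \<in> S" "w \<in> E_minus G g" for u w
    unfolding E_minus_eq
    by (rule constant_connection_preserves[OF D_def _ _ that(1)])
      (use that(2) in \<open>auto simp: LC_coeff_def E_minus_eq\<close>)
  ultimately have "levi_civita G H F g D" unfolding levi_civita_def using conn by blast
  moreover have "divergence_of G D u = \<delta> u" if "u \<in> S" for u
  proof (rule divergence_of_eqI[OF conn _ _ that])
    show "divergence_operator G \<delta>" using \<delta> by (simp add: left_inv_divergence_def)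
    fix A assume A: "A \<in> {0..2*n}"
    have "divergence_of G D (e A) = (\<Sum>C\<in>{0..2*n}. K (\<epsilon> C * LC_coeff C A C))"
      unfolding divergence_of_eq[OF conn e_S[OF A]]
      by (rule sum.cong[OF refl]) (simp only: constant_connection_e(2)[OF D_def _ A] K_arith)
    then show "divergence_of G D (e A) = \<delta> (e A)"
      unfolding K_sum LC_coeff_trace[OF A] \<delta>_e[OF A, symmetric] .
  qed
  ultimately show ?thesis using that by blast
qed

text \<open>A metric connection that preserves \<open>E_-\<close> preserves its orthogonal complement. The divergence of a
section of one half is a trace over that half, because the other half contributes off-diagonal terms
only.\<close>

lemma levi_civita_splits:
  assumes D: "levi_civita G H F g D" and div: "\<forall>u\<in>S. divergence_of G D u = \<delta> u"
  shows "split_connection G n v H F g D {0..n} {n+1..2*n} d"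
    and "split_connection G n v H F g D {n+1..2*n} {0..n} d"
proof -
  have tor: "torsion G H F D u w x = 0" if "u \<in> S" "w \<in> S" "x \<in> S" for u w x
    using D that unfolding levi_civita_def by blast
  have conn: "gen_connection G D" using D unfolding levi_civita_def by blast
  have minus: "D u w \<in> Sub {n+1..2*n}" if "u \<in> S" "w \<in> Sub {n+1..2*n}" for u w
    using D that unfolding levi_civita_def E_minus_eq by blast
  have DS: "D u w \<in> S" if "u \<in> S" "w \<in> S" for u w using conn that by (simp add: gen_connection_def)
  have plus: "D u w \<in> Sub {0..n}" if u: "u \<in> S" and w: "w \<in> Sub {0..n}" for u w
  proof -
    have "pairing (D u w) (e A) = 0" if A: "A \<in> {0..2*n} - {0..n}" for A
    proof -
      have AI: "A \<in> {0..2*n}" and AM: "A \<in> {n+1..2*n}" using A by auto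
      have eA: "e A \<in> Sub {n+1..2*n}" by (rule e_Sub[OF AM]) auto
      have "anchor u (pairing w (e A)) = pairing (D u w) (e A) + pairing w (D u (e A))"
        using conn u Sub_S[OF w] e_S[OF AI] unfolding gen_connection_def by blast
      moreover have "pairing w (e A) = 0" by (rule Sub_orthogonal[OF w eA]) auto
      moreover have "pairing w (D u (e A)) = 0" by (rule Sub_orthogonal[OF w minus[OF u eA]]) auto
      ultimately show ?thesis using anchor_deriv(4)[OF u] by simp
    qed
    then show ?thesis unfolding Sub_def using DS[OF u Sub_S[OF w]] by blast
  qed
  have tr: "(\<Sum>a\<in>P. K (\<epsilon> a) * pairing (D (e a) (e b)) (e a)) = K (d b)"
    if P: "P \<subseteq> {0..2*n}" and pres: "\<And>u w. u \<in> S \<Longrightarrow> w \<in> Sub P \<Longrightarrow> D u w \<in> Sub P" and b: "b \<in> P" for P b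
  proof -
    have bI: "b \<in> {0..2*n}" using P b by blast
    have "(\<Sum>a\<in>P. K (\<epsilon> a) * pairing (D (e a) (e b)) (e a)) =
        (\<Sum>a\<in>{0..2*n}. K (\<epsilon> a) * pairing (D (e a) (e b)) (e a))"
    proof (rule sum.mono_neutral_left[OF _ P])
      show "\<forall>a\<in>{0..2*n} - P. K (\<epsilon> a) * pairing (D (e a) (e b)) (e a) = 0"
      proof
        fix a assume a: "a \<in> {0..2*n} - P"
        then have "e a \<in> S" by blast
        from pres[OF this e_Sub[OF b P]] a show "K (\<epsilon> a) * pairing (D (e a) (e b)) (e a) = 0"
          by (simp add: Sub_def)
      qed
    qed simp
    also have "\<dots> = divergence_of G D (e b)" by (rule divergence_of_eq[OF conn e_S[OF bI], symmetric])
    also have "\<dots> = K (d b)" unfolding bspec[OF div e_S[OF bI]] by (rule \<delta>_e[OF bI])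
    finally show ?thesis .
  qed
  have PQ: "{0..n} \<union> {n+1..2*n} = {0..2*n}" "{n+1..2*n} \<union> {0..n} = {0..2*n}"
    "{0..n} \<inter> {n+1..2*n} = {}" "{n+1..2*n} \<inter> {0..n} = {}" "{0..n} \<subseteq> {0..2*n}" "{n+1..2*n} \<subseteq> {0..2*n}"
    by auto
  show "split_connection G n v H F g D {0..n} {n+1..2*n} d"
    by unfold_locales (rule conn tor PQ plus minus tr[OF PQ(5) plus] | assumption)+
  show "split_connection G n v H F g D {n+1..2*n} {0..n} d"
    by unfold_locales (rule conn tor PQ plus minus tr[OF PQ(6) minus] | assumption)+
qed

text \<open>Up to sign, the part of the Ricci tensors that is quadratic in the structure constants. It is the
same for both of them.\<close>

definition ric_sum :: "nat \<Rightarrow> nat \<Rightarrow> real" where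
  "ric_sum i b = (\<Sum>a\<in>{0..n}. \<Sum>j\<in>{n+1..2*n}. \<epsilon> a * \<epsilon> j * B a i j * B j b a)"

text \<open>The connection in the definition is arbitrary, but the Ricci tensors computed from it involve only
\<open>B\<close> and \<open>\<delta>\<close>. Exchanging the order of summation identifies their quadratic parts.\<close>

lemma einstein_iff:
  "odd_generalized_einstein G H F g \<delta> \<longleftrightarrow> (\<forall>i\<in>{n+1..2*n}. \<forall>b\<in>{0..n}.
     (\<Sum>c\<in>{0..n}. \<epsilon> c * B i b c * d c) = ric_sum i b \<and>
     (\<Sum>j\<in>{n+1..2*n}. \<epsilon> j * B b i j * d j) = ric_sum i b)" (is "_ \<longleftrightarrow> ?R")
proof -
  have *: "(\<forall>u\<in>E_minus G g. \<forall>v\<in>E_plus G g. Ric_plus G H F g D u v = 0) \<and>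
     (\<forall>u\<in>E_plus G g. \<forall>v\<in>E_minus G g. Ric_minus G H F g D u v = 0) \<longleftrightarrow> ?R"
    if D: "levi_civita G H F g D" and div: "\<forall>u\<in>S. divergence_of G D u = \<delta> u" for D
  proof -
    interpret p: split_connection G n v H F g D "{0..n}" "{n+1..2*n}" d
      by (rule levi_civita_splits(1)[OF D div])
    interpret m: split_connection G n v H F g D "{n+1..2*n}" "{0..n}" d
      by (rule levi_civita_splits(2)[OF D div])
    have swap: "(\<Sum>a\<in>{n+1..2*n}. \<Sum>j\<in>{0..n}. \<epsilon> a * \<epsilon> j * B a b j * B j i a) = ric_sum i b" for i b
      unfolding ric_sum_def by (subst sum.swap) (simp only: mult_ac)
    have P: "p.ric (e i) (e b) = 0 \<longleftrightarrow> (\<Sum>c\<in>{0..n}. \<epsilon> c * B i b c * d c) = ric_sum i b"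
      if "i \<in> {n+1..2*n}" "b \<in> {0..n}" for i b
      unfolding p.ric_e[OF that] ric_sum_def by simp
    have M: "m.ric (e b) (e i) = 0 \<longleftrightarrow> (\<Sum>j\<in>{n+1..2*n}. \<epsilon> j * B b i j * d j) = ric_sum i b"
      if "i \<in> {n+1..2*n}" "b \<in> {0..n}" for i b
      unfolding m.ric_e[OF that(2,1)] swap by simp
    have rp: "Ric_plus G H F g D u w = p.ric u w" "Ric_minus G H F g D u w = m.ric u w" for u w
      unfolding Ric_plus_def Ric_minus_def p.ric_def m.ric_def E_plus_eq E_minus_eq by (rule refl)+
    show ?thesis
      unfolding rp E_plus_eq E_minus_eq p.ric_vanishes_iff m.ric_vanishes_iff using P M by blast
  qed
  show ?thesis
  proof
    assume "odd_generalized_einstein G H F g \<delta>"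
    then show ?R unfolding odd_generalized_einstein_def using * by blast
  next
    assume R: ?R
    obtain D where D: "levi_civita G H F g D" "\<forall>u\<in>S. divergence_of G D u = \<delta> u" by (rule ex_levi_civita)
    show "odd_generalized_einstein G H F g \<delta>"
      unfolding odd_generalized_einstein_def using D *[OF D] R by blast
  qed
qed

abbreviation f where "f a c \<equiv> F (v a) (v c) \<one>\<^bsub>G\<^esub>"

lemma f_antisym: "a \<in> {1..n} \<Longrightarrow> c \<in> {1..n} \<Longrightarrow> f a c = - f c a"
  using O2D(2)[OF F_form v_V v_V, of a c] by (simp add: uminus_apply)

lemma sum_plus: "(\<Sum>c\<in>{0..n}. h c) = h 0 + (\<Sum>c=1..n. h c)" for h :: "nat \<Rightarrow> real"
  by (simp add: sum.atLeast_Suc_atMost One_nat_def)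

lemma sum_minus: "(\<Sum>j=n+1..2*n. h j) = (\<Sum>b=1..n. h (n + b))" for h :: "nat \<Rightarrow> real"
  using sum.shift_bounds_cl_nat_ivl[of h 1 n n] by (simp add: add.commute mult_2)

lemma ric_sums:
  assumes i: "i \<in> {1..n}"
  shows "a \<in> {1..n} \<Longrightarrow> (\<Sum>c\<in>{0..n}. \<epsilon> c * B (n + i) a c * d c) =
      f i a * d 0 + (\<Sum>b=1..n. \<epsilon> b * B (n + i) a b * d b)"
    and "(\<Sum>c\<in>{0..n}. \<epsilon> c * B (n + i) 0 c * d c) = - (\<Sum>b=1..n. \<epsilon> b * f i b * d b)"
    and "a \<in> {1..n} \<Longrightarrow> (\<Sum>j\<in>{n+1..2*n}. \<epsilon> j * B a (n + i) j * d j) =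
      (\<Sum>b=1..n. \<epsilon> b * B (n + i) a (n + b) * d (n + b))"
    and "(\<Sum>j\<in>{n+1..2*n}. \<epsilon> j * B 0 (n + i) j * d j) = - (\<Sum>b=1..n. \<epsilon> b * f i b * d (n + b))"
    and "a \<in> {1..n} \<Longrightarrow> ric_sum (n + i) a = (\<Sum>b=1..n. \<epsilon> b * f i b * f a b)
      - (\<Sum>b=1..n. \<Sum>j=n+1..2*n. \<epsilon> b * \<epsilon> j * B b (n + i) j * B a j b)"
    and "ric_sum (n + i) 0 = (\<Sum>b=1..n. \<Sum>j=n+1..2*n. \<epsilon> b * \<epsilon> (j - n) * f (j - n) b * B b (n + i) j)"
proof -
  have I: "c \<in> {0..2*n}" "n + c \<in> {0..2*n}" if "c \<in> {1..n}" for c using that by auto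
  have I0: "0 \<in> {0..2*n}" by simp
  note iI = I(2)[OF i]
  have B00: "B A 0 0 = 0" if "A \<in> {0..2*n}" for A using B_antisym(2)[OF that I0 I0] by simp
  have Bi0: "B (n + i) 0 b = - f i b" if "b \<in> {1..n}" for b
    using B_antisym(2)[OF iI I(1)[OF that] I0] B_0(2)[OF i that] by simp
  have B0i: "B 0 (n + i) (n + b) = f i b" if "b \<in> {1..n}" for b
    using B_cyclic[OF I0 iI I(2)[OF that]] B_0(3)[OF i that] by simp
  show "(\<Sum>c\<in>{0..n}. \<epsilon> c * B (n + i) a c * d c) = f i a * d 0 + (\<Sum>b=1..n. \<epsilon> b * B (n + i) a b * d b)"
    if a: "a \<in> {1..n}"
    unfolding sum_plus by (simp add: \<epsilon>_simps B_0(2)[OF i a])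
  show "(\<Sum>c\<in>{0..n}. \<epsilon> c * B (n + i) 0 c * d c) = - (\<Sum>b=1..n. \<epsilon> b * f i b * d b)"
  proof -
    have "(\<Sum>c=1..n. \<epsilon> c * B (n + i) 0 c * d c) = (\<Sum>b=1..n. - (\<epsilon> b * f i b * d b))"
      by (rule sum.cong[OF refl]) (simp add: Bi0 del: atLeastAtMost_iff)
    then show ?thesis unfolding sum_plus sum_negf B00[OF iI] by simp
  qed
  show "(\<Sum>j\<in>{n+1..2*n}. \<epsilon> j * B a (n + i) j * d j) = (\<Sum>b=1..n. \<epsilon> b * B (n + i) a (n + b) * d (n + b))"
    if a: "a \<in> {1..n}"
    unfolding sum_minus
  proof (rule sum.cong[OF refl])
    fix b assume b: "b \<in> {1..n}"
    show "\<epsilon> (n + b) * B a (n + i) (n + b) * d (n + b) = \<epsilon> b * B (n + i) a (n + b) * d (n + b)"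
      using B_antisym(1)[OF I(1)[OF a] iI I(2)[OF b]] \<epsilon>_simps(2)[OF b] by simp
  qed
  show "(\<Sum>j\<in>{n+1..2*n}. \<epsilon> j * B 0 (n + i) j * d j) = - (\<Sum>b=1..n. \<epsilon> b * f i b * d (n + b))"
    unfolding sum_minus sum_negf[symmetric]
    by (rule sum.cong[OF refl]) (simp add: \<epsilon>_simps B0i del: atLeastAtMost_iff)
  show "ric_sum (n + i) a = (\<Sum>b=1..n. \<epsilon> b * f i b * f a b)
      - (\<Sum>b=1..n. \<Sum>j=n+1..2*n. \<epsilon> b * \<epsilon> j * B b (n + i) j * B a j b)" if a: "a \<in> {1..n}"
  proof -
    have "(\<Sum>j=n+1..2*n. \<epsilon> 0 * \<epsilon> j * B 0 (n + i) j * B j a 0) = (\<Sum>b=1..n. \<epsilon> b * f i b * f a b)"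
      unfolding sum_minus
    proof (rule sum.cong[OF refl])
      fix b assume b: "b \<in> {1..n}"
      show "\<epsilon> 0 * \<epsilon> (n + b) * B 0 (n + i) (n + b) * B (n + b) a 0 = \<epsilon> b * f i b * f a b"
        using f_antisym[OF a b] \<epsilon>_simps(2)[OF b] by (simp add: \<epsilon>_simps(1) B0i[OF b] B_0(2)[OF b a])
    qed
    moreover have "(\<Sum>b=1..n. \<Sum>j=n+1..2*n. \<epsilon> b * \<epsilon> j * B b (n + i) j * B j a b) =
        (\<Sum>b=1..n. \<Sum>j=n+1..2*n. - (\<epsilon> b * \<epsilon> j * B b (n + i) j * B a j b))"
    proof (intro sum.cong refl)
      fix b j assume b: "b \<in> {1..n}" and "j \<in> {n+1..2*n}"
      then have "j \<in> {0..2*n}" by simp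
      then show "\<epsilon> b * \<epsilon> j * B b (n + i) j * B j a b = - (\<epsilon> b * \<epsilon> j * B b (n + i) j * B a j b)"
        using B_antisym(1)[OF I(1)[OF a] _ I(1)[OF b], of j] by simp
    qed
    ultimately show ?thesis unfolding ric_sum_def sum_plus by (simp add: sum_negf)
  qed
  show "ric_sum (n + i) 0 = (\<Sum>b=1..n. \<Sum>j=n+1..2*n. \<epsilon> b * \<epsilon> (j - n) * f (j - n) b * B b (n + i) j)"
  proof -
    have "(\<Sum>j=n+1..2*n. \<epsilon> 0 * \<epsilon> j * B 0 (n + i) j * B j 0 0) = 0"
      by (rule sum.neutral) (simp add: B00)
    moreover have "(\<Sum>b=1..n. \<Sum>j=n+1..2*n. \<epsilon> b * \<epsilon> j * B b (n + i) j * B j 0 b) =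
        (\<Sum>b=1..n. \<Sum>j=n+1..2*n. \<epsilon> b * \<epsilon> (j - n) * f (j - n) b * B b (n + i) j)"
      unfolding sum_minus
    proof (intro sum.cong refl)
      fix b c assume b: "b \<in> {1..n}" and c: "c \<in> {1..n}"
      have "B (n + c) 0 b = - f c b"
        using B_antisym(2)[OF I(2)[OF c] I(1)[OF b] I0] B_0(2)[OF c b] by simp
      then show "\<epsilon> b * \<epsilon> (n + c) * B b (n + i) (n + c) * B (n + c) 0 b =
          \<epsilon> b * \<epsilon> (n + c - n) * f (n + c - n) b * B b (n + i) (n + c)"
        using \<epsilon>_simps(2)[OF c] by simp
    qed
    ultimately show ?thesis unfolding ric_sum_def sum_plus by simp
  qed
qed

text \<open>The vanishing of plus and minus equations, recombined into the plus equations and the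
differences; \<open>0\<close> stands for the pairing with \<open>e 0\<close>.\<close>

lemma vanishing_pairs_iff:
  fixes p m :: "nat \<Rightarrow> nat \<Rightarrow> real"
  shows "(\<forall>i\<in>I. p i 0 = 0 \<and> m i 0 = 0 \<and> (\<forall>a\<in>I. p i a = 0 \<and> m i a = 0)) \<longleftrightarrow>
    (\<forall>a\<in>I. \<forall>i\<in>I. p i a = 0 \<and> p i 0 = 0 \<and> m a 0 - p a 0 = 0 \<and> p i a - m i a = 0)" (is "?L \<longleftrightarrow> ?R")
proof
  assume ?L
  then show ?R by simp
next
  assume R: ?R
  show ?L
  proof (intro ballI conjI)
    fix i assume i: "i \<in> I"
    show "p i 0 = 0" "m i 0 = 0" using bspec[OF bspec[OF R i] i] by simp_all
    fix a assume a: "a \<in> I"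
    show "p i a = 0" "m i a = 0" using bspec[OF bspec[OF R a] i] by simp_all
  qed
qed

lemma einstein_iff_equations:
  "odd_generalized_einstein G H F g \<delta> \<longleftrightarrow>
    (\<forall>a\<in>{1..n}. \<forall>i\<in>{n+1..2*n}.
       (\<Sum>b=1..n. (\<Sum>j=n+1..2*n. (\<epsilon> j * B b i j) * (\<epsilon> b * B a j b)) + (\<epsilon> b * B i a b) * d b)
         + f (i - n) a * d 0 - (\<Sum>b=1..n. \<epsilon> b * f (i - n) b * f a b) = 0 \<and>
       (\<Sum>b=1..n. \<epsilon> b * ((\<Sum>j=n+1..2*n. \<epsilon> (j - n) * f (j - n) b * B b i j)
         + f (i - n) b * d b)) = 0 \<and>
       (\<Sum>b=1..n. f a b * \<epsilon> b * (d b - d (b + n))) = 0 \<and>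
       (\<Sum>b=1..n. \<epsilon> b * (B i a b * d b - B i a (b + n) * d (b + n)))
         + d 0 * f (i - n) a = 0)"
proof -
  let ?E1 = "\<lambda>a i. (\<Sum>b=1..n. (\<Sum>j=n+1..2*n. (\<epsilon> j * B b i j) * (\<epsilon> b * B a j b)) + (\<epsilon> b * B i a b) * d b)
         + f (i - n) a * d 0 - (\<Sum>b=1..n. \<epsilon> b * f (i - n) b * f a b)"
  let ?E2 = "\<lambda>i. \<Sum>b=1..n. \<epsilon> b * ((\<Sum>j=n+1..2*n. \<epsilon> (j - n) * f (j - n) b * B b i j)
         + f (i - n) b * d b)"
  let ?E3 = "\<lambda>a. \<Sum>b=1..n. f a b * \<epsilon> b * (d b - d (b + n))"
  let ?E4 = "\<lambda>a i. (\<Sum>b=1..n. \<epsilon> b * (B i a b * d b - B i a (b + n) * d (b + n))) + d 0 * f (i - n) a"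
  let ?p = "\<lambda>i b. (\<Sum>c\<in>{0..n}. \<epsilon> c * B i b c * d c) - ric_sum i b"
  let ?m = "\<lambda>i b. (\<Sum>j\<in>{n+1..2*n}. \<epsilon> j * B b i j * d j) - ric_sum i b"
  have E: "?p (n + i) a = ?E1 a (n + i)" "?p (n + i) 0 = - ?E2 (n + i)"
    "?m (n + i) 0 - ?p (n + i) 0 = ?E3 i" "?p (n + i) a - ?m (n + i) a = ?E4 a (n + i)"
    if a: "a \<in> {1..n}" and i: "i \<in> {1..n}" for a i
  proof -
    note s = ric_sums[OF i]
    show "?p (n + i) a = ?E1 a (n + i)"
      unfolding s(1)[OF a] s(5)[OF a] by (simp add: sum.distrib mult_ac)
    show "?p (n + i) 0 = - ?E2 (n + i)"
      unfolding s(2) s(6) by (simp add: sum.distrib distrib_left sum_distrib_left mult_ac)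
    show "?m (n + i) 0 - ?p (n + i) 0 = ?E3 i"
      unfolding s(2) s(4) by (simp add: sum_subtractf right_diff_distrib mult_ac add.commute)
    show "?p (n + i) a - ?m (n + i) a = ?E4 a (n + i)"
      unfolding s(1)[OF a] s(3)[OF a] by (simp add: sum_subtractf right_diff_distrib mult_ac add.commute)
  qed
  have M: "i \<in> {n+1..2*n} \<longleftrightarrow> (\<exists>i'\<in>{1..n}. i = n + i')" for i
  proof
    assume "i \<in> {n+1..2*n}"
    then show "\<exists>i'\<in>{1..n}. i = n + i'" by (intro bexI[of _ "i - n"]) auto
  qed auto
  have Pl: "b \<in> {0..n} \<longleftrightarrow> b = 0 \<or> b \<in> {1..n}" for b by auto
  have "odd_generalized_einstein G H F g \<delta> \<longleftrightarrow>
      (\<forall>i\<in>{1..n}. ?p (n + i) 0 = 0 \<and> ?m (n + i) 0 = 0 \<and> (\<forall>a\<in>{1..n}. ?p (n + i) a = 0 \<and> ?m (n + i) a = 0))"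
    unfolding einstein_iff eq_iff_diff_eq_0[of _ "ric_sum _ _"] Ball_def M Pl by blast
  also have "\<dots> \<longleftrightarrow> (\<forall>a\<in>{1..n}. \<forall>i\<in>{1..n}. ?p (n + i) a = 0 \<and> ?p (n + i) 0 = 0 \<and>
      ?m (n + a) 0 - ?p (n + a) 0 = 0 \<and> ?p (n + i) a - ?m (n + i) a = 0)"
    by (rule vanishing_pairs_iff)
  also have "\<dots> \<longleftrightarrow> (\<forall>a\<in>{1..n}. \<forall>i\<in>{1..n}. ?E1 a (n + i) = 0 \<and> ?E2 (n + i) = 0 \<and> ?E3 a = 0 \<and> ?E4 a (n + i) = 0)"
  proof (intro ball_cong refl)
    fix a i assume a: "a \<in> {1..n}" and i: "i \<in> {1..n}"
    show "(?p (n + i) a = 0 \<and> ?p (n + i) 0 = 0 \<and> ?m (n + a) 0 - ?p (n + a) 0 = 0 \<and> ?p (n + i) a - ?m (n + i) a = 0)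
      \<longleftrightarrow> (?E1 a (n + i) = 0 \<and> ?E2 (n + i) = 0 \<and> ?E3 a = 0 \<and> ?E4 a (n + i) = 0)"
      unfolding E(3)[OF a a] E(4)[OF a i]
      unfolding E(1)[OF a i] E(2)[OF a i] neg_equal_0_iff_equal ..
  qed
  also have "\<dots> \<longleftrightarrow> (\<forall>a\<in>{1..n}. \<forall>i\<in>{n+1..2*n}. ?E1 a i = 0 \<and> ?E2 i = 0 \<and> ?E3 a = 0 \<and> ?E4 a i = 0)"
    unfolding Ball_def M by blast
  finally show ?thesis .
qed

end

theorem corollary20:
  fixes G :: "('a::{t2_space, second_countable_topology}, 'e::euclidean_space) lie_group"
    and n :: nat
    and H :: "'a form3" and F :: "'a form2" and g :: "'a form2"
    and \<delta> :: "'a sec \<Rightarrow> 'a fn" and v :: "nat \<Rightarrow> 'a vf"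
  defines "e \<equiv> induced_basis g n v"
  defines "\<epsilon> \<equiv> basis_sign G g n v"
  defines "\<delta>' \<equiv> \<lambda>A. \<delta> (e A) \<one>\<^bsub>G\<^esub>"
  defines "F' \<equiv> \<lambda>a b. F (v a) (v b) \<one>\<^bsub>G\<^esub>"
  defines "B \<equiv> dorfman_coeff G H F e"
  defines "Bup \<equiv> \<lambda>A B' C. \<epsilon> C * B A B' C"
  assumes "is_lie_group G" and "n = DIM('e)" and "n \<ge> 2"
    and "H \<in> three_forms G" and "left_inv3 G H"
    and "F \<in> two_forms G" and "left_inv2 G F"
    and "\<forall>X\<in>vfields G. \<forall>Y\<in>vfields G. \<forall>Z\<in>vfields G. d2 F X Y Z = 0"
    and "\<forall>X\<in>vfields G. \<forall>Y\<in>vfields G. \<forall>Z\<in>vfields G. \<forall>W\<in>vfields G.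
           d3 H X Y Z W + wedge22 F F X Y Z W = 0"
    and "pseudo_riemannian G g" and "left_inv2 G g"
    and "left_inv_divergence G \<delta>"
    and "lie_algebra_basis G n v" and "orthonormal g n v"
  shows "odd_generalized_einstein G H F g \<delta> \<longleftrightarrow>
    (\<forall>a\<in>{1..n}. \<forall>i\<in>{n+1..2*n}.
       (\<Sum>b=1..n. (\<Sum>j=n+1..2*n. Bup b i j * Bup a j b) + Bup i a b * \<delta>' b)
         + F' (i - n) a * \<delta>' 0 - (\<Sum>b=1..n. \<epsilon> b * F' (i - n) b * F' a b) = 0 \<and>
       (\<Sum>b=1..n. \<epsilon> b * ((\<Sum>j=n+1..2*n. \<epsilon> (j - n) * F' (j - n) b * B b i j)
         + F' (i - n) b * \<delta>' b)) = 0 \<and>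
       (\<Sum>b=1..n. F' a b * \<epsilon> b * (\<delta>' b - \<delta>' (b + n))) = 0 \<and>
       (\<Sum>b=1..n. \<epsilon> b * (B i a b * \<delta>' b - B i a (b + n) * \<delta>' (b + n)))
         + \<delta>' 0 * F' (i - n) a = 0)"
proof -
  have "is_atlas (charts G)" using assms(7) by (simp add: is_lie_group_def)
  then interpret invariant_divergence G n v H F g \<delta>
    using assms(7-) by unfold_locales auto
  show ?thesis
    unfolding Bup_def B_def F'_def \<delta>'_def \<epsilon>_def e_def by (rule einstein_iff_equations)
qed

end
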